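(* The Stiefel manifold $V_5\mathbb{R}^7=\mathrm{SO}(7)/\mathrm{SO}(2)$ admits at least six $\mathrm{SO}(7)$-invariant Einstein metrics that are pairwise distinct up to scaling by a positive constant. Two of them are Jensen's Einstein metrics. Another two are given by $\mathrm{Ad}(\mathrm{SO}(2)\times\mathrm{SO}(3)\times\mathrm{SO}(2))$-invariant scalar products on $\mathfrak{p}$ of the form $$x_1(-B)|_{\mathfrak{so}(2)}+x_2(-B)|_{\mathfrak{so}(3)}+x_{12}(-B)|_{\mathfrak{m}_{12}}+x_{13}(-B)|_{\mathfrak{m}_{13}}+x_{23}(-B)|_{\mathfrak{m}_{23}}$$ with all coefficients positive, where the decomposition of $\mathfrak{p}$ is the one for block sizes $(k_1,k_2,k_3)=(2,3,2)$. The remaining two are given by $\mathrm{Ad}(\mathrm{SO}(4)\times\mathrm{SO}(2))$-invariant scalar products on $\mathfrak{p}$ of the form $$x_2(-B)|_{\mathfrak{so}(4)}+x_{12}(-B)|_{\mathfrak{m}_{12}}+x_{13}(-B)|_{\mathfrak{m}_{13}}+x_{23}(-B)|_{\mathfrak{m}_{23}}$$ with all coefficients positive, where the decomposition of $\mathfrak{p}$ is the one for block sizes $(k_1,k_2,k_3)=(1,4,2)$.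
   Context: A Riemannian metric $g$ is Einstein if $\mathrm{Ric}_g=\lambda g$ for some $\lambda\in\mathbb{R}$. Let $G=\mathrm{SO}(7)$ and let $B(X,Y)=5\,\mathrm{tr}(XY)$ be the Killing form of $\mathfrak{so}(7)$, so that $-B$ is an $\mathrm{Ad}(G)$-invariant inner product. Let $H=\mathrm{SO}(2)$ be embedded in $G$ as the subgroup acting on the last two coordinates and fixing the first five. Let $\mathfrak{p}$ be the $(-B)$-orthogonal complement of $\mathfrak{h}=\mathfrak{so}(2)$ in $\mathfrak{so}(7)$, identified with the tangent space of $G/H$ at $eH$. The $G$-invariant metrics on $G/H$ correspond to $\mathrm{Ad}(H)$-invariant scalar products on $\mathfrak{p}$. For block sizes $(k_1,k_2,k_3)$ with $k_1+k_2+k_3=7$ and $k_3=2$, split $\{1,\dots,7\}$ into consecutive blocks $I_1,I_2,I_3$ of these sizes and write skew-symmetric matrices in the corresponding block form. For $a=1,2$ let $\mathfrak{so}(k_a)$ be the subalgebra of matrices supported in the diagonal block $I_a\times I_a$ (it is $0$ if $k_a=1$). For $1\le a<b\le 3$ let $\mathfrak{m}_{ab}$ be the subspace of skew-symmetric matrices whose only nonzero blocks are the $(a,b)$ block and, correspondingly, the $(b,a)$ block. Then $$\mathfrak{p}=\mathfrak{so}(k_1)\oplus\mathfrak{so}(k_2)\oplus\mathfrak{m}_{12}\oplus\mathfrak{m}_{13}\oplus\mathfrak{m}_{23}.$$ The group $\mathrm{SO}(k_1)\times\mathrm{SO}(k_2)\times\mathrm{SO}(k_3)$, embedded block-diagonally,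 acts on $\mathfrak{p}$ by $\mathrm{Ad}$. In the first displayed form, $\mathfrak{so}(2)$ denotes $\mathfrak{so}(k_1)\subset\mathfrak{p}$ (block $I_1$). Jensen's Einstein metrics on $V_5\mathbb{R}^7$ are (up to scale) the two $\mathrm{SO}(7)$-invariant Einstein metrics given, for block sizes $(2,3,2)$, by $x_{13}=x_{23}=1$ and $x_1=x_2=x_{12}=\dfrac{5\pm\sqrt{7}}{6}$. Equivalently, for block sizes $(1,4,2)$, they are given by $x_{13}=x_{23}=1$ and $x_2=x_{12}=\dfrac{5\pm\sqrt7}{6}$. *)

theory Defs
  imports "HOL-Analysis.Analysis"
begin

section \<open>Riemannian metrics in a coordinate domain\<close>

text \<open>
  A Riemannian metric on a neighbourhood of a point of a finite-dimensional vector space \<open>V\<close>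
  is given by a function \<open>g\<close>, where \<open>g x\<close> is the scalar product on \<open>V = T\<^sub>x V\<close>. Tangent
  vectors \<open>u \<in> V\<close> are identified with constant vector fields, which commute. \<open>V\<close> is a subspace
  of a Euclidean space; the ambient inner product plays no role in the geometry.
\<close>

definition dir_deriv :: "'a::real_normed_vector \<Rightarrow> ('a \<Rightarrow> 'b::real_normed_vector) \<Rightarrow> 'a \<Rightarrow> 'b" where
  "dir_deriv u f x = vector_derivative (\<lambda>t. f (x + t *\<^sub>R u)) (at 0)"

text \<open>
  The Levi-Civita derivative \<open>\<nabla>\<^sub>u v\<close> at \<open>x\<close> of the constant field \<open>v\<close>, i.e. the vector with
  components \<open>\<Gamma>\<^sup>k\<^sub>i\<^sub>j u\<^sup>i v\<^sup>j\<close>.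
\<close>

definition christoffel ::
  "'a::euclidean_space set \<Rightarrow> ('a \<Rightarrow> 'a \<Rightarrow> 'a \<Rightarrow> real) \<Rightarrow> 'a \<Rightarrow> 'a \<Rightarrow> 'a \<Rightarrow> 'a" where
  "christoffel V g x u v = (THE w. w \<in> V \<and> (\<forall>z\<in>V. g x w z =
     (dir_deriv u (\<lambda>y. g y v z) x + dir_deriv v (\<lambda>y. g y u z) x
        - dir_deriv z (\<lambda>y. g y u v) x) / 2))"

text \<open>\<open>R(u,v)w = \<nabla>\<^sub>u \<nabla>\<^sub>v w - \<nabla>\<^sub>v \<nabla>\<^sub>u w\<close> for constant \<open>u\<close>, \<open>v\<close>, \<open>w\<close>.\<close>

definition curvature ::
  "'a::euclidean_space set \<Rightarrow> ('a \<Rightarrow> 'a \<Rightarrow> 'a \<Rightarrow> real) \<Rightarrow> 'a \<Rightarrow> 'a \<Rightarrow> 'a \<Rightarrow> 'a \<Rightarrow> 'a" where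
  "curvature V g x u v w =
     dir_deriv u (\<lambda>y. christoffel V g y v w) x - dir_deriv v (\<lambda>y. christoffel V g y u w) x
     + christoffel V g x u (christoffel V g x v w) - christoffel V g x v (christoffel V g x u w)"

text \<open>
  The trace of a linear endomorphism of \<open>V\<close>, computed in an auxiliary basis that is
  orthonormal for the ambient inner product; it does not depend on the choice.
\<close>

definition trace_on :: "'a::euclidean_space set \<Rightarrow> ('a \<Rightarrow> 'a) \<Rightarrow> real" where
  "trace_on V L =
     (let B = (SOME B. B \<subseteq> V \<and> pairwise orthogonal B \<and> (\<forall>b\<in>B. norm b = 1) \<and> span B = V)
      in \<Sum>b\<in>B. L b \<bullet> b)"

definition ricci ::
  "'a::euclidean_space set \<Rightarrow> ('a \<Rightarrow> 'a \<Rightarrow> 'a \<Rightarrow> real) \<Rightarrow> 'a \<Rightarrow> 'a \<Rightarrow> 'a \<Rightarrow> real" where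
  "ricci V g x v w = trace_on V (\<lambda>u. curvature V g x u v w)"


section \<open>The homogeneous space \<open>SO(7)/SO(2)\<close>\<close>

type_synonym mat7 = "real^7^7"

text \<open>
  The index type \<open>7\<close> is ordered with least element \<open>0\<close> (and \<open>7 = 0\<close> in it). The coordinate
  called \<open>r \<in> {1,\<dots>,7}\<close> in the usual numbering is the index at position \<open>r - 1\<close>.
\<close>

definition pos :: "7 \<Rightarrow> nat" where
  "pos i = card {..<i}"

definition SO7 :: "mat7 set" where
  "SO7 = {A. orthogonal_matrix A \<and> det A = 1}"

definition so7 :: "mat7 set" where
  "so7 = {X. transpose X = - X}"

definition SO_on :: "7 set \<Rightarrow> mat7 set" where
  "SO_on I = {A \<in> SO7. \<forall>i. i \<notin> I \<longrightarrow> A *v axis i 1 = axis i 1}"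

definition so_on :: "7 set \<Rightarrow> mat7 set" where
  "so_on I = {X \<in> so7. \<forall>i j. X $ i $ j \<noteq> 0 \<longrightarrow> i \<in> I \<and> j \<in> I}"

definition Hgrp :: "mat7 set" where
  "Hgrp = SO_on {i. 5 \<le> pos i}"

definition hh :: "mat7 set" where
  "hh = so_on {i. 5 \<le> pos i}"

definition killing :: "mat7 \<Rightarrow> mat7 \<Rightarrow> real" where
  "killing X Y = 5 * trace (X ** Y)"

definition pp :: "mat7 set" where
  "pp = {X \<in> so7. \<forall>Y\<in>hh. - killing X Y = 0}"

definition proj_pp :: "mat7 \<Rightarrow> mat7" where
  "proj_pp X = (THE Y. Y \<in> pp \<and> X - Y \<in> hh)"

definition Ad :: "mat7 \<Rightarrow> mat7 \<Rightarrow> mat7" where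
  "Ad A X = A ** X ** matrix_inv A"


section \<open>Invariant metrics\<close>

type_synonym form7 = "mat7 \<Rightarrow> mat7 \<Rightarrow> real"

text \<open>Only the values of a form on \<open>pp \<times> pp\<close> are meaningful.\<close>

definition scalar_product_pp :: "form7 \<Rightarrow> bool" where
  "scalar_product_pp Q \<longleftrightarrow>
     (\<forall>X\<in>pp. \<forall>Y\<in>pp. Q X Y = Q Y X) \<and>
     (\<forall>X\<in>pp. \<forall>Y\<in>pp. \<forall>Z\<in>pp. Q (X + Y) Z = Q X Z + Q Y Z) \<and>
     (\<forall>c. \<forall>X\<in>pp. \<forall>Y\<in>pp. Q (c *\<^sub>R X) Y = c * Q X Y) \<and>
     (\<forall>X\<in>pp. X \<noteq> 0 \<longrightarrow> Q X X > 0)"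

definition Ad_invariant :: "mat7 set \<Rightarrow> form7 \<Rightarrow> bool" where
  "Ad_invariant K Q \<longleftrightarrow> (\<forall>A\<in>K. \<forall>X\<in>pp. \<forall>Y\<in>pp. Q (Ad A X) (Ad A Y) = Q X Y)"

text \<open>The \<open>SO(7)\<close>-invariant Riemannian metrics on \<open>SO(7)/SO(2)\<close>, as scalar products on
  \<open>pp = T\<^bsub>eH\<^esub>(G/H)\<close>.\<close>

definition invariant_metric :: "form7 \<Rightarrow> bool" where
  "invariant_metric Q \<longleftrightarrow> scalar_product_pp Q \<and> Ad_invariant Hgrp Q"

definition equal_on_pp :: "form7 \<Rightarrow> form7 \<Rightarrow> bool" where
  "equal_on_pp Q Q' \<longleftrightarrow> (\<forall>X\<in>pp. \<forall>Y\<in>pp. Q X Y = Q' X Y)"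

definition equal_up_to_scaling :: "form7 \<Rightarrow> form7 \<Rightarrow> bool" where
  "equal_up_to_scaling Q Q' \<longleftrightarrow> (\<exists>c>0. equal_on_pp Q (\<lambda>X Y. c * Q' X Y))"

text \<open>
  Charts of \<open>G/H\<close>: for \<open>A \<in> SO(7)\<close>, the map \<open>pp \<rightarrow> G/H\<close>, \<open>X \<mapsto> A c(X) H\<close>, where
  \<open>c(X) = (I - X/2)\<^sup>-\<^sup>1 (I + X/2)\<close> is the Cayley transform, is a diffeomorphism from a
  neighbourhood of \<open>0\<close> onto a neighbourhood of the point \<open>A H\<close>, because \<open>c(0) = I\<close> and the
  derivative of \<open>c\<close> at \<open>0\<close> is the identity.
\<close>

definition cayley :: "mat7 \<Rightarrow> mat7" where
  "cayley X = matrix_inv (mat 1 - (1/2) *\<^sub>R X) ** (mat 1 + (1/2) *\<^sub>R X)"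

definition lift_chart :: "mat7 \<Rightarrow> mat7 \<Rightarrow> mat7" where
  "lift_chart A X = A ** cayley X"

text \<open>
  The coordinate expression in this chart of the \<open>G\<close>-invariant metric determined by \<open>Q\<close>. The
  coordinate vector \<open>u\<close> at \<open>X\<close> corresponds to the image under \<open>G \<rightarrow> G/H\<close> of the tangent vector
  \<open>B'\<close>, the derivative of the lifted chart in direction \<open>u\<close>, at the group element \<open>B = A c(X)\<close>;
  the translation by \<open>B\<^sup>-\<^sup>1\<close> carries it to the \<open>pp\<close>-component of \<open>B\<^sup>-\<^sup>1 B'\<close> in \<open>T\<^bsub>eH\<^esub>(G/H)\<close>.
\<close>

definition chart_metric :: "form7 \<Rightarrow> mat7 \<Rightarrow> mat7 \<Rightarrow> mat7 \<Rightarrow> mat7 \<Rightarrow> real" where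
  "chart_metric Q A X u v =
     Q (proj_pp (matrix_inv (lift_chart A X) ** dir_deriv u (lift_chart A) X))
       (proj_pp (matrix_inv (lift_chart A X) ** dir_deriv v (lift_chart A) X))"

text \<open>\<open>Ric = \<lambda>g\<close> at every point \<open>A H\<close> of \<open>G/H\<close>, evaluated in the chart centred at that point.\<close>

definition einstein :: "form7 \<Rightarrow> bool" where
  "einstein Q \<longleftrightarrow> (\<exists>c::real. \<forall>A\<in>SO7. \<forall>u\<in>pp. \<forall>v\<in>pp.
     ricci pp (chart_metric Q A) 0 u v = c * chart_metric Q A 0 u v)"


section \<open>Block decompositions\<close>

text \<open>The blocks are numbered from \<open>1\<close>, and \<open>ks\<close> is the list of the block sizes.\<close>

definition block :: "nat list \<Rightarrow> nat \<Rightarrow> 7 set" where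
  "block ks a = {i. sum_list (take (a - 1) ks) \<le> pos i \<and> pos i < sum_list (take a ks)}"

definition block_group :: "nat list \<Rightarrow> mat7 set" where
  "block_group ks = {A1 ** A2 ** A3 | A1 A2 A3.
     A1 \<in> SO_on (block ks 1) \<and> A2 \<in> SO_on (block ks 2) \<and> A3 \<in> SO_on (block ks 3)}"

text \<open>
  The component of a skew-symmetric matrix in the summand \<open>so(k\<^sub>a)\<close> (for \<open>a = b\<close>) or
  \<open>m\<^sub>a\<^sub>b\<close> (for \<open>a < b\<close>), and the form \<open>(-B)\<close> restricted to that summand, extended by \<open>0\<close> to
  the other summands.
\<close>

definition component :: "nat list \<Rightarrow> nat \<Rightarrow> nat \<Rightarrow> mat7 \<Rightarrow> mat7" where
  "component ks a b X = (\<chi> i j.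
     if i \<in> block ks a \<and> j \<in> block ks b \<or> i \<in> block ks b \<and> j \<in> block ks a
     then X $ i $ j else 0)"

definition part_form :: "nat list \<Rightarrow> nat \<Rightarrow> nat \<Rightarrow> form7" where
  "part_form ks a b X Y = - killing (component ks a b X) (component ks a b Y)"

definition metric_232 :: "real \<Rightarrow> real \<Rightarrow> real \<Rightarrow> real \<Rightarrow> real \<Rightarrow> form7" where
  "metric_232 x1 x2 x12 x13 x23 X Y =
     x1 * part_form [2,3,2] 1 1 X Y + x2 * part_form [2,3,2] 2 2 X Y
     + x12 * part_form [2,3,2] 1 2 X Y + x13 * part_form [2,3,2] 1 3 X Y
     + x23 * part_form [2,3,2] 2 3 X Y"

definition metric_142 :: "real \<Rightarrow> real \<Rightarrow> real \<Rightarrow> real \<Rightarrow> form7" where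
  "metric_142 x2 x12 x13 x23 X Y =
     x2 * part_form [1,4,2] 2 2 X Y + x12 * part_form [1,4,2] 1 2 X Y
     + x13 * part_form [1,4,2] 1 3 X Y + x23 * part_form [1,4,2] 2 3 X Y"

definition jensen :: "real \<Rightarrow> form7" where
  "jensen t = metric_232 t t t 1 1"

end

theory Submission
  imports Defs
begin

text \<open>
  All metrics considered are diagonal in the matrix entries: on \<open>pp\<close> they have the form
  \<open>wform W X Y = (\<Sum>i j. W i j * X\<^sub>i\<^sub>j * Y\<^sub>i\<^sub>j)\<close>, with weights \<open>W\<close> that are constant on the
  blocks. The proof has a geometric part, the computation of the Ricci tensor from its
  definition by coordinates, and an algebraic part, the solution of the resulting equations.

  \<^emph>\<open>Geometry.\<close> In the Cayley chart the pullback of the Maurer-Cartan form is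
  \<open>(1 + X/2)\<^sup>-\<^sup>1 u (1 - X/2)\<^sup>-\<^sup>1\<close>, whatever the centre of the chart (\<open>mc_form_lift_chart\<close>). Its
  \<open>pp\<close>-component is a frame in which the metric is the constant form \<open>wform W\<close>. In such a frame
  the Levi-Civita connection is recognised by being skew and torsion-free
  (\<open>christoffel_frame\<close>), and these properties hold for Nomizu's connection by
  \<open>nomizu_coeff_skew\<close>, \<open>nomizu_coeff_torsion\<close> and the Maurer-Cartan equation. The curvature at
  the centre is then \<open>R(u,v)w = A(u) A(v) w - A(v) A(u) w - A([u,v]) w\<close> (\<open>curvature_frame\<close>),
  where second derivatives of the frame cancel by symmetry. Taking the trace entry by entry
  shows that the Ricci tensor is again diagonal, with explicit coefficients
  (\<open>ricci_invariant_metric\<close>). For block weights they are rational functions of the block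
  parameters (\<open>triple_term_sum_eq_ricci_coeff\<close>), and the metric is Einstein if they all
  coincide (\<open>einstein_block_weight\<close>).

  \<^emph>\<open>Algebra.\<close> Normalise \<open>x\<^sub>2\<^sub>3 = 1\<close>. Jensen's metrics solve the equations because of
  \<open>6 t\<^sup>2 - 10 t + 3 = 0\<close>. For the others, the parameters \<open>x\<^sub>1\<close> and \<open>x\<^sub>2\<close> enter some of the
  equations linearly and can be eliminated, which leaves two polynomial equations in
  \<open>a = x\<^sub>1\<^sub>2\<close> and \<open>b = x\<^sub>1\<^sub>3\<close>. Four explicit rectangles, two for each choice of block sizes,
  satisfy the sign conditions of the Poincare-Miranda theorem and therefore contain
  solutions. All of them lie away from \<open>b = 1\<close>, which is the value for Jensen's metrics. The
  ratios of the weights at four positions separate the six metrics up to scaling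
  (\<open>scaling_invariants\<close>).
\<close>

section \<open>Linear equations depending on a parameter\<close>

lemma has_vector_derivative_iff_quotient:
  "(f has_vector_derivative D) (at (0::real)) \<longleftrightarrow> ((\<lambda>t. (f t - f 0) /\<^sub>R t) \<longlongrightarrow> D) (at 0)"
proof -
  have "((\<lambda>t. norm (f t - f 0 - t *\<^sub>R D) / norm t) \<longlongrightarrow> 0) (at 0) \<longleftrightarrow>
      ((\<lambda>t. norm ((f t - f 0) /\<^sub>R t - D)) \<longlongrightarrow> 0) (at 0)"
  proof (rule tendsto_cong)
    show "\<forall>\<^sub>F t in at 0. norm (f t - f 0 - t *\<^sub>R D) / norm t = norm ((f t - f 0) /\<^sub>R t - D)"
    proof (rule eventually_at_topological[THEN iffD2], intro exI[of _ UNIV] conjI ballI impI)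
      fix t :: real assume "t \<noteq> 0"
      then have "(f t - f 0) /\<^sub>R t - D = (f t - f 0 - t *\<^sub>R D) /\<^sub>R t"
        by (simp add: scaleR_diff_right)
      then show "norm (f t - f 0 - t *\<^sub>R D) / norm t = norm ((f t - f 0) /\<^sub>R t - D)"
        by (simp add: divide_inverse mult.commute)
    qed auto
  qed
  then show ?thesis
    by (simp add: has_vector_derivative_def has_derivative_at_within has_derivative_def
        bounded_linear_scaleR_left tendsto_norm_zero_iff LIM_zero_iff divide_inverse
        tendsto_iff dist_norm norm_mult mult.commute)
qed

lemma linear_expand_basis:
  fixes f :: "'a::euclidean_space \<Rightarrow> 'b::real_vector"
  assumes "linear f"
  shows "f v = (\<Sum>e\<in>Basis. (v \<bullet> e) *\<^sub>R f e)"
proof -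
  have "f v = f (\<Sum>e\<in>Basis. (v \<bullet> e) *\<^sub>R e)"
    by (simp add: euclidean_representation)
  also have "\<dots> = (\<Sum>e\<in>Basis. (v \<bullet> e) *\<^sub>R f e)"
    using assms by (simp add: linear_sum linear_scale)
  finally show ?thesis .
qed

text \<open>
  A pointwise continuous family of linear maps on a finite-dimensional space is continuous
  in operator norm: on a basis there are only finitely many pointwise limits to control.
\<close>

lemma eventually_linear_perturbation:
  fixes T :: "real \<Rightarrow> 'a::euclidean_space \<Rightarrow> 'a"
  assumes lin: "\<And>t. linear (T t)"
    and cont: "\<And>v. ((\<lambda>t. T t v) \<longlongrightarrow> T 0 v) (at 0)"
    and "e > 0"
  shows "\<forall>\<^sub>F t in at 0. \<forall>v. norm (T t v - T 0 v) \<le> e * norm v"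
proof -
  define \<epsilon> where "\<epsilon> t = (\<Sum>b\<in>Basis. norm (T t b - T 0 b))" for t
  have le: "norm (T t v - T 0 v) \<le> \<epsilon> t * norm v" for t v
  proof -
    have "T t v - T 0 v = (\<Sum>b\<in>Basis. (v \<bullet> b) *\<^sub>R (T t b - T 0 b))"
      by (subst (1 2) linear_expand_basis[OF lin])
        (simp add: scaleR_diff_right sum_subtractf)
    also have "norm \<dots> \<le> (\<Sum>b\<in>Basis. norm v * norm (T t b - T 0 b))"
      by (rule sum_norm_le) (auto intro!: mult_right_mono Basis_le_norm)
    finally show ?thesis
      by (simp add: \<epsilon>_def sum_distrib_left mult.commute)
  qed
  have "(\<epsilon> \<longlongrightarrow> (\<Sum>b\<in>(Basis::'a set). norm (T 0 b - T 0 b))) (at 0)"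
    unfolding \<epsilon>_def by (intro tendsto_intros cont)
  then have "(\<epsilon> \<longlongrightarrow> 0) (at 0)" by simp
  then have "\<forall>\<^sub>F t in at 0. \<epsilon> t < e"
    using \<open>e > 0\<close> by (rule order_tendstoD(2))
  then show ?thesis
    by eventually_elim (meson le order_trans less_imp_le mult_right_mono norm_ge_zero)
qed

text \<open>
  Differentiating \<open>T x = b\<close> gives \<open>T x' = b' - T' x\<close>. Nothing is assumed about the regularity of
  \<open>x\<close>; its continuity comes first, from the bound \<open>norm (x t) \<le> 2 * norm (S (b t))\<close> near \<open>0\<close>, and
  then the difference quotient converges. The lemma yields the derivative of the inverse of
  a matrix and the derivative of the Christoffel symbols, which are only given implicitly.
\<close>

lemma has_vector_derivative_linear_solve:
  fixes T :: "real \<Rightarrow> 'a::euclidean_space \<Rightarrow> 'a"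
  assumes lin: "\<And>t. linear (T t)" and linS: "linear S" and ST: "\<And>v. S (T 0 v) = v"
    and dT: "\<And>v. ((\<lambda>t. T t v) has_vector_derivative T' v) (at 0)"
    and db: "(b has_vector_derivative b') (at 0)"
    and sol: "\<forall>\<^sub>F t in at 0. T t (x t) = b t" and sol0: "T 0 (x 0) = b 0"
  shows "(x has_vector_derivative S (b' - T' (x 0))) (at 0)"
proof -
  have blS: "bounded_linear S"
    using linS by (simp add: linear_conv_bounded_linear)
  have contT: "((\<lambda>t. T t v) \<longlongrightarrow> T 0 v) (at 0)" for v
    using has_vector_derivative_continuous[OF dT] by (simp add: continuous_within)
  have contb: "(b \<longlongrightarrow> b 0) (at 0)"
    using has_vector_derivative_continuous[OF db] by (simp add: continuous_within)
  have key: "x t - x 0 = S (b t - b 0) - S (T t (x t) - T 0 (x t))" if "T t (x t) = b t" for t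
  proof -
    have "S (b t - b 0) - S (T t (x t) - T 0 (x t)) = S (T 0 (x t)) - S (T 0 (x 0))"
      by (simp add: linear_diff[OF linS] that sol0)
    then show ?thesis by (simp add: ST)
  qed
  obtain K where K: "K > 0" "\<And>v. norm (S v) \<le> norm v * K"
    using bounded_linear.pos_bounded[OF blS] by blast
  have ev: "\<forall>\<^sub>F t in at 0. norm (S (T t (x t) - T 0 (x t))) \<le> e * norm (x t)" if "e > 0" for e
  proof -
    have "\<forall>\<^sub>F t in at 0. \<forall>v. norm (T t v - T 0 v) \<le> (e / K) * norm v"
      by (rule eventually_linear_perturbation[OF lin contT]) (use K that in auto)
    then show ?thesis
    proof eventually_elim
      case (elim t)
      have "norm (S (T t (x t) - T 0 (x t))) \<le> norm (T t (x t) - T 0 (x t)) * K" by (rule K)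
      also have "\<dots> \<le> (e / K) * norm (x t) * K"
        using elim K by (intro mult_right_mono) auto
      also have "\<dots> = e * norm (x t)" using K by simp
      finally show ?case .
    qed
  qed
  have x_lim: "(x \<longlongrightarrow> x 0) (at 0)"
  proof -
    have "((\<lambda>t. x t - x 0) \<longlongrightarrow> 0) (at 0)"
    proof (rule tendsto_norm_zero_cancel, rule tendsto_0_le[where K = 1])
      have "((\<lambda>t. norm (S (b t))) \<longlongrightarrow> norm (S (b 0))) (at 0)"
        by (intro tendsto_norm bounded_linear.tendsto[OF blS] contb)
      then have bnd: "\<forall>\<^sub>F t in at 0. norm (S (b t)) < norm (S (b 0)) + 1"
        by (rule order_tendstoD(2)) simp
      define C where "C = 2 * (norm (S (b 0)) + 1)"
      have C: "C > 0" unfolding C_def by (smt (verit) norm_ge_zero)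
      have xb: "\<forall>\<^sub>F t in at 0. norm (x t) \<le> C"
        using bnd ev[of "1/2", simplified] sol
      proof eventually_elim
        case (elim t)
        have "x t = S (b t) - S (T t (x t) - T 0 (x t))"
          using key[OF elim(3)] by (simp add: linear_diff[OF linS] sol0[symmetric] ST)
        then have "norm (x t) \<le> norm (S (b t)) + norm (S (T t (x t) - T 0 (x t)))"
          by (metis norm_triangle_ineq4)
        then show ?case using elim by (simp add: C_def)
      qed
      show "((\<lambda>t. norm (S (b t - b 0)) + norm (S (T t (x t) - T 0 (x t)))) \<longlongrightarrow> 0) (at 0)"
      proof (rule tendsto_add_zero)
        have "((\<lambda>t. b t - b 0) \<longlongrightarrow> 0) (at 0)" using contb by (simp add: LIM_zero_iff)
        from bounded_linear.tendsto[OF blS this]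
        show "((\<lambda>t. norm (S (b t - b 0))) \<longlongrightarrow> 0) (at 0)"
          by (simp add: tendsto_norm_zero linear_0[OF linS])
        show "((\<lambda>t. norm (S (T t (x t) - T 0 (x t)))) \<longlongrightarrow> 0) (at 0)"
        proof (rule tendstoI)
          fix e :: real assume "e > 0"
          then have "\<forall>\<^sub>F t in at 0. norm (S (T t (x t) - T 0 (x t))) \<le> e / (2 * C) * norm (x t)"
            using C by (intro ev) simp
          then show "\<forall>\<^sub>F t in at 0. dist (norm (S (T t (x t) - T 0 (x t)))) 0 < e"
            using xb
          proof eventually_elim
            case (elim t)
            have "e / (2 * C) * norm (x t) \<le> e / (2 * C) * C"
              using elim C \<open>e > 0\<close> by (intro mult_left_mono) auto
            also have "\<dots> = e / 2" using C by simp
            finally have "norm (S (T t (x t) - T 0 (x t))) \<le> e / 2"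
              by (rule order_trans[OF elim(1)])
            then show ?case using \<open>e > 0\<close> by simp
          qed
        qed
      qed
      show "\<forall>\<^sub>F t in at 0. norm (norm (x t - x 0))
          \<le> norm (norm (S (b t - b 0)) + norm (S (T t (x t) - T 0 (x t)))) * 1"
        using sol
      proof eventually_elim
        case (elim t)
        show ?case unfolding key[OF elim]
          using norm_triangle_ineq4[of "S (b t - b 0)" "S (T t (x t) - T 0 (x t))"] by simp
      qed
    qed
    then show ?thesis by (simp add: LIM_zero_iff)
  qed
  \<comment> \<open>The pointwise derivative inherits linearity from \<open>T\<close>.\<close>
  have T'lin: "T' v = (\<Sum>e\<in>Basis. (v \<bullet> e) *\<^sub>R T' e)" for v
  proof -
    have "((\<lambda>t. \<Sum>e\<in>Basis. (v \<bullet> e) *\<^sub>R T t e) has_vector_derivative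
        (\<Sum>e\<in>Basis. (v \<bullet> e) *\<^sub>R T' e)) (at 0)"
      by (rule has_vector_derivative_sum)
        (rule bounded_linear.has_vector_derivative[OF bounded_linear_scaleR_right dT])
    then have "((\<lambda>t. T t v) has_vector_derivative (\<Sum>e\<in>Basis. (v \<bullet> e) *\<^sub>R T' e)) (at 0)"
      by (simp flip: linear_expand_basis[OF lin])
    then show ?thesis
      using dT vector_derivative_at by metis
  qed
  have "((\<lambda>t. S ((b t - b 0) /\<^sub>R t) - S (\<Sum>e\<in>Basis. (x t \<bullet> e) *\<^sub>R ((T t e - T 0 e) /\<^sub>R t)))
      \<longlongrightarrow> S b' - S (\<Sum>e\<in>Basis. (x 0 \<bullet> e) *\<^sub>R T' e)) (at 0)"
    by (intro tendsto_intros bounded_linear.tendsto[OF blS] x_lim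
        dT[unfolded has_vector_derivative_iff_quotient]
        db[unfolded has_vector_derivative_iff_quotient])
  moreover have "\<forall>\<^sub>F t in at 0.
      S ((b t - b 0) /\<^sub>R t) - S (\<Sum>e\<in>Basis. (x t \<bullet> e) *\<^sub>R ((T t e - T 0 e) /\<^sub>R t))
      = (x t - x 0) /\<^sub>R t"
    using sol
  proof eventually_elim
    case (elim t)
    have "(\<Sum>e\<in>Basis. (x t \<bullet> e) *\<^sub>R ((T t e - T 0 e) /\<^sub>R t))
        = ((\<Sum>e\<in>Basis. (x t \<bullet> e) *\<^sub>R T t e) - (\<Sum>e\<in>Basis. (x t \<bullet> e) *\<^sub>R T 0 e)) /\<^sub>R t"
      by (simp add: scaleR_diff_right sum_subtractf scaleR_sum_right mult.commute)
    also have "\<dots> = (T t (x t) - T 0 (x t)) /\<^sub>R t"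
      by (simp flip: linear_expand_basis[OF lin])
    finally have quot: "(\<Sum>e\<in>Basis. (x t \<bullet> e) *\<^sub>R ((T t e - T 0 e) /\<^sub>R t))
        = (T t (x t) - T 0 (x t)) /\<^sub>R t" .
    show ?case
      unfolding quot key[OF elim] linear_scale[OF linS] by (simp add: scaleR_diff_right)
  qed
  ultimately have "((\<lambda>t. (x t - x 0) /\<^sub>R t) \<longlongrightarrow> S b' - S (\<Sum>e\<in>Basis. (x 0 \<bullet> e) *\<^sub>R T' e)) (at 0)"
    by (rule Lim_transform_eventually)
  then show ?thesis
    by (simp add: has_vector_derivative_iff_quotient T'lin[symmetric] linear_diff[OF linS])
qed

section \<open>The Levi-Civita connection in a moving frame\<close>

text \<open>
  Here \<open>\<theta> y\<close> identifies the tangent space at \<open>y\<close> with the fixed space \<open>V\<close> carrying the fixed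
  scalar product \<open>Q\<close>, and \<open>C u\<close> is the connection form in direction \<open>u\<close> in this trivialisation. If
  \<open>C\<close> is skew for \<open>Q\<close> and has no torsion, then it is the Levi-Civita connection. The proof is
  the Koszul computation: with \<open>N u v = D u v + C u (\<theta> x v)\<close>, which is symmetric, the
  derivative of \<open>g a b\<close> in direction \<open>z\<close> is \<open>Q (N z a) (\<theta> x b) + Q (\<theta> x a) (N z b)\<close>, and the
  alternating sum in the definition of the Christoffel symbols collapses to
  \<open>2 * Q (N u v) (\<theta> x z)\<close>.
\<close>

lemma christoffel_frame:
  fixes V :: "'a::euclidean_space set" and Q :: "'a \<Rightarrow> 'a \<Rightarrow> real"
  assumes V: "subspace V" and x: "x \<in> V"
    and Q: "bounded_bilinear Q" and Qsym: "\<And>a b. Q a b = Q b a" and Qpos: "\<And>a. a \<noteq> 0 \<Longrightarrow> Q a a > 0"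
    and g: "\<And>y a b. y \<in> V \<Longrightarrow> a \<in> V \<Longrightarrow> b \<in> V \<Longrightarrow> g y a b = Q (\<theta> y a) (\<theta> y b)"
    and d\<theta>: "\<And>z a. z \<in> V \<Longrightarrow> a \<in> V \<Longrightarrow> ((\<lambda>s. \<theta> (x + s *\<^sub>R z) a) has_vector_derivative D z a) (at 0)"
    and \<theta>lin: "linear (\<theta> x)" and \<theta>V: "\<And>a. a \<in> V \<Longrightarrow> \<theta> x a \<in> V"
    and \<theta>inj: "\<And>a. a \<in> V \<Longrightarrow> \<theta> x a = 0 \<Longrightarrow> a = 0"
    and skew: "\<And>u a b. u \<in> V \<Longrightarrow> a \<in> V \<Longrightarrow> b \<in> V \<Longrightarrow> Q (C u a) b = - Q a (C u b)"
    and torsion: "\<And>u v. u \<in> V \<Longrightarrow> v \<in> V \<Longrightarrow> D u v + C u (\<theta> x v) = D v u + C v (\<theta> x u)"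
    and u: "u \<in> V" and v: "v \<in> V" and w: "w \<in> V" "\<theta> x w = D u v + C u (\<theta> x v)"
  shows "christoffel V g x u v = w"
proof -
  interpret Q: bounded_bilinear Q by (rule Q)
  define N where "N u v = D u v + C u (\<theta> x v)" for u v
  have Nsym: "N u v = N v u" if "u \<in> V" "v \<in> V" for u v
    using torsion[OF that] by (simp add: N_def)
  have dg: "dir_deriv z (\<lambda>y. g y a b) x = Q (N z a) (\<theta> x b) + Q (\<theta> x a) (N z b)"
    if z: "z \<in> V" and a: "a \<in> V" and b: "b \<in> V" for z a b
  proof -
    have "((\<lambda>s. Q (\<theta> (x + s *\<^sub>R z) a) (\<theta> (x + s *\<^sub>R z) b)) has_vector_derivative
        Q (\<theta> (x + 0 *\<^sub>R z) a) (D z b) + Q (D z a) (\<theta> (x + 0 *\<^sub>R z) b)) (at 0)"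
      by (rule Q.has_vector_derivative[OF d\<theta>[OF z a] d\<theta>[OF z b]])
    moreover have "(\<lambda>s. Q (\<theta> (x + s *\<^sub>R z) a) (\<theta> (x + s *\<^sub>R z) b)) = (\<lambda>s. g (x + s *\<^sub>R z) a b)"
      using V x z a b by (simp add: g subspace_add subspace_scale)
    ultimately have "dir_deriv z (\<lambda>y. g y a b) x = Q (\<theta> x a) (D z b) + Q (D z a) (\<theta> x b)"
      unfolding dir_deriv_def by (intro vector_derivative_at) simp
    then show ?thesis
      using skew[OF z \<theta>V[OF a] \<theta>V[OF b]] by (simp add: N_def Q.add_left Q.add_right)
  qed
  have koszul: "g x w z = (dir_deriv u (\<lambda>y. g y v z) x + dir_deriv v (\<lambda>y. g y u z) x
        - dir_deriv z (\<lambda>y. g y u v) x) / 2" if z: "z \<in> V" for z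
    using Nsym[OF u v] Nsym[OF u z] Nsym[OF v z] Qsym[of "N z v"] Qsym[of "N z u"]
    by (simp add: dg u v z g x w flip: N_def)
  show ?thesis
    unfolding christoffel_def
  proof (rule the_equality)
    show "w \<in> V \<and> (\<forall>z\<in>V. g x w z = (dir_deriv u (\<lambda>y. g y v z) x + dir_deriv v (\<lambda>y. g y u z) x
        - dir_deriv z (\<lambda>y. g y u v) x) / 2)"
      using w koszul by blast
    fix w' assume w': "w' \<in> V \<and> (\<forall>z\<in>V. g x w' z = (dir_deriv u (\<lambda>y. g y v z) x
        + dir_deriv v (\<lambda>y. g y u z) x - dir_deriv z (\<lambda>y. g y u v) x) / 2)"
    have d: "w' - w \<in> V" using V w w' by (simp add: subspace_diff)
    have "g x w' (w' - w) = g x w (w' - w)"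
      by (rule trans[OF conjunct2[OF w', rule_format, OF d] koszul[OF d, symmetric]])
    then have "Q (\<theta> x (w' - w)) (\<theta> x (w' - w)) = 0"
      using x w w' d by (simp add: g linear_diff[OF \<theta>lin] Q.diff_left Q.diff_right)
    then have "\<theta> x (w' - w) = 0" using Qpos by force
    then show "w' = w" using \<theta>inj[OF d] by simp
  qed
qed

text \<open>
  In the trivialisation \<open>\<theta>\<close> the connection form is \<open>A (\<omega> y u)\<close>, so the curvature at \<open>0\<close> is its
  exterior derivative plus its commutator. The second derivatives of \<open>\<theta>\<close> enter only through
  \<open>DD\<close>, whose symmetry makes them cancel; this is why the metric never has to be expanded to
  second order.
\<close>

lemma curvature_frame:
  fixes V :: "'a::euclidean_space set"
  assumes V: "subspace V"
    and \<theta>lin: "\<And>y. linear (\<theta> y)" and \<theta>0: "\<And>a. \<theta> 0 a = a"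
    and \<omega>0: "\<And>a. a \<in> V \<Longrightarrow> \<omega> 0 a = a"
    and d\<theta>: "\<And>u a. u \<in> V \<Longrightarrow> ((\<lambda>t. \<theta> (t *\<^sub>R u) a) has_vector_derivative D 0 u a) (at 0)"
    and d\<omega>: "\<And>u v. u \<in> V \<Longrightarrow> v \<in> V \<Longrightarrow> ((\<lambda>t. \<omega> (t *\<^sub>R u) v) has_vector_derivative D\<omega> u v) (at 0)"
    and dD: "\<And>u v w. u \<in> V \<Longrightarrow> v \<in> V \<Longrightarrow> w \<in> V \<Longrightarrow>
      ((\<lambda>t. D (t *\<^sub>R u) v w) has_vector_derivative DD u v w) (at 0)"
    and DD: "\<And>u v w. u \<in> V \<Longrightarrow> v \<in> V \<Longrightarrow> w \<in> V \<Longrightarrow> DD u v w = DD v u w"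
    and A: "bounded_bilinear A"
    and DV: "\<And>v w. v \<in> V \<Longrightarrow> w \<in> V \<Longrightarrow> D 0 v w \<in> V"
    and AV: "\<And>v w. v \<in> V \<Longrightarrow> w \<in> V \<Longrightarrow> A v w \<in> V"
    and \<Gamma>: "\<And>u v w. u \<in> V \<Longrightarrow> v \<in> V \<Longrightarrow> w \<in> V \<Longrightarrow> \<forall>\<^sub>F t in nhds 0.
      \<theta> (t *\<^sub>R u) (christoffel V g (t *\<^sub>R u) v w)
        = D (t *\<^sub>R u) v w + A (\<omega> (t *\<^sub>R u) v) (\<theta> (t *\<^sub>R u) w)"
    and u: "u \<in> V" and v: "v \<in> V" and w: "w \<in> V"
  shows "curvature V g 0 u v w = A (D\<omega> u v - D\<omega> v u) w + A u (A v w) - A v (A u w)"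
proof -
  interpret A: bounded_bilinear A by (rule A)
  have \<Gamma>0: "christoffel V g 0 a b = D 0 a b + A a b" if "a \<in> V" "b \<in> V" for a b
    using eventually_nhds_x_imp_x[OF \<Gamma>[OF that(1) that]] that by (simp add: \<theta>0 \<omega>0)
  have \<Gamma>V: "christoffel V g 0 a b \<in> V" if "a \<in> V" "b \<in> V" for a b
    using that V by (simp add: \<Gamma>0 DV AV subspace_add)
  have d\<Gamma>: "dir_deriv a (\<lambda>y. christoffel V g y b w) 0
      = DD a b w + A (D\<omega> a b) w + A b (D 0 a w) - D 0 a (christoffel V g 0 b w)"
    if a: "a \<in> V" and b: "b \<in> V" for a b
  proof -
    have rhs: "((\<lambda>t. D (t *\<^sub>R a) b w + A (\<omega> (t *\<^sub>R a) b) (\<theta> (t *\<^sub>R a) w)) has_vector_derivative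
       DD a b w + (A (\<omega> (0 *\<^sub>R a) b) (D 0 a w) + A (D\<omega> a b) (\<theta> (0 *\<^sub>R a) w))) (at 0)"
      by (intro has_vector_derivative_add dD A.has_vector_derivative d\<omega> d\<theta> a b w)
    have "((\<lambda>t. christoffel V g (t *\<^sub>R a) b w) has_vector_derivative
        id ((DD a b w + (A (\<omega> (0 *\<^sub>R a) b) (D 0 a w) + A (D\<omega> a b) (\<theta> (0 *\<^sub>R a) w)))
          - D 0 a (christoffel V g (0 *\<^sub>R a) b w))) (at 0)"
    proof (rule has_vector_derivative_linear_solve[where T = "\<lambda>t. \<theta> (t *\<^sub>R a)" and T' = "D 0 a"])
      show "linear (\<theta> (t *\<^sub>R a))" for t by (rule \<theta>lin)
      show "linear (id :: 'a \<Rightarrow> 'a)" by (rule linear_id)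
      show "id (\<theta> (0 *\<^sub>R a) y) = y" for y by (simp add: \<theta>0)
      show "((\<lambda>t. \<theta> (t *\<^sub>R a) y) has_vector_derivative D 0 a y) (at 0)" for y by (rule d\<theta>[OF a])
      show "((\<lambda>t. D (t *\<^sub>R a) b w + A (\<omega> (t *\<^sub>R a) b) (\<theta> (t *\<^sub>R a) w)) has_vector_derivative
       DD a b w + (A (\<omega> (0 *\<^sub>R a) b) (D 0 a w) + A (D\<omega> a b) (\<theta> (0 *\<^sub>R a) w))) (at 0)"
        by (rule rhs)
      show "\<forall>\<^sub>F t in at 0. \<theta> (t *\<^sub>R a) (christoffel V g (t *\<^sub>R a) b w)
          = D (t *\<^sub>R a) b w + A (\<omega> (t *\<^sub>R a) b) (\<theta> (t *\<^sub>R a) w)"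
        using \<Gamma>[OF a b w] by (simp add: eventually_at_filter eventually_mono)
      show "\<theta> (0 *\<^sub>R a) (christoffel V g (0 *\<^sub>R a) b w)
          = D (0 *\<^sub>R a) b w + A (\<omega> (0 *\<^sub>R a) b) (\<theta> (0 *\<^sub>R a) w)"
        using eventually_nhds_x_imp_x[OF \<Gamma>[OF a b w]] by simp
    qed
    then show ?thesis
      unfolding dir_deriv_def by (subst vector_derivative_at) (auto simp: \<theta>0 \<omega>0 b add_ac)
  qed
  show ?thesis
    unfolding curvature_def d\<Gamma>[OF u v] d\<Gamma>[OF v u] \<Gamma>0[OF u \<Gamma>V[OF v w]] \<Gamma>0[OF v \<Gamma>V[OF u w]]
    unfolding \<Gamma>0[OF v w] \<Gamma>0[OF u w] DD[OF u v w]
    by (simp add: A.add_right A.diff_left)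
qed

text \<open>
  For a map with values in \<open>V\<close> the trace on \<open>V\<close> equals the trace on the whole space. Summing
  over the standard basis avoids choosing a basis of \<open>V\<close>.
\<close>

lemma trace_on_eq_sum:
  fixes T :: "'a::euclidean_space \<Rightarrow> 'a"
  assumes V: "subspace V" and T: "linear T" and TV: "\<And>a. T a \<in> V"
    and L: "\<And>a. a \<in> V \<Longrightarrow> L a = T a"
  shows "trace_on V L = (\<Sum>e\<in>Basis. T e \<bullet> e)"
proof -
  let ?P = "\<lambda>B. B \<subseteq> V \<and> pairwise orthogonal B \<and> (\<forall>b\<in>B. norm b = 1) \<and> span B = V"
  define B where "B = (SOME B. ?P B)"
  have "\<exists>B. ?P B"
    by (rule orthonormal_basis_subspace[OF V]) blast
  then have "?P B" unfolding B_def by (rule someI_ex)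
  then have B: "B \<subseteq> V" "pairwise orthogonal B" "\<And>b. b \<in> B \<Longrightarrow> norm b = 1" "span B = V" by auto
  then have "0 \<notin> B" by force
  then have "independent B" using B(2) pairwise_orthogonal_independent by blast
  then have fin: "finite B" by (rule independent_imp_finite)
  have expand: "y \<bullet> e = (\<Sum>b\<in>B. (b \<bullet> e) * (y \<bullet> b))" if "y \<in> V" for y e
  proof -
    have "y = (\<Sum>b\<in>B. (y \<bullet> b) *\<^sub>R b)"
      using orthonormal_basis_expand[OF B(2,3) _ fin, of y] that B(4) by metis
    then have "y \<bullet> e = (\<Sum>b\<in>B. (y \<bullet> b) *\<^sub>R b) \<bullet> e" by metis
    then show ?thesis by (simp add: inner_sum_left mult.commute)
  qed
  have "trace_on V L = (\<Sum>b\<in>B. L b \<bullet> b)"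
    by (simp add: trace_on_def B_def)
  also have "\<dots> = (\<Sum>b\<in>B. T b \<bullet> b)"
    using B(1) L by (intro sum.cong) auto
  also have "\<dots> = (\<Sum>b\<in>B. \<Sum>e\<in>Basis. (b \<bullet> e) * (T e \<bullet> b))"
    by (subst linear_expand_basis[OF T]) (simp add: inner_sum_left)
  also have "\<dots> = (\<Sum>e\<in>Basis. \<Sum>b\<in>B. (b \<bullet> e) * (T e \<bullet> b))"
    by (rule sum.swap)
  also have "\<dots> = (\<Sum>e\<in>Basis. T e \<bullet> e)"
    by (intro sum.cong refl) (simp add: expand TV)
  finally show ?thesis .
qed

section \<open>Skew-symmetric matrices and the tangent space\<close>

lemma bounded_bilinear_matrix_matrix_mult:
  "bounded_bilinear ((**) :: real^'n^'m \<Rightarrow> real^'p^'n \<Rightarrow> real^'p^'m)"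
proof -
  have "bilinear ((**) :: real^'n^'m \<Rightarrow> real^'p^'n \<Rightarrow> real^'p^'m)"
    unfolding bilinear_def
    by (auto intro!: linearI simp: vec_eq_iff matrix_matrix_mult_def sum.distrib algebra_simps
        sum_distrib_left)
  then show ?thesis by (simp add: bilinear_conv_bounded_bilinear)
qed

interpretation mm: bounded_bilinear "(**) :: mat7 \<Rightarrow> mat7 \<Rightarrow> mat7"
  by (rule bounded_bilinear_matrix_matrix_mult)

lemmas mat_distrib = mm.add_left mm.add_right mm.diff_left mm.diff_right mm.minus_left mm.minus_right
  mm.scaleR_left mm.scaleR_right matrix_mul_assoc

lemma matrix_inv_eqI:
  fixes A B :: "'a::semiring_1^'n^'n"
  assumes "A ** B = mat 1" "B ** A = mat 1"
  shows "matrix_inv A = B"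
proof -
  have "A ** matrix_inv A = mat 1 \<and> matrix_inv A ** A = mat 1"
    unfolding matrix_inv_def by (rule someI[of _ B]) (use assms in simp)
  then show ?thesis
    by (metis assms(2) matrix_mul_assoc matrix_mul_lid matrix_mul_rid)
qed

text \<open>
  The positions of the matrix entries that may be nonzero for an element of \<open>pp\<close>.
\<close>

definition pp_pair :: "7 \<Rightarrow> 7 \<Rightarrow> bool" where
  "pp_pair i j \<longleftrightarrow> i \<noteq> j \<and> \<not> (5 \<le> pos i \<and> 5 \<le> pos j)"

definition pp_part :: "mat7 \<Rightarrow> mat7" where
  "pp_part X = (\<chi> i j. if pp_pair i j then X $ i $ j else 0)"

lemma pp_pair_sym: "pp_pair i j \<longleftrightarrow> pp_pair j i"
  by (auto simp: pp_pair_def)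

lemma pp_part_nth [simp]: "pp_part X $ i $ j = (if pp_pair i j then X $ i $ j else 0)"
  by (simp add: pp_part_def)

text \<open>
  The symmetric form \<open>X $ i $ j + X $ j $ i = 0\<close> is preferred to \<open>X $ j $ i = - X $ i $ j\<close>,
  because the latter loops as a rewrite rule.
\<close>

lemma so7_iff: "X \<in> so7 \<longleftrightarrow> (\<forall>i j. X $ i $ j + X $ j $ i = 0)"
  by (simp add: so7_def vec_eq_iff transpose_def eq_neg_iff_add_eq_0 add.commute)

lemma so7D: "X \<in> so7 \<Longrightarrow> X $ j $ i = - X $ i $ j"
  by (simp add: so7_iff eq_neg_iff_add_eq_0)

lemma so7_diag: "X \<in> so7 \<Longrightarrow> X $ i $ i = 0"
  using so7D[of X i i] by simp

lemma hh_iff: "X \<in> hh \<longleftrightarrow> X \<in> so7 \<and> (\<forall>i j. X $ i $ j \<noteq> 0 \<longrightarrow> 5 \<le> pos i \<and> 5 \<le> pos j)"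
  by (simp add: hh_def so_on_def)

lemma killing_eq_sum: "killing X Y = 5 * (\<Sum>i\<in>UNIV. \<Sum>j\<in>UNIV. X $ i $ j * Y $ j $ i)"
  by (simp add: killing_def trace_def matrix_matrix_mult_def)

definition elem_skew :: "7 \<Rightarrow> 7 \<Rightarrow> mat7" where
  "elem_skew i j = (\<chi> a b. (if a = i \<and> b = j then 1 else 0) - (if a = j \<and> b = i then 1 else 0))"

lemma elem_skew_hh: "5 \<le> pos i \<Longrightarrow> 5 \<le> pos j \<Longrightarrow> i \<noteq> j \<Longrightarrow> elem_skew i j \<in> hh"
  unfolding hh_iff so7_iff elem_skew_def by (simp split: if_split)

text \<open>
  Testing against these matrices reads off single entries, which turns the orthogonality
  that defines \<open>pp\<close> into the vanishing of entries.
\<close>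

lemma killing_elem_skew: "killing X (elem_skew i j) = 5 * (X $ j $ i - X $ i $ j)"
proof -
  have "X $ a $ b * elem_skew i j $ b $ a = (if b = i then if a = j then X $ a $ b else 0 else 0)
      - (if b = j then if a = i then X $ a $ b else 0 else 0)" for a b
    by (simp add: elem_skew_def)
  then show ?thesis
    by (simp add: killing_eq_sum sum_subtractf)
qed

lemma pp_iff: "X \<in> pp \<longleftrightarrow> X \<in> so7 \<and> (\<forall>i j. \<not> pp_pair i j \<longrightarrow> X $ i $ j = 0)"
proof
  assume X: "X \<in> pp"
  then have so: "X \<in> so7" by (simp add: pp_def)
  have "X $ i $ j = 0" if np: "\<not> pp_pair i j" for i j
  proof (cases "i = j")
    case True
    then show ?thesis using so7_diag[OF so, of j] by simp
  next
    case False
    then have "elem_skew i j \<in> hh" using np by (intro elem_skew_hh) (auto simp: pp_pair_def)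
    with X have "- killing X (elem_skew i j) = 0" unfolding pp_def by blast
    then show ?thesis using so7D[OF so, of j i] by (simp add: killing_elem_skew)
  qed
  then show "X \<in> so7 \<and> (\<forall>i j. \<not> pp_pair i j \<longrightarrow> X $ i $ j = 0)" using so by blast
next
  assume X: "X \<in> so7 \<and> (\<forall>i j. \<not> pp_pair i j \<longrightarrow> X $ i $ j = 0)"
  have "killing X Y = 0" if "Y \<in> hh" for Y
  proof -
    have "X $ i $ j * Y $ j $ i = 0" for i j
    proof (cases "Y $ j $ i = 0")
      case False
      then have "\<not> pp_pair i j" using that unfolding hh_iff pp_pair_def by blast
      then show ?thesis using X by simp
    qed simp
    note zero = this
    show ?thesis unfolding killing_eq_sum zero by simp
  qed
  then show "X \<in> pp" using X by (simp add: pp_def)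
qed

lemma subspace_so7: "subspace so7"
proof (unfold subspace_def, intro conjI ballI allI)
  show "0 \<in> so7" by (simp add: so7_iff)
  show "X + Y \<in> so7" if X: "X \<in> so7" and Y: "Y \<in> so7" for X Y
  proof (unfold so7_iff, intro allI)
    fix i j
    show "(X + Y) $ i $ j + (X + Y) $ j $ i = 0"
      using so7D[OF X, of i j] so7D[OF Y, of i j] by simp
  qed
  show "c *\<^sub>R X \<in> so7" if X: "X \<in> so7" for X c
  proof (unfold so7_iff, intro allI)
    fix i j
    show "(c *\<^sub>R X) $ i $ j + (c *\<^sub>R X) $ j $ i = 0"
      using so7D[OF X, of i j] by simp
  qed
qed

lemma subspace_pp: "subspace pp"
  using subspace_0[OF subspace_so7] subspace_add[OF subspace_so7] subspace_scale[OF subspace_so7]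
  by (simp add: subspace_def pp_iff Ball_def)

lemma pp_so7: "X \<in> pp \<Longrightarrow> X \<in> so7"
  by (simp add: pp_iff)

lemma pp_part_pp: "X \<in> so7 \<Longrightarrow> pp_part X \<in> pp"
  by (auto simp: pp_iff so7_iff pp_pair_def)

lemma pp_part_id: "X \<in> pp \<Longrightarrow> pp_part X = X"
  by (auto simp: pp_iff vec_eq_iff)

lemma pp_part_pp_part [simp]: "pp_part (pp_part X) = pp_part X"
  by (simp add: vec_eq_iff)

lemma linear_pp_part: "linear pp_part"
  by (auto intro!: linearI simp: vec_eq_iff)

lemma bounded_linear_pp_part: "bounded_linear pp_part"
  using linear_pp_part by (simp add: linear_conv_bounded_linear)

lemma proj_pp_eq_pp_part:
  assumes "X \<in> so7"
  shows "proj_pp X = pp_part X"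
  unfolding proj_pp_def
proof (rule the_equality)
  show "pp_part X \<in> pp \<and> X - pp_part X \<in> hh"
    using assms pp_part_pp[OF assms] subspace_diff[OF subspace_so7 assms, of "pp_part X"] so7_diag[OF assms]
    by (auto simp: hh_iff pp_so7 pp_pair_def split: if_splits)
  fix Y assume Y: "Y \<in> pp \<and> X - Y \<in> hh"
  have "Y $ i $ j = pp_part X $ i $ j" for i j
  proof (cases "pp_pair i j")
    case True
    then have "(X - Y) $ i $ j = 0" using Y by (auto simp: hh_iff pp_pair_def)
    then show ?thesis using True by simp
  next
    case False
    then show ?thesis using Y by (simp add: pp_iff)
  qed
  then show "Y = pp_part X" by (simp add: vec_eq_iff)
qed

section \<open>The Cayley transform and the Maurer-Cartan form\<close>

definition resolvent :: "mat7 \<Rightarrow> mat7" where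
  "resolvent X = matrix_inv (mat 1 - (1/2) *\<^sub>R X)"

text \<open>
  A skew matrix has no eigenvalue \<open>2\<close>, since \<open>(X x) \<bullet> x = 0\<close>. Hence the Cayley transform is
  defined on all of \<open>so7\<close>, and no neighbourhood of \<open>0\<close> has to be singled out.
\<close>

lemma resolvent_inverse:
  assumes "X \<in> so7"
  shows "resolvent X ** (mat 1 - (1/2) *\<^sub>R X) = mat 1" "(mat 1 - (1/2) *\<^sub>R X) ** resolvent X = mat 1"
proof -
  let ?A = "mat 1 - (1/2) *\<^sub>R X"
  have "x = 0" if "?A *v x = 0" for x
  proof -
    have "(X *v x) \<bullet> x = x \<bullet> (transpose X *v x)"
      by (metis dot_lmul_matrix inner_commute transpose_matrix_vector)
    moreover have "transpose X = - X" using assms by (simp add: so7_def)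
    moreover have "(- X) *v x = - (X *v x)"
      by (simp add: matrix_vector_mult_def vec_eq_iff sum_negf)
    ultimately have "(X *v x) \<bullet> x = - ((X *v x) \<bullet> x)"
      by (metis inner_commute inner_minus_right)
    then have "(X *v x) \<bullet> x = 0" by simp
    then have "(?A *v x) \<bullet> x = x \<bullet> x"
      by (simp add: matrix_vector_mult_diff_rdistrib inner_diff_left scaleR_matrix_vector_assoc[symmetric])
    then show ?thesis using that by simp
  qed
  then obtain B where "B ** ?A = mat 1"
    using matrix_left_invertible_ker by blast
  moreover from this have "?A ** B = mat 1" by (simp add: matrix_left_right_inverse)
  ultimately show "resolvent X ** ?A = mat 1" "?A ** resolvent X = mat 1"
    using matrix_inv_eqI[of ?A B] by (simp_all add: resolvent_def)
qed

lemma uminus_so7: "X \<in> so7 \<Longrightarrow> - X \<in> so7"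
  by (simp add: subspace_neg[OF subspace_so7])

lemma resolvent_0 [simp]: "resolvent 0 = mat 1"
  unfolding resolvent_def by (rule matrix_inv_eqI) simp_all

lemma transpose_resolvent:
  assumes "X \<in> so7"
  shows "transpose (resolvent X) = resolvent (- X)"
proof -
  have X: "transpose (mat 1 - (1/2) *\<^sub>R X) = mat 1 - (1/2) *\<^sub>R (- X)"
  proof -
    have "transpose X = - X" using assms by (simp add: so7_def)
    moreover have "transpose (mat 1 - (1/2) *\<^sub>R X) = mat 1 - (1/2) *\<^sub>R transpose X"
      by (simp add: vec_eq_iff transpose_def mat_def)
    ultimately show ?thesis by simp
  qed
  have "matrix_inv (mat 1 - (1/2) *\<^sub>R (- X)) = transpose (resolvent X)"
    by (rule matrix_inv_eqI)
      (simp_all only: X[symmetric] matrix_transpose_mul[symmetric] resolvent_inverse[OF assms] transpose_mat)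
  then show ?thesis by (simp add: resolvent_def)
qed

text \<open>
  The resolvent identity for \<open>X\<close> and \<open>- X\<close>. It is what makes the Maurer-Cartan equation below
  come out exactly.
\<close>

lemma resolvent_plus_resolvent:
  assumes X: "X \<in> so7"
  shows "resolvent X + resolvent (- X) = 2 *\<^sub>R (resolvent X ** resolvent (- X))" "resolvent X + resolvent (- X) = 2 *\<^sub>R (resolvent (- X) ** resolvent X)"
proof -
  have *: "resolvent X + resolvent (- X) = 2 *\<^sub>R (resolvent X ** resolvent (- X))" if X: "X \<in> so7" for X
  proof -
    have "resolvent X ** ((mat 1 - (1/2) *\<^sub>R (- X)) + (mat 1 - (1/2) *\<^sub>R X)) ** resolvent (- X) = resolvent X + resolvent (- X)"
      using resolvent_inverse[OF X] resolvent_inverse[OF uminus_so7[OF X]]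
      by (simp only: mm.add_left mm.add_right matrix_mul_lid flip: matrix_mul_assoc)
        (simp add: matrix_mul_assoc)
    moreover have "(mat 1 - (1/2) *\<^sub>R (- X)) + (mat 1 - (1/2) *\<^sub>R X) = 2 *\<^sub>R mat 1"
      by (simp add: scaleR_2)
    ultimately show ?thesis by (simp add: mat_distrib)
  qed
  show "resolvent X + resolvent (- X) = 2 *\<^sub>R (resolvent X ** resolvent (- X))" by (rule *[OF X])
  show "resolvent X + resolvent (- X) = 2 *\<^sub>R (resolvent (- X) ** resolvent X)"
    using *[OF uminus_so7[OF X]] by (simp add: add.commute)
qed

lemma has_vector_derivative_resolvent:
  assumes X: "X \<in> so7" and Z: "Z \<in> so7"
  shows "((\<lambda>s. resolvent (X + s *\<^sub>R Z)) has_vector_derivative (1/2) *\<^sub>R (resolvent X ** Z ** resolvent X)) (at 0)"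
proof -
  have so: "X + s *\<^sub>R Z \<in> so7" for s
    using X Z subspace_so7 by (simp add: subspace_add subspace_scale)
  have "((\<lambda>s. resolvent (X + s *\<^sub>R Z)) has_vector_derivative
      resolvent X ** (0 - (- (1/2) *\<^sub>R Z) ** resolvent (X + 0 *\<^sub>R Z))) (at 0)"
  proof (rule has_vector_derivative_linear_solve[where
        T = "\<lambda>s Y. (mat 1 - (1/2) *\<^sub>R (X + s *\<^sub>R Z)) ** Y" and T' = "\<lambda>Y. (- (1/2) *\<^sub>R Z) ** Y"])
    show "linear ((**) (mat 1 - (1/2) *\<^sub>R (X + s *\<^sub>R Z)) :: mat7 \<Rightarrow> mat7)" for s
      using mm.bounded_linear_right by (simp add: linear_conv_bounded_linear)
    show "linear ((**) (resolvent X) :: mat7 \<Rightarrow> mat7)"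
      using mm.bounded_linear_right by (simp add: linear_conv_bounded_linear)
    show "resolvent X ** ((mat 1 - (1/2) *\<^sub>R (X + 0 *\<^sub>R Z)) ** Y) = Y" for Y :: mat7
      using resolvent_inverse[OF X] by (simp add: matrix_mul_assoc)
    show "((\<lambda>s. (mat 1 - (1/2) *\<^sub>R (X + s *\<^sub>R Z)) ** Y) has_vector_derivative (- (1/2) *\<^sub>R Z) ** Y) (at 0)" for Y :: mat7
    proof -
      have "((\<lambda>s. (mat 1 - (1/2) *\<^sub>R X) ** Y + s *\<^sub>R ((- (1/2) *\<^sub>R Z) ** Y)) has_vector_derivative
          0 + (0 *\<^sub>R 0 + 1 *\<^sub>R ((- (1/2) *\<^sub>R Z) ** Y))) (at 0)"
        by (intro derivative_intros)
      moreover have "(\<lambda>s. (mat 1 - (1/2) *\<^sub>R X) ** Y + s *\<^sub>R ((- (1/2) *\<^sub>R Z) ** Y))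
          = (\<lambda>s. (mat 1 - (1/2) *\<^sub>R (X + s *\<^sub>R Z)) ** Y)"
        by (rule ext) (simp add: mat_distrib scaleR_add_right algebra_simps)
      ultimately show ?thesis by simp
    qed
    show "((\<lambda>s. mat 1) has_vector_derivative 0) (at 0)" by simp
    show "\<forall>\<^sub>F s in at 0. (mat 1 - (1/2) *\<^sub>R (X + s *\<^sub>R Z)) ** resolvent (X + s *\<^sub>R Z) = mat 1"
      by (rule always_eventually) (use resolvent_inverse[OF so] in blast)
    show "(mat 1 - (1/2) *\<^sub>R (X + 0 *\<^sub>R Z)) ** resolvent (X + 0 *\<^sub>R Z) = mat 1"
      using resolvent_inverse[OF X] by simp
  qed
  then show ?thesis by (simp add: mat_distrib)
qed

text \<open>
  With \<open>c\<close> the Cayley transform, \<open>mc_form X u\<close> is \<open>c(X)\<^sup>-\<^sup>1 (d\<^sub>u c)(X)\<close>, the pullback of the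
  left-invariant Maurer-Cartan form; \<open>mc_deriv\<close> and \<open>mc_deriv2\<close> are its first derivative and its
  second derivative at \<open>0\<close>.
\<close>

definition mc_form :: "mat7 \<Rightarrow> mat7 \<Rightarrow> mat7" where
  "mc_form X u = resolvent (- X) ** u ** resolvent X"

definition mc_deriv :: "mat7 \<Rightarrow> mat7 \<Rightarrow> mat7 \<Rightarrow> mat7" where
  "mc_deriv X z u = (1/2) *\<^sub>R (resolvent (- X) ** u ** resolvent X ** z ** resolvent X - resolvent (- X) ** z ** resolvent (- X) ** u ** resolvent X)"

lemma mc_form_0 [simp]: "mc_form 0 u = u"
  by (simp add: mc_form_def)

lemma linear_mc_form: "linear (mc_form X)"
  unfolding mc_form_def by (intro linearI) (simp_all add: mat_distrib)

lemma mc_form_so7: "X \<in> so7 \<Longrightarrow> u \<in> so7 \<Longrightarrow> mc_form X u \<in> so7"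
  using transpose_resolvent[of X] transpose_resolvent[OF uminus_so7, of X]
  by (simp add: so7_def mc_form_def matrix_transpose_mul mat_distrib)

lemma has_vector_derivative_resolvent_uminus:
  assumes "X \<in> so7" "Z \<in> so7"
  shows "((\<lambda>s. resolvent (- (X + s *\<^sub>R Z))) has_vector_derivative - ((1/2) *\<^sub>R (resolvent (- X) ** Z ** resolvent (- X)))) (at 0)"
  using has_vector_derivative_resolvent[OF uminus_so7[OF assms(1)] uminus_so7[OF assms(2)]]
  by (simp add: mat_distrib)

lemma has_vector_derivative_mc_form:
  assumes "X \<in> so7" "Z \<in> so7"
  shows "((\<lambda>s. mc_form (X + s *\<^sub>R Z) u) has_vector_derivative mc_deriv X Z u) (at 0)"
proof -
  have "((\<lambda>s. resolvent (- (X + s *\<^sub>R Z)) ** (u ** resolvent (X + s *\<^sub>R Z))) has_vector_derivative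
      resolvent (- (X + 0 *\<^sub>R Z)) ** (u ** ((1/2) *\<^sub>R (resolvent X ** Z ** resolvent X)))
      + (- ((1/2) *\<^sub>R (resolvent (- X) ** Z ** resolvent (- X)))) ** (u ** resolvent (X + 0 *\<^sub>R Z))) (at 0)"
    by (intro mm.has_vector_derivative has_vector_derivative_resolvent_uminus
        bounded_linear.has_vector_derivative[OF mm.bounded_linear_right] has_vector_derivative_resolvent assms)
  then show ?thesis
    by (simp add: mc_form_def mc_deriv_def mat_distrib scaleR_diff_right)
qed

text \<open>
  The equation \<open>d\<omega> + \<omega> \<and> \<omega> = 0\<close>. After factoring out the outer resolvents, the difference
  contains the sum of the resolvents of \<open>X\<close> and \<open>- X\<close>, which is twice their product.
\<close>

lemma maurer_cartan:
  assumes "X \<in> so7"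
  shows "mc_deriv X u v - mc_deriv X v u = - (mc_form X u ** mc_form X v - mc_form X v ** mc_form X u)"
proof -
  let ?P = "resolvent X" and ?M = "resolvent (- X)"
  have "2 *\<^sub>R (mc_deriv X u v - mc_deriv X v u)
      = ?M ** v ** (?P + ?M) ** u ** ?P - ?M ** u ** (?P + ?M) ** v ** ?P"
    by (simp add: mc_deriv_def mat_distrib scaleR_diff_right)
  also have "\<dots> = 2 *\<^sub>R (mc_form X v ** mc_form X u - mc_form X u ** mc_form X v)"
    unfolding resolvent_plus_resolvent(1)[OF assms]
    by (simp add: mc_form_def mat_distrib scaleR_diff_right)
  finally show ?thesis by simp
qed

definition mc_deriv2 :: "mat7 \<Rightarrow> mat7 \<Rightarrow> mat7 \<Rightarrow> mat7" where
  "mc_deriv2 u v w = (1/4) *\<^sub>R ((w ** u ** v + w ** v ** u) + (u ** v ** w + v ** u ** w) - (u ** w ** v + v ** w ** u))"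

text \<open>
  The symmetry by which the second derivatives cancel in \<open>curvature_frame\<close>.
\<close>

lemma mc_deriv2_sym: "mc_deriv2 u v w = mc_deriv2 v u w"
  by (simp add: mc_deriv2_def add.commute)

lemma has_vector_derivative_mc_deriv:
  assumes u: "u \<in> so7"
  shows "((\<lambda>t. mc_deriv (t *\<^sub>R u) v w) has_vector_derivative mc_deriv2 u v w) (at 0)"
proof -
  have so0: "0 \<in> so7" by (simp add: subspace_0[OF subspace_so7])
  have P: "((\<lambda>t. resolvent (t *\<^sub>R u)) has_vector_derivative (1/2) *\<^sub>R u) (at 0)"
    and M: "((\<lambda>t. resolvent (- (t *\<^sub>R u))) has_vector_derivative - ((1/2) *\<^sub>R u)) (at 0)"
    using has_vector_derivative_resolvent[OF so0 u] has_vector_derivative_resolvent_uminus[OF so0 u] by simp_all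
  have eq: "mc_deriv X v w = (1/2) *\<^sub>R (resolvent (- X) ** (w ** (resolvent X ** (v ** resolvent X)))
      - resolvent (- X) ** (v ** (resolvent (- X) ** (w ** resolvent X))))" for X
    by (simp add: mc_deriv_def matrix_mul_assoc)
  note left = bounded_linear.has_vector_derivative[OF mm.bounded_linear_right]
  have "((\<lambda>t. (1/2) *\<^sub>R (resolvent (- (t *\<^sub>R u)) ** (w ** (resolvent (t *\<^sub>R u) ** (v ** resolvent (t *\<^sub>R u))))
      - resolvent (- (t *\<^sub>R u)) ** (v ** (resolvent (- (t *\<^sub>R u)) ** (w ** resolvent (t *\<^sub>R u))))))
    has_vector_derivative (1/2) *\<^sub>R
      ((resolvent (- (0 *\<^sub>R u)) ** (w ** (resolvent (0 *\<^sub>R u) ** (v ** ((1/2) *\<^sub>R u))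
          + ((1/2) *\<^sub>R u) ** (v ** resolvent (0 *\<^sub>R u))))
        + (- ((1/2) *\<^sub>R u)) ** (w ** (resolvent (0 *\<^sub>R u) ** (v ** resolvent (0 *\<^sub>R u)))))
      - (resolvent (- (0 *\<^sub>R u)) ** (v ** (resolvent (- (0 *\<^sub>R u)) ** (w ** ((1/2) *\<^sub>R u))
          + (- ((1/2) *\<^sub>R u)) ** (w ** resolvent (0 *\<^sub>R u))))
        + (- ((1/2) *\<^sub>R u)) ** (v ** (resolvent (- (0 *\<^sub>R u)) ** (w ** resolvent (0 *\<^sub>R u))))))) (at 0)"
    by (rule bounded_linear.has_vector_derivative[OF bounded_linear_scaleR_right]
        has_vector_derivative_diff mm.has_vector_derivative P M left)+
  then have "((\<lambda>t. mc_deriv (t *\<^sub>R u) v w) has_vector_derivative (1/2) *\<^sub>R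
      ((w ** (v ** ((1/2) *\<^sub>R u) + ((1/2) *\<^sub>R u) ** v) + (- ((1/2) *\<^sub>R u)) ** (w ** v))
      - (v ** (w ** ((1/2) *\<^sub>R u) + (- ((1/2) *\<^sub>R u)) ** w) + (- ((1/2) *\<^sub>R u)) ** (v ** w)))) (at 0)"
    by (simp only: eq scaleR_zero_left minus_zero resolvent_0 matrix_mul_lid matrix_mul_rid)
  then show ?thesis
    by (rule has_vector_derivative_eq_rhs) (simp add: mc_deriv2_def mat_distrib algebra_simps)
qed

section \<open>The connection of a weighted scalar product\<close>

text \<open>
  A bilinear map that multiplies the contribution of the entry pair \<open>(i, k)\<close>, \<open>(k, j)\<close> to the
  entry \<open>(i, j)\<close> by \<open>L i k j\<close> and then antisymmetrises. All maps needed below are of this form: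
  the Lie bracket, its projection to \<open>pp\<close>, and the connection of an invariant metric. The
  subtracted term uses \<open>x $ j $ k * y $ k $ i\<close> instead of \<open>y $ i $ k * x $ k $ j\<close>, which is the
  same on skew matrices, so that the value is skew for arbitrary \<open>x\<close> and \<open>y\<close>; the traces below
  need that.
\<close>

definition wbracket :: "(7 \<Rightarrow> 7 \<Rightarrow> 7 \<Rightarrow> real) \<Rightarrow> mat7 \<Rightarrow> mat7 \<Rightarrow> mat7" where
  "wbracket L x y = (\<chi> i j. \<Sum>k\<in>UNIV. L i k j * x $ i $ k * y $ k $ j - L j k i * x $ j $ k * y $ k $ i)"

lemma wbracket_nth: "wbracket L x y $ i $ j = (\<Sum>k\<in>UNIV. L i k j * x $ i $ k * y $ k $ j - L j k i * x $ j $ k * y $ k $ i)"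
  by (simp add: wbracket_def)

lemma bounded_bilinear_wbracket: "bounded_bilinear (wbracket L)"
proof -
  have "bilinear (wbracket L)"
    unfolding bilinear_def
    by (auto intro!: linearI simp: vec_eq_iff wbracket_nth sum.distrib[symmetric] sum_distrib_left algebra_simps
        intro!: sum.cong)
  then show ?thesis by (simp add: bilinear_conv_bounded_bilinear)
qed

lemma wbracket_pp:
  assumes "\<And>i k j. \<not> pp_pair i j \<Longrightarrow> L i k j = 0"
  shows "wbracket L x y \<in> pp"
proof -
  have "wbracket L x y $ i $ j + wbracket L x y $ j $ i = 0" for i j
    unfolding wbracket_nth sum.distrib[symmetric] by simp
  moreover have "wbracket L x y $ i $ j = 0" if "\<not> pp_pair i j" for i j
    using that assms[of i j] assms[of j i] pp_pair_sym[of i j] by (simp add: wbracket_nth)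
  ultimately show ?thesis by (simp add: pp_iff so7_iff)
qed

definition off_diag :: "7 \<Rightarrow> 7 \<Rightarrow> 7 \<Rightarrow> real" where
  "off_diag i k j = (if i = j then 0 else 1)"

lemma wbracket_off_diag:
  assumes "x \<in> so7" "y \<in> so7"
  shows "wbracket off_diag x y = x ** y - y ** x"
proof -
  have "wbracket off_diag x y $ i $ j = (x ** y - y ** x) $ i $ j" for i j
  proof (cases "i = j")
    case False
    have "x $ j $ k * y $ k $ i = y $ i $ k * x $ k $ j" for k
      using so7D[OF assms(1), of j k] so7D[OF assms(2), of k i] by simp
    then show ?thesis
      using False by (simp add: wbracket_nth off_diag_def matrix_matrix_mult_def sum_subtractf)
  next
    case True
    have "x $ j $ k * y $ k $ j = y $ j $ k * x $ k $ j" for k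
      using so7D[OF assms(1), of j k] so7D[OF assms(2), of k j] by simp
    then show ?thesis
      using True by (simp add: wbracket_nth off_diag_def matrix_matrix_mult_def)
  qed
  then show ?thesis by (simp add: vec_eq_iff)
qed

definition wform :: "(7 \<Rightarrow> 7 \<Rightarrow> real) \<Rightarrow> form7" where
  "wform W X Y = (\<Sum>i\<in>UNIV. \<Sum>j\<in>UNIV. W i j * X $ i $ j * Y $ i $ j)"

lemma bounded_bilinear_wform: "bounded_bilinear (wform W)"
proof -
  have "bilinear (wform W)"
    unfolding bilinear_def
    by (auto intro!: linearI simp: wform_def sum.distrib[symmetric] sum_distrib_left algebra_simps
        intro!: sum.cong)
  then show ?thesis by (simp add: bilinear_conv_bounded_bilinear)
qed

lemma wform_sym: "wform W X Y = wform W Y X"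
  by (simp add: wform_def mult.commute mult.left_commute)

lemma wform_pos:
  assumes "\<And>i j. W i j > 0" "X \<noteq> 0"
  shows "wform W X X > 0"
proof -
  obtain a b where ab: "X $ a $ b \<noteq> 0" using assms(2) by (auto simp: vec_eq_iff)
  have nn: "W i j * X $ i $ j * X $ i $ j \<ge> 0" for i j
    using assms(1)[of i j] by (simp add: mult.assoc)
  have "W a b * X $ a $ b * X $ a $ b > 0"
    using assms(1)[of a b] ab by (simp add: mult.assoc zero_less_mult_iff linorder_neq_iff) blast
  then have "(\<Sum>j\<in>UNIV. W a j * X $ a $ j * X $ a $ j) > 0"
    by (rule sum_pos2[where i = b, rotated 2]) (use nn in auto)
  moreover have "(\<Sum>j\<in>UNIV. W i j * X $ i $ j * X $ i $ j) \<ge> 0" for i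
    by (rule sum_nonneg) (rule nn)
  ultimately show ?thesis
    unfolding wform_def by (rule sum_pos2[where i = a, rotated 2]) auto
qed

text \<open>
  The coefficients of Nomizu's map \<open>\<Lambda>(x) y = 1/2 [x, y]\<^sub>p + U(x, y)\<close> for \<open>x\<close> in \<open>pp\<close>, and of the
  isotropy action \<open>[x, y]\<close> for \<open>x\<close> in \<open>hh\<close>. For a scalar product that is diagonal in the entries,
  with weights \<open>W\<close>, the Koszul formula gives the quotient for the first.
\<close>

definition nomizu_coeff :: "(7 \<Rightarrow> 7 \<Rightarrow> real) \<Rightarrow> 7 \<Rightarrow> 7 \<Rightarrow> 7 \<Rightarrow> real" where
  "nomizu_coeff W i k j = (if \<not> pp_pair i j then 0
     else if pp_pair i k then (W i j + W k j - W i k) / (2 * W i j) else 1)"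

text \<open>
  Positivity and symmetry make \<open>W\<close> the weights of a scalar product, and the last condition
  says that the product on \<open>pp\<close> is invariant under \<open>SO(2)\<close>.
\<close>

definition adapted :: "(7 \<Rightarrow> 7 \<Rightarrow> real) \<Rightarrow> bool" where
  "adapted W \<longleftrightarrow> (\<forall>i j. W i j > 0) \<and> (\<forall>i j. W i j = W j i) \<and>
    (\<forall>i k j. 5 \<le> pos i \<longrightarrow> 5 \<le> pos k \<longrightarrow> pos j < 5 \<longrightarrow> W i j = W k j)"

lemma nomizu_coeff_pp: "wbracket (nomizu_coeff W) x y \<in> pp"
  by (rule wbracket_pp) (simp add: nomizu_coeff_def)

text \<open>
  The two terms of the antisymmetrised bracket contribute equally, by skewness of \<open>z\<close>.
\<close>

lemma wform_wbracket:
  assumes "\<And>i j. W i j = W j i" "z \<in> so7"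
  shows "wform W (wbracket L x y) z
    = 2 * (\<Sum>i\<in>UNIV. \<Sum>k\<in>UNIV. \<Sum>j\<in>UNIV. W i j * L i k j * x $ i $ k * y $ k $ j * z $ i $ j)"
proof -
  let ?f = "\<lambda>i j k. W i j * L i k j * x $ i $ k * y $ k $ j * z $ i $ j"
  have "W i j * wbracket L x y $ i $ j * z $ i $ j = (\<Sum>k\<in>UNIV. ?f i j k) + (\<Sum>k\<in>UNIV. ?f j i k)" for i j
    using so7D[OF assms(2), of i j] assms(1)[of i j]
    by (simp add: wbracket_nth sum_distrib_left sum_distrib_right sum.distrib[symmetric] algebra_simps)
  then have "wform W (wbracket L x y) z = (\<Sum>i\<in>UNIV. \<Sum>j\<in>UNIV. \<Sum>k\<in>UNIV. ?f i j k) + (\<Sum>i\<in>UNIV. \<Sum>j\<in>UNIV. \<Sum>k\<in>UNIV. ?f j i k)"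
    by (simp add: wform_def sum.distrib)
  also have "(\<Sum>i\<in>UNIV. \<Sum>j\<in>UNIV. \<Sum>k\<in>UNIV. ?f j i k) = (\<Sum>i\<in>UNIV. \<Sum>j\<in>UNIV. \<Sum>k\<in>UNIV. ?f i j k)"
    by (rule sum.swap)
  also have "(\<Sum>i\<in>UNIV. \<Sum>j\<in>UNIV. \<Sum>k\<in>UNIV. ?f i j k) = (\<Sum>i\<in>UNIV. \<Sum>k\<in>UNIV. \<Sum>j\<in>UNIV. ?f i j k)"
    by (intro sum.cong refl sum.swap)
  finally show ?thesis by simp
qed

text \<open>
  Exchanging \<open>y\<close> and \<open>z\<close> exchanges the summation indices \<open>i\<close> and \<open>k\<close>. For \<open>(i, k)\<close> in \<open>pp\<close> the numerator
  of the coefficient is symmetric under this exchange, and for \<open>(i, k)\<close> in \<open>hh\<close> the weights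
  agree because \<open>W\<close> is adapted.
\<close>

lemma nomizu_coeff_skew:
  assumes W: "adapted W" and x: "x \<in> so7" and y: "y \<in> pp" and z: "z \<in> pp"
  shows "wform W (wbracket (nomizu_coeff W) x y) z = - wform W y (wbracket (nomizu_coeff W) x z)"
proof -
  have Wsym: "\<And>i j. W i j = W j i" using W unfolding adapted_def by blast
  have Wpos: "W i j > 0" for i j using W by (simp add: adapted_def)
  have key: "W i j * nomizu_coeff W i k j * x $ i $ k * y $ k $ j * z $ i $ j
      = - (W k j * nomizu_coeff W k i j * x $ k $ i * z $ i $ j * y $ k $ j)" for i j k
  proof (cases "pp_pair k j \<and> pp_pair i j \<and> i \<noteq> k")
    case True
    have "W i j * nomizu_coeff W i k j = W k j * nomizu_coeff W k i j"
    proof (cases "pp_pair i k")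
      case ik: True
      then show ?thesis
        using True pp_pair_sym[of i k] Wpos[of i j] Wpos[of k j] Wsym[of i k] by (simp add: nomizu_coeff_def)
    next
      case ik: False
      then have "5 \<le> pos i" "5 \<le> pos k" "pos j < 5"
        using True by (auto simp: pp_pair_def)
      then have "W i j = W k j"
        using W unfolding adapted_def by blast
      then show ?thesis using True ik pp_pair_sym[of i k] by (simp add: nomizu_coeff_def)
    qed
    then show ?thesis using so7D[OF x, of i k] by simp
  next
    case False
    then have "x $ i $ k * y $ k $ j * z $ i $ j = 0"
      using y z so7_diag[OF x, of k] by (auto simp: pp_iff)
    then have "x $ i $ k = 0 \<or> y $ k $ j = 0 \<or> z $ i $ j = 0" by simp
    then show ?thesis using so7D[OF x, of i k] by auto
  qed
  have "wform W (wbracket (nomizu_coeff W) x y) z = 2 * (\<Sum>i\<in>UNIV. \<Sum>k\<in>UNIV. \<Sum>j\<in>UNIV.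
      - (W k j * nomizu_coeff W k i j * x $ k $ i * z $ i $ j * y $ k $ j))"
    by (simp only: wform_wbracket[OF Wsym pp_so7[OF z]] key)
  also have "\<dots> = - (2 * (\<Sum>k\<in>UNIV. \<Sum>i\<in>UNIV. \<Sum>j\<in>UNIV.
      W k j * nomizu_coeff W k i j * x $ k $ i * z $ i $ j * y $ k $ j))"
    by (subst sum.swap) (simp only: sum_negf mult_minus_right)
  also have "\<dots> = - wform W (wbracket (nomizu_coeff W) x z) y"
    by (simp only: wform_wbracket[OF Wsym pp_so7[OF y]])
  finally show ?thesis by (simp only: wform_sym)
qed

text \<open>
  The torsion condition, in the form needed for the frame given by the Maurer-Cartan form.
  Entry by entry, the coefficient of \<open>x\<^sub>i\<^sub>k y\<^sub>k\<^sub>j\<close> is \<open>1\<close>: if both positions lie in \<open>pp\<close>, it is a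
  sum of two quotients with the same denominator whose numerators add up to it, and if one
  lies in \<open>hh\<close>, only the isotropy action contributes.
\<close>

lemma nomizu_coeff_torsion:
  assumes W: "adapted W" and x: "x \<in> so7" and y: "y \<in> so7"
  shows "wbracket (nomizu_coeff W) x (pp_part y) - wbracket (nomizu_coeff W) y (pp_part x) = pp_part (x ** y - y ** x)"
proof -
  have Wsym: "\<And>i j. W i j = W j i" using W unfolding adapted_def by blast
  have Wpos: "W i j > 0" for i j using W by (simp add: adapted_def)
  have key: "nomizu_coeff W i k j * x $ i $ k * pp_part y $ k $ j - nomizu_coeff W j k i * x $ j $ k * pp_part y $ k $ i
      - (nomizu_coeff W i k j * y $ i $ k * pp_part x $ k $ j - nomizu_coeff W j k i * y $ j $ k * pp_part x $ k $ i)
      = (if pp_pair i j then x $ i $ k * y $ k $ j - y $ i $ k * x $ k $ j else 0)" for i j k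
  proof (cases "pp_pair i j")
    case False
    then show ?thesis using pp_pair_sym[of i j] by (simp add: nomizu_coeff_def)
  next
    case ij: True
    \<comment> \<open>The coefficient of \<open>x\<^sub>i\<^sub>k y\<^sub>k\<^sub>j\<close>, collected from the two terms in which it occurs.\<close>
    define p :: real where "p = (if pp_pair k j then 1 else 0)"
    define q :: real where "q = (if pp_pair k i then 1 else 0)"
    have c: "(nomizu_coeff W i k j * p + nomizu_coeff W j k i * q) * (a $ i $ k * b $ k $ j) = a $ i $ k * b $ k $ j"
      if ab: "a \<in> so7" "b \<in> so7" for a b
    proof (cases "k = i \<or> k = j")
      case True
      then show ?thesis using so7_diag[OF ab(1), of i] so7_diag[OF ab(2), of j] by auto
    next
      case False
      have ji: "pp_pair j i" using ij pp_pair_sym by blast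
      consider (both) "pp_pair k j" "pp_pair k i" | (kj) "pp_pair k j" "\<not> pp_pair k i"
        | (ki) "\<not> pp_pair k j" "pp_pair k i"
        using ij False by (auto simp: pp_pair_def)
      then have "nomizu_coeff W i k j * p + nomizu_coeff W j k i * q = 1"
      proof cases
        case both
        then have "pp_pair i k" "pp_pair j k" using pp_pair_sym by blast+
        then have "nomizu_coeff W i k j = (W i j + W k j - W i k) / (2 * W i j)"
          "nomizu_coeff W j k i = (W i j + W i k - W k j) / (2 * W i j)"
          using ij ji by (simp_all add: nomizu_coeff_def Wsym[of j i] Wsym[of k i] Wsym[of j k])
        then show ?thesis
          using Wpos[of i j] both by (simp add: p_def q_def add_divide_distrib[symmetric])
      next
        case kj
        then have "\<not> pp_pair i k" using pp_pair_sym by blast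
        then show ?thesis using kj ij by (simp add: p_def q_def nomizu_coeff_def)
      next
        case ki
        then have "\<not> pp_pair j k" using pp_pair_sym by blast
        then show ?thesis using ki ji by (simp add: p_def q_def nomizu_coeff_def)
      qed
      then show ?thesis by simp
    qed
    have pr: "pp_part a $ k $ j = p * a $ k $ j" "pp_part a $ k $ i = q * a $ k $ i" for a
      by (simp_all add: p_def q_def)
    have flip: "x $ j $ k = - x $ k $ j" "x $ k $ i = - x $ i $ k" "y $ j $ k = - y $ k $ j" "y $ k $ i = - y $ i $ k"
      using x y by (auto intro: so7D)
    have "nomizu_coeff W i k j * x $ i $ k * pp_part y $ k $ j - nomizu_coeff W j k i * x $ j $ k * pp_part y $ k $ i
      - (nomizu_coeff W i k j * y $ i $ k * pp_part x $ k $ j - nomizu_coeff W j k i * y $ j $ k * pp_part x $ k $ i)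
      = (nomizu_coeff W i k j * p + nomizu_coeff W j k i * q) * (x $ i $ k * y $ k $ j)
       - (nomizu_coeff W i k j * p + nomizu_coeff W j k i * q) * (y $ i $ k * x $ k $ j)"
      unfolding pr flip by algebra
    then show ?thesis using c[OF x y] c[OF y x] ij by simp
  qed
  have "(wbracket (nomizu_coeff W) x (pp_part y) - wbracket (nomizu_coeff W) y (pp_part x)) $ i $ j = pp_part (x ** y - y ** x) $ i $ j" for i j
  proof -
    have "(wbracket (nomizu_coeff W) x (pp_part y) - wbracket (nomizu_coeff W) y (pp_part x)) $ i $ j = (\<Sum>k\<in>UNIV.
        (if pp_pair i j then x $ i $ k * y $ k $ j - y $ i $ k * x $ k $ j else 0))"
      unfolding vector_minus_component wbracket_nth sum_subtractf[symmetric] key ..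
    then show ?thesis by (simp add: matrix_matrix_mult_def sum_subtractf)
  qed
  then show ?thesis by (simp add: vec_eq_iff)
qed

section \<open>The trace of the curvature\<close>

lemma sum_Basis_mat7:
  fixes f :: "mat7 \<Rightarrow> real"
  shows "(\<Sum>e\<in>Basis. f e) = (\<Sum>a\<in>UNIV. \<Sum>b\<in>UNIV. f (axis a (axis b 1)))"
proof -
  have B: "(Basis :: mat7 set) = (\<lambda>(a, b). axis a (axis b 1)) ` (UNIV \<times> UNIV)"
    by (auto simp: Basis_vec_def)
  have inj: "inj_on (\<lambda>(a, b). axis a (axis b 1) :: mat7) (UNIV \<times> UNIV)"
    by (auto simp: inj_on_def axis_eq_axis)
  show ?thesis
    unfolding B sum.reindex[OF inj] by (simp add: sum.cartesian_product case_prod_unfold)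
qed

lemma unit_nth: "(axis a (axis b 1) :: mat7) $ p $ q = (if p = a then if q = b then 1 else 0 else 0)"
  by (simp add: axis_def)

lemma wbracket_unit_left:
  "wbracket L (axis a (axis b 1)) y $ p $ q
    = (if p = a then L a b q * y $ b $ q else 0) - (if q = a then L a b p * y $ b $ p else 0)"
proof -
  have "wbracket L (axis a (axis b 1)) y $ p $ q = (\<Sum>k\<in>UNIV.
      (if k = b then (if p = a then L a b q * y $ b $ q else 0) else 0)
      - (if k = b then (if q = a then L a b p * y $ b $ p else 0) else 0))"
    unfolding wbracket_nth unit_nth by (intro sum.cong refl) (simp split: if_split)
  then show ?thesis by (simp add: sum_subtractf)
qed

lemma trace_wbracket_left:
  assumes "\<And>i k. L i k i = 0" "y \<in> so7"
  shows "(\<Sum>a\<in>UNIV. \<Sum>b\<in>UNIV. wbracket L (axis a (axis b 1)) y $ a $ b) = 0"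
proof -
  have "wbracket L (axis a (axis b 1)) y $ a $ b = 0" for a b
    using assms(1)[of a b] so7_diag[OF assms(2), of b] by (auto simp: wbracket_unit_left)
  then show ?thesis by simp
qed

text \<open>
  Only the terms in which the two brackets return to the basis matrix they started from
  survive, so the trace is diagonal in the entries of \<open>v\<close> and \<open>w\<close>. The same mechanism works in
  the next lemma, and it is the reason why the Ricci tensor of a diagonal metric is
  diagonal.
\<close>

lemma trace_wbracket_wbracket:
  assumes K: "\<And>i k. K i k i = 0" and L: "\<And>i k. L i k i = 0" and v: "v \<in> so7"
  shows "(\<Sum>a\<in>UNIV. \<Sum>b\<in>UNIV. wbracket K v (wbracket L (axis a (axis b 1)) w) $ a $ b)
    = (\<Sum>b\<in>UNIV. \<Sum>k\<in>UNIV. v $ b $ k * w $ b $ k * (\<Sum>a\<in>UNIV. K b k a * L a b k))"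
proof -
  have t: "K a k b * v $ a $ k * wbracket L (axis a (axis b 1)) w $ k $ b
      - K b k a * v $ b $ k * wbracket L (axis a (axis b 1)) w $ k $ a
      = v $ b $ k * w $ b $ k * (K b k a * L a b k)" for a b k
    using K L so7_diag[OF v] by (simp add: wbracket_unit_left)
  have "(\<Sum>a\<in>UNIV. \<Sum>b\<in>UNIV. wbracket K v (wbracket L (axis a (axis b 1)) w) $ a $ b)
      = (\<Sum>a\<in>UNIV. \<Sum>b\<in>UNIV. \<Sum>k\<in>UNIV. v $ b $ k * w $ b $ k * (K b k a * L a b k))"
    unfolding wbracket_nth[of K] t ..
  also have "\<dots> = (\<Sum>b\<in>UNIV. \<Sum>a\<in>UNIV. \<Sum>k\<in>UNIV. v $ b $ k * w $ b $ k * (K b k a * L a b k))"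
    by (rule sum.swap)
  also have "\<dots> = (\<Sum>b\<in>UNIV. \<Sum>k\<in>UNIV. \<Sum>a\<in>UNIV. v $ b $ k * w $ b $ k * (K b k a * L a b k))"
    by (intro sum.cong refl sum.swap)
  finally show ?thesis by (simp only: sum_distrib_left)
qed

lemma trace_wbracket_bracket:
  assumes K: "\<And>i k. K i k i = 0" and N: "\<And>i k. N i k i = 0" and v: "v \<in> so7" and w: "w \<in> so7"
  shows "(\<Sum>a\<in>UNIV. \<Sum>b\<in>UNIV. wbracket K (wbracket N (axis a (axis b 1)) v) w $ a $ b)
    = - (\<Sum>b\<in>UNIV. \<Sum>k\<in>UNIV. v $ b $ k * w $ b $ k * (\<Sum>a\<in>UNIV. K a k b * N a b k))"
proof -
  have t: "K a k b * wbracket N (axis a (axis b 1)) v $ a $ k * w $ k $ b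
      - K b k a * wbracket N (axis a (axis b 1)) v $ b $ k * w $ k $ a
      = - (v $ b $ k * w $ b $ k * (K a k b * N a b k))" for a b k
    using K N so7_diag[OF v] so7D[OF w, of b k] by (simp add: wbracket_unit_left)
  have "(\<Sum>a\<in>UNIV. \<Sum>b\<in>UNIV. wbracket K (wbracket N (axis a (axis b 1)) v) w $ a $ b)
      = (\<Sum>a\<in>UNIV. \<Sum>b\<in>UNIV. \<Sum>k\<in>UNIV. - (v $ b $ k * w $ b $ k * (K a k b * N a b k)))"
    unfolding wbracket_nth[of K] t ..
  also have "\<dots> = (\<Sum>b\<in>UNIV. \<Sum>a\<in>UNIV. \<Sum>k\<in>UNIV. - (v $ b $ k * w $ b $ k * (K a k b * N a b k)))"
    by (rule sum.swap)
  also have "\<dots> = (\<Sum>b\<in>UNIV. \<Sum>k\<in>UNIV. \<Sum>a\<in>UNIV. - (v $ b $ k * w $ b $ k * (K a k b * N a b k)))"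
    by (intro sum.cong refl sum.swap)
  finally show ?thesis by (simp only: sum_distrib_left sum_negf)
qed

text \<open>
  The coefficient of \<open>v $ b $ k * w $ b $ k\<close> in the Ricci tensor; only
  \<open>ricci_weight W b k + ricci_weight W k b\<close> is determined by the tensor.
\<close>

definition ricci_weight :: "(7 \<Rightarrow> 7 \<Rightarrow> real) \<Rightarrow> 7 \<Rightarrow> 7 \<Rightarrow> real" where
  "ricci_weight W b k = (\<Sum>a\<in>UNIV. nomizu_coeff W a k b * off_diag a b k - nomizu_coeff W b k a * nomizu_coeff W a b k)"

lemma nomizu_coeff_diag: "nomizu_coeff W i k i = 0"
  by (simp add: nomizu_coeff_def pp_pair_def)

text \<open>
  The map \<open>R\<close> is the curvature at the base point, and the three terms are covered by the three
  trace lemmas; the middle one has trace zero.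
\<close>

lemma trace_curvature:
  assumes v: "v \<in> pp" and w: "w \<in> pp"
    and R: "\<And>u. u \<in> pp \<Longrightarrow> R u = - wbracket (nomizu_coeff W) (wbracket off_diag u v) w
      + wbracket (nomizu_coeff W) u (wbracket (nomizu_coeff W) v w) - wbracket (nomizu_coeff W) v (wbracket (nomizu_coeff W) u w)"
  shows "trace_on pp R = (\<Sum>b\<in>UNIV. \<Sum>k\<in>UNIV. v $ b $ k * w $ b $ k * ricci_weight W b k)"
proof -
  interpret A: bounded_bilinear "wbracket (nomizu_coeff W)" by (rule bounded_bilinear_wbracket)
  interpret O: bounded_bilinear "wbracket off_diag" by (rule bounded_bilinear_wbracket)
  define T where "T u = - wbracket (nomizu_coeff W) (wbracket off_diag u v) w
      + wbracket (nomizu_coeff W) u (wbracket (nomizu_coeff W) v w) - wbracket (nomizu_coeff W) v (wbracket (nomizu_coeff W) u w)" for u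
  have lin: "linear T"
    unfolding T_def
    by (intro linearI) (simp_all add: A.add_left A.add_right O.add_left A.scaleR_left A.scaleR_right
        O.scaleR_left scaleR_diff_right scaleR_add_right)
  have Tpp: "T u \<in> pp" for u
    unfolding T_def by (intro subspace_diff subspace_add subspace_neg subspace_pp nomizu_coeff_pp)
  have "trace_on pp R = (\<Sum>e\<in>Basis. T e \<bullet> e)"
    by (rule trace_on_eq_sum[OF subspace_pp lin Tpp]) (simp add: R T_def)
  also have "\<dots> = (\<Sum>a\<in>UNIV. \<Sum>b\<in>UNIV. T (axis a (axis b 1)) $ a $ b)"
    by (simp add: sum_Basis_mat7 inner_axis)
  also have "\<dots> = - (\<Sum>a\<in>UNIV. \<Sum>b\<in>UNIV. wbracket (nomizu_coeff W) (wbracket off_diag (axis a (axis b 1)) v) w $ a $ b)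
      + (\<Sum>a\<in>UNIV. \<Sum>b\<in>UNIV. wbracket (nomizu_coeff W) (axis a (axis b 1)) (wbracket (nomizu_coeff W) v w) $ a $ b)
      - (\<Sum>a\<in>UNIV. \<Sum>b\<in>UNIV. wbracket (nomizu_coeff W) v (wbracket (nomizu_coeff W) (axis a (axis b 1)) w) $ a $ b)"
    by (simp only: T_def vector_minus_component vector_add_component vector_uminus_component
        sum_subtractf sum.distrib sum_negf)
  also have "\<dots> = (\<Sum>b\<in>UNIV. \<Sum>k\<in>UNIV. v $ b $ k * w $ b $ k * (\<Sum>a\<in>UNIV. nomizu_coeff W a k b * off_diag a b k))
      - (\<Sum>b\<in>UNIV. \<Sum>k\<in>UNIV. v $ b $ k * w $ b $ k * (\<Sum>a\<in>UNIV. nomizu_coeff W b k a * nomizu_coeff W a b k))"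
    by (simp add: trace_wbracket_bracket[OF nomizu_coeff_diag _ pp_so7[OF v] pp_so7[OF w]] off_diag_def[of _ _ _, abs_def]
       trace_wbracket_left[OF nomizu_coeff_diag pp_so7[OF nomizu_coeff_pp]] trace_wbracket_wbracket[OF nomizu_coeff_diag nomizu_coeff_diag pp_so7[OF v]])
  also have "\<dots> = (\<Sum>b\<in>UNIV. \<Sum>k\<in>UNIV. v $ b $ k * w $ b $ k * ricci_weight W b k)"
    by (simp only: ricci_weight_def sum_subtractf[symmetric] right_diff_distrib[symmetric])
  finally show ?thesis .
qed

section \<open>The invariant metric in a chart\<close>

text \<open>
  Writing \<open>1 + X/2 = 2 - (1 - X/2)\<close> reduces derivatives of the Cayley transform to those of
  the resolvent.
\<close>

lemma cayley_eq:
  assumes "X \<in> so7"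
  shows "cayley X = 2 *\<^sub>R resolvent X - mat 1"
proof -
  have eq: "mat 1 + (1/2) *\<^sub>R X = 2 *\<^sub>R mat 1 - (mat 1 - (1/2) *\<^sub>R X)"
    by (simp add: scaleR_2)
  have "cayley X = resolvent X ** (2 *\<^sub>R mat 1 - (mat 1 - (1/2) *\<^sub>R X))"
    unfolding cayley_def resolvent_def eq ..
  also have "\<dots> = 2 *\<^sub>R resolvent X - resolvent X ** (mat 1 - (1/2) *\<^sub>R X)"
    by (simp only: mm.diff_right mm.scaleR_right matrix_mul_rid)
  finally show ?thesis by (simp only: resolvent_inverse[OF assms])
qed

lemma dir_deriv_lift_chart:
  assumes X: "X \<in> so7" and u: "u \<in> so7"
  shows "dir_deriv u (lift_chart A) X = A ** (resolvent X ** u ** resolvent X)"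
proof -
  have so: "X + s *\<^sub>R u \<in> so7" for s
    using X u subspace_so7 by (simp add: subspace_add subspace_scale)
  have "((\<lambda>s. A ** (2 *\<^sub>R resolvent (X + s *\<^sub>R u) - mat 1)) has_vector_derivative
      A ** (2 *\<^sub>R ((1/2) *\<^sub>R (resolvent X ** u ** resolvent X)) - 0)) (at 0)"
    by (rule bounded_linear.has_vector_derivative[OF mm.bounded_linear_right]
        bounded_linear.has_vector_derivative[OF bounded_linear_scaleR_right]
        has_vector_derivative_diff has_vector_derivative_const has_vector_derivative_resolvent[OF X u])+
  then show ?thesis
    unfolding dir_deriv_def lift_chart_def cayley_eq[OF so]
    by (simp add: vector_derivative_at)
qed

lemma matrix_inv_lift_chart:
  assumes A: "A \<in> SO7" and X: "X \<in> so7"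
  shows "matrix_inv (lift_chart A X) = (2 *\<^sub>R resolvent (- X) - mat 1) ** transpose A"
proof -
  have AA: "transpose A ** A = mat 1" "A ** transpose A = mat 1"
    using A by (simp_all add: SO7_def orthogonal_matrix_def)
  have c: "(2 *\<^sub>R resolvent Y - mat 1) ** (2 *\<^sub>R resolvent (- Y) - mat 1) = mat 1" if Y: "Y \<in> so7" for Y
  proof -
    have "(2 *\<^sub>R resolvent Y - mat 1) ** (2 *\<^sub>R resolvent (- Y) - mat 1)
        = 2 *\<^sub>R (2 *\<^sub>R (resolvent Y ** resolvent (- Y))) - 2 *\<^sub>R resolvent Y - (2 *\<^sub>R resolvent (- Y) - mat 1)"
      by (simp only: mm.diff_left mm.diff_right mm.scaleR_left mm.scaleR_right matrix_mul_lid
          matrix_mul_rid scaleR_diff_right diff_diff_eq2)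
        (simp add: add.commute)
    also have "\<dots> = mat 1"
      unfolding resolvent_plus_resolvent(1)[OF Y, symmetric] by (simp add: scaleR_add_right)
    finally show ?thesis .
  qed
  have c': "(2 *\<^sub>R resolvent (- X) - mat 1) ** (2 *\<^sub>R resolvent X - mat 1) = mat 1"
    using c[OF uminus_so7[OF X]] by simp
  have l: "lift_chart A X = A ** (2 *\<^sub>R resolvent X - mat 1)"
    by (simp add: lift_chart_def cayley_eq[OF X])
  show ?thesis
    unfolding l
  proof (rule matrix_inv_eqI)
    let ?c = "2 *\<^sub>R resolvent X - mat 1" and ?d = "2 *\<^sub>R resolvent (- X) - mat 1"
    have "A ** ?c ** (?d ** transpose A) = A ** (?c ** ?d) ** transpose A"
      by (simp only: matrix_mul_assoc)
    then show "A ** ?c ** (?d ** transpose A) = mat 1" by (simp only: c[OF X] matrix_mul_rid AA)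
    have "?d ** transpose A ** (A ** ?c) = ?d ** (transpose A ** A) ** ?c"
      by (simp only: matrix_mul_assoc)
    then show "?d ** transpose A ** (A ** ?c) = mat 1" by (simp only: c' matrix_mul_rid AA)
  qed
qed

text \<open>
  The base point \<open>A\<close> drops out, so all charts give the same coordinate expression of the
  metric. This is the homogeneity of the metric.
\<close>

lemma mc_form_lift_chart:
  assumes A: "A \<in> SO7" and X: "X \<in> so7" and u: "u \<in> so7"
  shows "matrix_inv (lift_chart A X) ** dir_deriv u (lift_chart A) X = mc_form X u"
proof -
  have AA: "transpose A ** A = mat 1"
    using A by (simp add: SO7_def orthogonal_matrix_def)
  let ?d = "2 *\<^sub>R resolvent (- X) - mat 1"
  have "matrix_inv (lift_chart A X) ** dir_deriv u (lift_chart A) X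
      = ?d ** (transpose A ** A) ** (resolvent X ** u ** resolvent X)"
    by (simp only: matrix_inv_lift_chart[OF A X] dir_deriv_lift_chart[OF X u] matrix_mul_assoc)
  also have "\<dots> = 2 *\<^sub>R (resolvent (- X) ** resolvent X) ** u ** resolvent X - resolvent X ** u ** resolvent X"
    by (simp add: AA mm.diff_left mm.scaleR_left matrix_mul_assoc)
  also have "\<dots> = mc_form X u"
    by (simp add: resolvent_plus_resolvent(2)[OF X, symmetric] mm.add_left mc_form_def)
  finally show ?thesis .
qed

text \<open>
  On \<open>pp\<close> this is the \<open>pp\<close>-component of the Maurer-Cartan form, which identifies the tangent
  space at \<open>X\<close>, for \<open>X\<close> near \<open>0\<close>, with \<open>pp\<close>. It is extended by the identity on the kernel of
  \<open>pp_part\<close>, so that it becomes an endomorphism of the whole matrix space that is the identity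
  at \<open>X = 0\<close>.
\<close>

definition frame :: "mat7 \<Rightarrow> mat7 \<Rightarrow> mat7" where
  "frame X a = pp_part (mc_form X (pp_part a)) + (a - pp_part a)"

lemma frame_on_pp: "a \<in> pp \<Longrightarrow> frame X a = pp_part (mc_form X a)"
  by (simp add: frame_def pp_part_id)

lemma frame_pp: "X \<in> so7 \<Longrightarrow> a \<in> pp \<Longrightarrow> frame X a \<in> pp"
  by (simp add: frame_on_pp pp_part_pp mc_form_so7 pp_so7)

lemma frame_0: "frame 0 a = a"
  by (simp add: frame_def)

lemma linear_frame: "linear (frame X)"
proof -
  have "frame X = (\<lambda>a. (pp_part \<circ> (mc_form X \<circ> pp_part)) a + (a - pp_part a))"
    by (rule ext) (simp add: frame_def)
  then show ?thesis
    by (simp only:) (intro linear_compose_add linear_compose_sub linear_compose linear_pp_part linear_mc_form linear_ident)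
qed

lemma chart_metric_eq:
  assumes Q: "\<And>a b. a \<in> pp \<Longrightarrow> b \<in> pp \<Longrightarrow> Q a b = wform W a b"
    and A: "A \<in> SO7" and X: "X \<in> pp" and u: "u \<in> pp" and v: "v \<in> pp"
  shows "chart_metric Q A X u v = wform W (frame X u) (frame X v)"
  using X u v
  by (simp add: chart_metric_def mc_form_lift_chart[OF A] pp_so7 proj_pp_eq_pp_part mc_form_so7 Q pp_part_pp frame_on_pp)

lemma has_vector_derivative_frame:
  assumes "X \<in> so7" "Z \<in> so7"
  shows "((\<lambda>s. frame (X + s *\<^sub>R Z) a) has_vector_derivative pp_part (mc_deriv X Z (pp_part a))) (at 0)"
proof -
  have "((\<lambda>s. pp_part (mc_form (X + s *\<^sub>R Z) (pp_part a)) + (a - pp_part a)) has_vector_derivative pp_part (mc_deriv X Z (pp_part a)) + 0) (at 0)"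
    by (intro has_vector_derivative_add has_vector_derivative_const
        bounded_linear.has_vector_derivative[OF bounded_linear_pp_part] has_vector_derivative_mc_form assms)
  then show ?thesis by (simp add: frame_def)
qed

lemma mc_deriv_so7:
  assumes "X \<in> so7" "u \<in> so7" "v \<in> so7"
  shows "mc_deriv X u v \<in> so7"
proof -
  have t: "transpose (resolvent X) = resolvent (- X)" "transpose (resolvent (- X)) = resolvent X" "transpose u = - u" "transpose v = - v"
    using transpose_resolvent[OF assms(1)] transpose_resolvent[OF uminus_so7[OF assms(1)]] assms by (simp_all add: so7_def)
  \<comment> \<open>Transposition exchanges the two terms of \<open>mc_deriv\<close>.\<close>
  have td: "transpose (x - y) = transpose x - transpose y" for x y :: mat7
    by (simp add: vec_eq_iff transpose_def)
  show ?thesis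
    unfolding so7_def mem_Collect_eq mc_deriv_def
    by (simp add: transpose_scalar td matrix_transpose_mul t mat_distrib flip: scaleR_minus_right)
qed

text \<open>
  The two frame lemmas apply with the frame \<open>frame\<close> and with Nomizu's connection evaluated on
  the Maurer-Cartan form: torsion-freeness is the Maurer-Cartan equation together with the
  torsion identity, and skewness is the skewness of Nomizu's map. The result is the
  classical formula \<open>R(u,v)w = A(u) A(v) w - A(v) A(u) w - A([u,v]) w\<close> at the base point,
  whose trace is known.
\<close>

lemma ricci_invariant_metric:
  assumes W: "adapted W" and Q: "\<And>a b. a \<in> pp \<Longrightarrow> b \<in> pp \<Longrightarrow> Q a b = wform W a b"
    and A: "A \<in> SO7" and v: "v \<in> pp" and w: "w \<in> pp"
  shows "ricci pp (chart_metric Q A) 0 v w = (\<Sum>b\<in>UNIV. \<Sum>k\<in>UNIV. v $ b $ k * w $ b $ k * ricci_weight W b k)"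
proof -
  let ?g = "chart_metric Q A" and ?A = "wbracket (nomizu_coeff W)"
  define D where "D y u a = pp_part (mc_deriv y u (pp_part a))" for y u a
  have Wpos: "W i j > 0" for i j using W by (simp add: adapted_def)
  have so0: "0 \<in> so7" by (simp add: subspace_0[OF subspace_so7])
  have d\<theta>: "((\<lambda>t. frame (t *\<^sub>R u) a) has_vector_derivative D 0 u a) (at 0)" if "u \<in> pp" for u a
    using has_vector_derivative_frame[OF so0 pp_so7[OF that], of a] by (simp add: D_def)
  have torsion: "D x a b + ?A (mc_form x a) (frame x b) = D x b a + ?A (mc_form x b) (frame x a)"
    if "x \<in> so7" "a \<in> pp" "b \<in> pp" for x a b
  proof -
    have "?A (mc_form x a) (frame x b) - ?A (mc_form x b) (frame x a) = pp_part (mc_form x a ** mc_form x b - mc_form x b ** mc_form x a)"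
      using that by (simp add: frame_on_pp nomizu_coeff_torsion[OF W] mc_form_so7 pp_so7)
    also have "\<dots> = pp_part (- (mc_deriv x a b - mc_deriv x b a))"
      by (simp add: maurer_cartan[OF that(1)])
    also have "\<dots> = D x b a - D x a b"
      by (simp add: D_def pp_part_id that linear_diff[OF linear_pp_part])
    finally show ?thesis by (simp add: algebra_simps)
  qed
  have frame: "\<forall>\<^sub>F t in nhds 0. frame (t *\<^sub>R u) (christoffel pp ?g (t *\<^sub>R u) a b)
      = D (t *\<^sub>R u) a b + ?A (mc_form (t *\<^sub>R u) a) (frame (t *\<^sub>R u) b)"
    if u: "u \<in> pp" and a: "a \<in> pp" and b: "b \<in> pp" for u a b
  proof -
    have main: "frame x (christoffel pp ?g x a b) = D x a b + ?A (mc_form x a) (frame x b)"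
      if x: "x \<in> pp" and inj: "\<And>y. frame x y = 0 \<Longrightarrow> y = 0" for x
    proof -
      have N: "D x a b + ?A (mc_form x a) (frame x b) \<in> pp"
        unfolding D_def using x a b
        by (intro subspace_add subspace_pp nomizu_coeff_pp pp_part_pp mc_deriv_so7) (simp_all add: pp_so7 pp_part_id)
      \<comment> \<open>An injective linear map of \<open>pp\<close> into itself is onto, so the vector sought exists.\<close>
      have "inj_on (frame x) (span pp)"
        using inj linear_injective_0[OF linear_frame, of x] by (auto intro: inj_on_subset)
      then have "dim (frame x ` pp) = dim pp"
        by (rule dim_image_eq[OF linear_frame])
      moreover have "frame x ` pp \<subseteq> pp"
        using frame_pp[OF pp_so7[OF x]] by blast
      ultimately have "frame x ` pp = pp"
        using subspace_dim_equal[OF linear_subspace_image[OF linear_frame subspace_pp] subspace_pp]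
        by simp
      then obtain w where w: "w \<in> pp" "frame x w = D x a b + ?A (mc_form x a) (frame x b)"
        using N by (metis imageE)
      have "christoffel pp ?g x a b = w"
      proof (rule christoffel_frame[where \<theta> = frame and D = "D x" and C = "\<lambda>u. ?A (mc_form x u)" and Q = "wform W"])
        show "((\<lambda>s. frame (x + s *\<^sub>R z) a) has_vector_derivative D x z a) (at 0)" if "z \<in> pp" for z a
          unfolding D_def by (rule has_vector_derivative_frame) (use x that pp_so7 in auto)
        show "wform W (?A (mc_form x u) a) b = - wform W a (?A (mc_form x u) b)"
          if "u \<in> pp" "a \<in> pp" "b \<in> pp" for u a b
          by (rule nomizu_coeff_skew[OF W mc_form_so7]) (use x that pp_so7 in auto)
        show "?g y a b = wform W (frame y a) (frame y b)" if "y \<in> pp" "a \<in> pp" "b \<in> pp" for y a b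
          by (rule chart_metric_eq[OF Q A that])
        show "D x u v + ?A (mc_form x u) (frame x v) = D x v u + ?A (mc_form x v) (frame x u)"
          if "u \<in> pp" "v \<in> pp" for u v
          by (rule torsion[OF pp_so7[OF x] that])
        show "wform W a a > 0" if "a \<noteq> 0" for a by (rule wform_pos[OF Wpos that])
        show "wform W a b = wform W b a" for a b by (rule wform_sym)
        show "frame x a \<in> pp" if "a \<in> pp" for a by (rule frame_pp[OF pp_so7[OF x] that])
        show "a = 0" if "frame x a = 0" for a by (rule inj[OF that])
      qed (rule subspace_pp x a b w bounded_bilinear_wform linear_frame)+
      then show ?thesis using w by simp
    qed
    \<comment> \<open>Near \<open>0\<close> the frame differs from the identity by at most half the norm, so it is injective.\<close>
    have "\<forall>\<^sub>F t in at 0. \<forall>y. norm (frame (t *\<^sub>R u) y - frame (0 *\<^sub>R u) y) \<le> (1/2) * norm y"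
    proof (rule eventually_linear_perturbation)
      show "((\<lambda>t. frame (t *\<^sub>R u) y) \<longlongrightarrow> frame (0 *\<^sub>R u) y) (at 0)" for y
        using has_vector_derivative_continuous[OF d\<theta>[OF u, of y]] by (simp add: continuous_within)
    qed (simp_all add: linear_frame)
    then have "\<forall>\<^sub>F t in at 0. frame (t *\<^sub>R u) (christoffel pp ?g (t *\<^sub>R u) a b)
      = D (t *\<^sub>R u) a b + ?A (mc_form (t *\<^sub>R u) a) (frame (t *\<^sub>R u) b)"
    proof eventually_elim
      case (elim t)
      show ?case
      proof (rule main)
        show "t *\<^sub>R u \<in> pp" using u by (simp add: subspace_scale[OF subspace_pp])
        fix y assume "frame (t *\<^sub>R u) y = 0"
        then have "norm y \<le> norm y / 2" using elim[rule_format, of y] by (simp add: frame_0)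
        then show "y = 0" by simp
      qed
    qed
    moreover have "frame (0 *\<^sub>R u) (christoffel pp ?g (0 *\<^sub>R u) a b)
      = D (0 *\<^sub>R u) a b + ?A (mc_form (0 *\<^sub>R u) a) (frame (0 *\<^sub>R u) b)"
      by (rule main) (simp_all add: frame_0 subspace_0[OF subspace_pp])
    ultimately show ?thesis by (simp add: eventually_nhds_conv_at)
  qed
  have curv: "curvature pp ?g 0 u v w = - ?A (wbracket off_diag u v) w + ?A u (?A v w) - ?A v (?A u w)"
    if u: "u \<in> pp" for u
  proof -
    interpret A: bounded_bilinear "wbracket (nomizu_coeff W)" by (rule bounded_bilinear_wbracket)
    have "curvature pp ?g 0 u v w = ?A (mc_deriv 0 u v - mc_deriv 0 v u) w + ?A u (?A v w) - ?A v (?A u w)"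
    proof (rule curvature_frame[where \<theta> = frame and D = D and \<omega> = mc_form and D\<omega> = "mc_deriv 0"
          and DD = "\<lambda>u v w. pp_part (mc_deriv2 u v (pp_part w))"])
      show "((\<lambda>t. mc_form (t *\<^sub>R u) v) has_vector_derivative mc_deriv 0 u v) (at 0)" if "u \<in> pp" for u v
        using has_vector_derivative_mc_form[OF so0 pp_so7[OF that]] by simp
      show "((\<lambda>t. D (t *\<^sub>R u) v w) has_vector_derivative pp_part (mc_deriv2 u v (pp_part w))) (at 0)" if "u \<in> pp" for u v w
        unfolding D_def
        by (rule bounded_linear.has_vector_derivative[OF bounded_linear_pp_part has_vector_derivative_mc_deriv[OF pp_so7[OF that]]])
      show "D 0 v w \<in> pp" if "v \<in> pp" "w \<in> pp" for v w
        unfolding D_def by (rule pp_part_pp, rule mc_deriv_so7) (use that so0 pp_so7 pp_part_id in auto)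
      show "pp_part (mc_deriv2 u v (pp_part w)) = pp_part (mc_deriv2 v u (pp_part w))" for u v w
        by (simp only: mc_deriv2_sym)
    qed (rule subspace_pp linear_frame frame_0 mc_form_0 d\<theta> frame u v w bounded_bilinear_wbracket nomizu_coeff_pp; assumption?)+
    then show ?thesis
      using maurer_cartan[OF so0, of u v] wbracket_off_diag[OF pp_so7[OF u] pp_so7[OF v]]
      by (simp flip: A.minus_left)
  qed
  show ?thesis
    unfolding ricci_def by (rule trace_curvature[OF v w curv])
qed

text \<open>
  The weights \<open>ricci_weight W b k\<close> may be symmetrised, because \<open>u $ b $ k * v $ b $ k\<close> is
  symmetric in \<open>b\<close> and \<open>k\<close>.
\<close>

lemma einstein_criterion:
  assumes W: "adapted W" and Q: "\<And>a b. a \<in> pp \<Longrightarrow> b \<in> pp \<Longrightarrow> Q a b = wform W a b"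
    and E: "\<And>i j. pp_pair i j \<Longrightarrow> ricci_weight W i j + ricci_weight W j i = 2 * c * W i j"
  shows "einstein Q"
  unfolding einstein_def
proof (intro exI[of _ c] ballI)
  fix A u v assume A: "A \<in> SO7" and u: "u \<in> pp" and v: "v \<in> pp"
  let ?S = "\<Sum>b\<in>UNIV. \<Sum>k\<in>UNIV. u $ b $ k * v $ b $ k * ricci_weight W b k"
  have "?S = (\<Sum>b\<in>UNIV. \<Sum>k\<in>UNIV. u $ k $ b * v $ k $ b * ricci_weight W k b)"
    by (rule sum.swap)
  also have "\<dots> = (\<Sum>b\<in>UNIV. \<Sum>k\<in>UNIV. u $ b $ k * v $ b $ k * ricci_weight W k b)"
  proof (intro sum.cong refl)
    fix b k
    show "u $ k $ b * v $ k $ b * ricci_weight W k b = u $ b $ k * v $ b $ k * ricci_weight W k b"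
      using so7D[OF pp_so7[OF u], of b k] so7D[OF pp_so7[OF v], of b k] by simp
  qed
  finally have "2 * ?S = (\<Sum>b\<in>UNIV. \<Sum>k\<in>UNIV. u $ b $ k * v $ b $ k * (ricci_weight W b k + ricci_weight W k b))"
    by (simp add: sum.distrib distrib_left)
  also have "\<dots> = (\<Sum>b\<in>UNIV. \<Sum>k\<in>UNIV. 2 * c * (W b k * u $ b $ k * v $ b $ k))"
  proof (intro sum.cong refl)
    fix b k
    show "u $ b $ k * v $ b $ k * (ricci_weight W b k + ricci_weight W k b) = 2 * c * (W b k * u $ b $ k * v $ b $ k)"
    proof (cases "pp_pair b k")
      case True
      then show ?thesis by (simp add: E)
    next
      case False
      then show ?thesis using u by (simp add: pp_iff)
    qed
  qed
  also have "\<dots> = 2 * (c * wform W u v)"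
    by (simp only: wform_def sum_distrib_left mult.assoc)
  finally have "?S = c * wform W u v" by simp
  then show "ricci pp (chart_metric Q A) 0 u v = c * chart_metric Q A 0 u v"
    using ricci_invariant_metric[OF W Q A u v] chart_metric_eq[OF Q A subspace_0[OF subspace_pp] u v]
    by (simp add: frame_0)
qed

section \<open>Weights that are constant on blocks\<close>

lemma pos_less: "pos i < 7"
proof -
  have "card {..<i} < card (UNIV :: 7 set)"
    by (rule psubset_card_mono) auto
  then show ?thesis by (simp add: pos_def)
qed

lemma pos_mono: "i < j \<Longrightarrow> pos i < pos j"
  unfolding pos_def by (rule psubset_card_mono) auto

lemma pos_eq_iff: "pos i = pos j \<longleftrightarrow> i = j"
  by (metis linorder_neqE pos_mono less_irrefl)

lemma bij_pos: "bij_betw pos UNIV {..<7}"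
proof -
  have inj: "inj pos" by (simp add: inj_def pos_eq_iff)
  moreover have "pos ` UNIV = {..<7}"
    by (rule card_subset_eq) (auto simp: pos_less card_image[OF inj])
  ultimately show ?thesis by (simp add: bij_betw_def)
qed

lemma sum_pos: "(\<Sum>i\<in>UNIV. f (pos i)) = f 0 + f 1 + f 2 + f 3 + f 4 + f 5 + f (6::nat)"
  for f :: "nat \<Rightarrow> real"
proof -
  have "(\<Sum>i\<in>UNIV. f (pos i)) = (\<Sum>n<7. f n)"
    by (rule sum.reindex_bij_betw[OF bij_pos])
  then show ?thesis by (simp add: eval_nat_numeral)
qed

text \<open>
  The number of the block of an index, for block sizes \<open>k\<close>, \<open>5 - k\<close> and \<open>2\<close>.
\<close>

definition blk :: "nat \<Rightarrow> 7 \<Rightarrow> nat" where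
  "blk k i = (if pos i < k then 1 else if pos i < 5 then 2 else 3)"

lemma blk_eq_3: "k \<le> 5 \<Longrightarrow> blk k i = 3 \<longleftrightarrow> 5 \<le> pos i"
  by (auto simp: blk_def)

lemma sum_blk:
  fixes G :: "nat \<Rightarrow> real"
  assumes "k = 1 \<or> k = 2"
  shows "(\<Sum>a\<in>UNIV. G (blk k a)) = real k * G 1 + (5 - real k) * G 2 + 2 * G 3"
proof -
  have "(\<Sum>a\<in>UNIV. G (blk k a)) = (\<Sum>a\<in>UNIV. (\<lambda>n. G (if n < k then 1 else if n < 5 then 2 else 3)) (pos a))"
    by (simp only: blk_def)
  also note sum_pos
  finally show ?thesis
    using assms by auto
qed

text \<open>
  The value \<open>1\<close> for the third diagonal block is arbitrary: that block is the isotropy algebra.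
  A positive value keeps the weights positive everywhere.
\<close>

definition block_table :: "real \<Rightarrow> real \<Rightarrow> real \<Rightarrow> real \<Rightarrow> real \<Rightarrow> nat \<Rightarrow> nat \<Rightarrow> real" where
  "block_table x1 x2 x12 x13 x23 p q =
     (if p = 3 \<and> q = 3 then 1 else if p = 3 then (if q = 1 then x13 else x23)
      else if q = 3 then (if p = 1 then x13 else x23)
      else if p = q then (if p = 1 then x1 else x2) else x12)"

definition block_weight :: "nat \<Rightarrow> (nat \<Rightarrow> nat \<Rightarrow> real) \<Rightarrow> 7 \<Rightarrow> 7 \<Rightarrow> real" where
  "block_weight k x i j = 5 * x (blk k i) (blk k j)"

definition block_nomizu_coeff :: "(nat \<Rightarrow> nat \<Rightarrow> real) \<Rightarrow> nat \<Rightarrow> nat \<Rightarrow> nat \<Rightarrow> real" where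
  "block_nomizu_coeff x p q r = (if p = 3 \<and> r = 3 then 0 else if p = 3 \<and> q = 3 then 1
     else (x p r + x q r - x p q) / (2 * x p r))"

text \<open>
  The summand of \<open>ricci_weight\<close> for three distinct indices, as a function of their blocks.
\<close>

definition triple_term :: "(nat \<Rightarrow> nat \<Rightarrow> real) \<Rightarrow> nat \<Rightarrow> nat \<Rightarrow> nat \<Rightarrow> real" where
  "triple_term x p q s = block_nomizu_coeff x s q p - block_nomizu_coeff x p q s * block_nomizu_coeff x s p q"

lemma nomizu_coeff_block_weight:
  assumes "k \<le> 5" "i \<noteq> j" "i \<noteq> l"
  shows "nomizu_coeff (block_weight k x) i l j = block_nomizu_coeff x (blk k i) (blk k l) (blk k j)"
proof -
  have cancel: "(5 * a + 5 * b - 5 * c) / (2 * (5 * d)) = (a + b - c) / (2 * d)" for a b c d :: real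
  proof -
    have "(5 * a + 5 * b - 5 * c) / (2 * (5 * d)) = (5 * (a + b - c)) / (5 * (2 * d))"
      by simp
    then show ?thesis by (simp only: mult_divide_mult_cancel_left_if) simp
  qed
  show ?thesis
    unfolding nomizu_coeff_def block_nomizu_coeff_def block_weight_def pp_pair_def cancel
    using assms(2,3) by (simp add: blk_eq_3[OF assms(1)])
qed

text \<open>
  The summand depends on the third index only through its block, so the sum is a count of
  block sizes. The summands at \<open>a = i\<close> and \<open>a = j\<close> vanish, which accounts for the two subtracted
  terms.
\<close>

lemma ricci_weight_block_weight:
  assumes k: "k = 1 \<or> k = 2" and ij: "i \<noteq> j"
  defines "p \<equiv> blk k i" and "q \<equiv> blk k j"
  shows "ricci_weight (block_weight k x) i j = real k * triple_term x p q 1 + (5 - real k) * triple_term x p q 2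
    + 2 * triple_term x p q 3 - triple_term x p q p - triple_term x p q q"
proof -
  have k5: "k \<le> 5" using k by auto
  have "ricci_weight (block_weight k x) i j = (\<Sum>a\<in>UNIV. triple_term x p q (blk k a)
      - (if a = i then triple_term x p q p else 0) - (if a = j then triple_term x p q q else 0))"
    unfolding ricci_weight_def
  proof (intro sum.cong refl)
    fix a :: 7
    show "nomizu_coeff (block_weight k x) a j i * off_diag a i j
        - nomizu_coeff (block_weight k x) i j a * nomizu_coeff (block_weight k x) a i j
      = triple_term x p q (blk k a) - (if a = i then triple_term x p q p else 0) - (if a = j then triple_term x p q q else 0)"
    proof (cases "a = i \<or> a = j")
      case True
      then show ?thesis using ij by (auto simp: nomizu_coeff_diag p_def q_def off_diag_def)
    next
      case False
      then show ?thesis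
        using ij k5 by (auto simp: nomizu_coeff_block_weight triple_term_def p_def q_def off_diag_def)
    qed
  qed
  then show ?thesis
    by (simp add: sum_subtractf sum_blk[OF k])
qed

text \<open>
  Twenty times the Ricci eigenvalues on \<open>so(k)\<close>, \<open>so(5 - k)\<close>, \<open>m\<^sub>1\<^sub>2\<close>, \<open>m\<^sub>1\<^sub>3\<close> and \<open>m\<^sub>2\<^sub>3\<close>.
\<close>

definition ricci_coeff :: "real \<Rightarrow> real \<Rightarrow> real \<Rightarrow> real \<Rightarrow> real \<Rightarrow> real \<Rightarrow> nat \<Rightarrow> nat \<Rightarrow> real" where
  "ricci_coeff k x1 x2 x12 x13 x23 p q =
     (if p = 1 \<and> q = 1 then (k - 2) / x1 + (5 - k) * x1 / x12^2 + 2 * x1 / x13^2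
      else if p = 2 \<and> q = 2 then (3 - k) / x2 + k * x2 / x12^2 + 2 * x2 / x23^2
      else if p \<noteq> 3 \<and> q \<noteq> 3 then 10 / x12 + 2 * (x12 / (x13 * x23) - x13 / (x12 * x23) - x23 / (x12 * x13))
        - ((k - 1) * x1 + (4 - k) * x2) / x12^2
      else if p = 1 \<or> q = 1 then 10 / x13 + (5 - k) * (x13 / (x12 * x23) - x12 / (x13 * x23) - x23 / (x12 * x13))
        - (k - 1) * x1 / x13^2
      else 10 / x23 + k * (x23 / (x12 * x13) - x12 / (x13 * x23) - x13 / (x12 * x23))
        - (4 - k) * x2 / x23^2)"

lemma triple_term_sum_eq_ricci_coeff:
  fixes k :: real
  assumes x: "x1 > 0" "x2 > 0" "x12 > 0" "x13 > 0" "x23 > 0"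
    and pq: "(p, q) \<in> {(1,1), (2,2), (1,2), (1,3), (2,3)} \<or> (q, p) \<in> {(1,1), (2,2), (1,2), (1,3), (2,3)}"
  fixes x R
  defines "x \<equiv> block_table x1 x2 x12 x13 x23"
  defines "R \<equiv> \<lambda>p q. k * triple_term x p q 1 + (5 - k) * triple_term x p q 2
    + 2 * triple_term x p q 3 - triple_term x p q p - triple_term x p q q"
  shows "R p q + R q p = x p q / 2 * ricci_coeff k x1 x2 x12 x13 x23 p q"
proof -
  have main: "R p q + R q p = x p q / 2 * ricci_coeff k x1 x2 x12 x13 x23 p q"
    if pq': "(p, q) \<in> {(1,1), (2,2), (1,2), (1,3), (2,3)}" for p q
  proof -
    consider "p = 1" "q = 1" | "p = 2" "q = 2" | "p = 1" "q = 2" | "p = 1" "q = 3" | "p = 2" "q = 3"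
      using pq' by auto
    then show ?thesis
      using x unfolding R_def
      by cases (simp_all add: triple_term_def block_nomizu_coeff_def x_def block_table_def ricci_coeff_def
        field_simps power2_eq_square)
  qed
  have "x q p = x p q"
    by (simp add: x_def block_table_def)
  moreover have "ricci_coeff k x1 x2 x12 x13 x23 q p = ricci_coeff k x1 x2 x12 x13 x23 p q"
    by (auto simp: ricci_coeff_def)
  ultimately show ?thesis
    using pq main[of p q] main[of q p] by (metis add.commute)
qed

section \<open>Invariance under block-diagonal rotations\<close>

text \<open>
  The columns outside \<open>I\<close> are unit vectors by definition. A row outside \<open>I\<close> has norm \<open>1\<close> and
  diagonal entry \<open>1\<close>, so it is a unit vector too.
\<close>

lemma SO_on_nonzero:
  assumes A: "A \<in> SO_on I" and pq: "A $ p $ q \<noteq> 0"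
  shows "p = q \<or> p \<in> I \<and> q \<in> I"
proof (rule ccontr)
  assume *: "\<not> ?thesis"
  have col: "A $ i $ j = (if i = j then 1 else 0)" if "j \<notin> I" for i j
  proof -
    have "(A *v axis j 1) $ i = axis j 1 $ i" using A that by (simp add: SO_on_def)
    then show ?thesis
      unfolding matrix_vector_mult_basis by (simp add: column_def axis_def)
  qed
  have q: "q \<in> I" using * col[of q p] pq by auto
  then have p: "p \<notin> I" using * by blast
  have "A ** transpose A = mat 1"
    using A by (simp add: SO_on_def SO7_def orthogonal_matrix_def)
  then have "(A ** transpose A) $ p $ p = 1" by (simp add: mat_def)
  then have "(\<Sum>k\<in>UNIV. A $ p $ k * A $ p $ k) = 1"
    by (simp add: matrix_matrix_mult_def transpose_def)
  moreover have "(\<Sum>k\<in>UNIV. A $ p $ k * A $ p $ k) = A $ p $ p * A $ p $ p + (\<Sum>k\<in>UNIV - {p}. A $ p $ k * A $ p $ k)"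
    by (rule sum.remove) auto
  moreover have "A $ p $ p = 1" using col[OF p] by simp
  ultimately have "(\<Sum>k\<in>UNIV - {p}. A $ p $ k * A $ p $ k) = 0" by simp
  then have "\<forall>k\<in>UNIV - {p}. A $ p $ k * A $ p $ k = 0"
    by (subst (asm) sum_nonneg_eq_0_iff) auto
  then show False using * pq by auto
qed

definition block_diagonal :: "nat list \<Rightarrow> mat7 \<Rightarrow> bool" where
  "block_diagonal ks A \<longleftrightarrow> (\<forall>p q a. A $ p $ q \<noteq> 0 \<longrightarrow> (p \<in> block ks a \<longleftrightarrow> q \<in> block ks a))"

lemma block_disjoint:
  assumes "p \<in> block ks a" "p \<in> block ks b"
  shows "a = b"
proof -
  have mono: "sum_list (take m ks) \<le> sum_list (take n ks)" if "m \<le> n" for m n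
    using that by (metis le_add1 sum_list_append take_add le_add_diff_inverse)
  have "\<not> m < n" if "p \<in> block ks m" "p \<in> block ks n" for m n
  proof
    assume "m < n"
    then have "m \<le> n - 1" by simp
    from mono[OF this] that show False by (simp add: block_def)
  qed
  then show ?thesis using assms by (meson linorder_neqE_nat)
qed

lemma SO_on_block_diagonal:
  assumes "A \<in> SO_on (block ks c)"
  shows "block_diagonal ks A"
  unfolding block_diagonal_def
  using SO_on_nonzero[OF assms] block_disjoint[of _ ks] by metis

lemma block_diagonal_mult:
  assumes "block_diagonal ks A" "block_diagonal ks B"
  shows "block_diagonal ks (A ** B)"
  unfolding block_diagonal_def
proof (intro allI impI)
  fix p q a assume "(A ** B) $ p $ q \<noteq> 0"
  then have "\<exists>k. A $ p $ k * B $ k $ q \<noteq> 0"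
    by (auto simp: matrix_matrix_mult_def dest: sum.not_neutral_contains_not_neutral)
  then show "p \<in> block ks a \<longleftrightarrow> q \<in> block ks a"
    using assms unfolding block_diagonal_def by (metis mult_eq_0_iff)
qed

lemma SO7_mult: "A \<in> SO7 \<Longrightarrow> B \<in> SO7 \<Longrightarrow> A ** B \<in> SO7"
  by (simp add: SO7_def orthogonal_matrix_mul det_mul)

lemma SO_on_SO7: "A \<in> SO_on I \<Longrightarrow> A \<in> SO7"
  by (simp add: SO_on_def)

lemma Ad_eq: "A \<in> SO7 \<Longrightarrow> Ad A X = A ** X ** transpose A"
  unfolding Ad_def by (subst matrix_inv_eqI[of A "transpose A"]) (simp_all add: SO7_def orthogonal_matrix_def)

text \<open>
  A block-diagonal matrix only mixes entries within one block position, so conjugation by it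
  commutes with the mask that cuts out a component.
\<close>

lemma component_Ad:
  assumes A: "A \<in> SO7" "block_diagonal ks A"
  shows "component ks a b (Ad A X) = Ad A (component ks a b X)"
proof -
  let ?m = "\<lambda>i j. i \<in> block ks a \<and> j \<in> block ks b \<or> i \<in> block ks b \<and> j \<in> block ks a"
  have "component ks a b (Ad A X) $ i $ j = Ad A (component ks a b X) $ i $ j" for i j
  proof -
    have e: "Ad A Y $ i $ j = (\<Sum>l\<in>UNIV. \<Sum>k\<in>UNIV. A $ i $ k * Y $ k $ l * A $ j $ l)" for Y
      by (simp add: Ad_eq[OF A(1)] matrix_matrix_mult_def transpose_def sum_distrib_right)
    have t: "A $ i $ k * component ks a b X $ k $ l * A $ j $ l
        = (if ?m i j then A $ i $ k * X $ k $ l * A $ j $ l else 0)" for k l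
    proof (cases "A $ i $ k = 0 \<or> A $ j $ l = 0")
      case False
      then have "?m i j \<longleftrightarrow> ?m k l" using A(2) unfolding block_diagonal_def by blast
      then show ?thesis by (simp add: component_def)
    qed auto
    have c: "component ks a b (Ad A X) $ i $ j = (if ?m i j then Ad A X $ i $ j else 0)"
      by (simp add: component_def)
    show ?thesis
    proof (cases "?m i j")
      case True
      show ?thesis unfolding c e t by (simp only: True if_True)
    next
      case False
      show ?thesis unfolding c e t by (simp only: False if_False sum.neutral_const)
    qed
  qed
  then show ?thesis by (simp add: vec_eq_iff)
qed

lemma killing_Ad:
  assumes A: "A \<in> SO7"
  shows "killing (Ad A X) (Ad A Y) = killing X Y"
proof -
  have AA: "transpose A ** A = mat 1"
    using A by (simp add: SO7_def orthogonal_matrix_def)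
  have "Ad A X ** Ad A Y = A ** (X ** (transpose A ** A) ** Y ** transpose A)"
    by (simp only: Ad_eq[OF A] matrix_mul_assoc)
  then have "trace (Ad A X ** Ad A Y) = trace (X ** Y ** transpose A ** A)"
    by (simp add: AA trace_mul_sym[of A])
  also have "\<dots> = trace (X ** Y)"
    by (simp add: AA flip: matrix_mul_assoc)
  finally show ?thesis by (simp add: killing_def)
qed

lemma part_form_Ad:
  "A \<in> SO7 \<Longrightarrow> block_diagonal ks A \<Longrightarrow> part_form ks a b (Ad A X) (Ad A Y) = part_form ks a b X Y"
  by (simp add: part_form_def component_Ad killing_Ad)

lemma block_group_block_diagonal:
  assumes "A \<in> block_group ks"
  shows "A \<in> SO7" "block_diagonal ks A"
  using assms unfolding block_group_def
  by (auto intro!: SO7_mult block_diagonal_mult intro: SO_on_SO7 SO_on_block_diagonal)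

lemma blk_iff_block:
  "a \<in> {1, 2, 3} \<Longrightarrow> i \<in> block [2,3,2] a \<longleftrightarrow> blk 2 i = a"
  "a \<in> {1, 2, 3} \<Longrightarrow> i \<in> block [1,4,2] a \<longleftrightarrow> blk 1 i = a"
  using pos_less[of i] by (auto simp: block_def blk_def)

lemma Hgrp_block_diagonal:
  assumes "A \<in> Hgrp"
  shows "A \<in> SO7" "block_diagonal [2,3,2] A" "block_diagonal [1,4,2] A"
proof -
  have "{i. 5 \<le> pos i} = block [2,3,2] 3" "{i. 5 \<le> pos i} = block [1,4,2] 3"
    using pos_less by (auto simp: block_def)
  then have "A \<in> SO_on (block [2,3,2] 3)" "A \<in> SO_on (block [1,4,2] 3)"
    using assms unfolding Hgrp_def by metis+
  then show "A \<in> SO7" "block_diagonal [2,3,2] A" "block_diagonal [1,4,2] A"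
    by (blast intro: SO_on_SO7 SO_on_block_diagonal)+
qed

lemma metric_Ad_invariant:
  "A \<in> SO7 \<Longrightarrow> block_diagonal [2,3,2] A \<Longrightarrow>
    metric_232 x1 x2 x12 x13 x23 (Ad A X) (Ad A Y) = metric_232 x1 x2 x12 x13 x23 X Y"
  "A \<in> SO7 \<Longrightarrow> block_diagonal [1,4,2] A \<Longrightarrow>
    metric_142 x2 x12 x13 x23 (Ad A X) (Ad A Y) = metric_142 x2 x12 x13 x23 X Y"
  by (simp_all add: metric_232_def metric_142_def part_form_Ad)

section \<open>The block metrics as weighted forms\<close>

lemma part_form_eq_wform:
  assumes X: "X \<in> so7" and Y: "Y \<in> so7"
  shows "part_form ks a b X Y = wform (\<lambda>i j.
    if i \<in> block ks a \<and> j \<in> block ks b \<or> i \<in> block ks b \<and> j \<in> block ks a then 5 else 0) X Y"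
proof -
  have "- 5 * (component ks a b X $ i $ j * component ks a b Y $ j $ i)
      = (if i \<in> block ks a \<and> j \<in> block ks b \<or> i \<in> block ks b \<and> j \<in> block ks a then 5 else 0) * X $ i $ j * Y $ i $ j" for i j
    using so7D[OF Y, of i j] by (auto simp: component_def)
  then show ?thesis
    by (simp only: part_form_def killing_eq_sum wform_def sum_distrib_left mult_minus_left[symmetric])
      (simp add: sum_distrib_left flip: sum_negf)
qed

lemma wform_cong_pp:
  assumes "\<And>i j. pp_pair i j \<Longrightarrow> W i j = W' i j" "X \<in> pp"
  shows "wform W X Y = wform W' X Y"
proof -
  have eq: "W i j * X $ i $ j * Y $ i $ j = W' i j * X $ i $ j * Y $ i $ j" for i j
    using assms by (cases "pp_pair i j") (auto simp: pp_iff)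
  show ?thesis unfolding wform_def eq ..
qed

lemma wform_linear_weight:
  "wform (\<lambda>i j. W i j + W' i j) X Y = wform W X Y + wform W' X Y"
  "wform (\<lambda>i j. c * W i j) X Y = c * wform W X Y"
  by (simp_all add: wform_def distrib_right sum.distrib sum_distrib_left mult.assoc)

lemma blk_cases: "blk k i = 1 \<or> blk k i = 2 \<or> blk k i = 3"
  by (simp add: blk_def)

lemma block_weight_232:
  assumes "pp_pair i j"
  shows "block_weight 2 (block_table x1 x2 x12 x13 x23) i j =
      x1 * (if i \<in> block [2,3,2] 1 \<and> j \<in> block [2,3,2] 1 \<or> i \<in> block [2,3,2] 1 \<and> j \<in> block [2,3,2] 1 then 5 else 0)
      + x2 * (if i \<in> block [2,3,2] 2 \<and> j \<in> block [2,3,2] 2 \<or> i \<in> block [2,3,2] 2 \<and> j \<in> block [2,3,2] 2 then 5 else 0)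
      + x12 * (if i \<in> block [2,3,2] 1 \<and> j \<in> block [2,3,2] 2 \<or> i \<in> block [2,3,2] 2 \<and> j \<in> block [2,3,2] 1 then 5 else 0)
      + x13 * (if i \<in> block [2,3,2] 1 \<and> j \<in> block [2,3,2] 3 \<or> i \<in> block [2,3,2] 3 \<and> j \<in> block [2,3,2] 1 then 5 else 0)
      + x23 * (if i \<in> block [2,3,2] 2 \<and> j \<in> block [2,3,2] 3 \<or> i \<in> block [2,3,2] 3 \<and> j \<in> block [2,3,2] 2 then 5 else 0)"
proof -
  have B: "l \<in> block [2,3,2] 1 \<longleftrightarrow> blk 2 l = 1" "l \<in> block [2,3,2] 2 \<longleftrightarrow> blk 2 l = 2"
    "l \<in> block [2,3,2] 3 \<longleftrightarrow> blk 2 l = 3" for l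
    by (rule blk_iff_block; simp)+
  have ne: "blk 2 i \<noteq> 3 \<or> blk 2 j \<noteq> 3"
    using assms unfolding pp_pair_def by (simp add: blk_eq_3)
  show ?thesis
    unfolding B block_weight_def block_table_def
    using blk_cases[of 2 i] blk_cases[of 2 j] ne
    by (elim disjE) simp_all
qed

lemma metric_232_eq_wform:
  assumes X: "X \<in> pp" and Y: "Y \<in> pp"
  shows "metric_232 x1 x2 x12 x13 x23 X Y = wform (block_weight 2 (block_table x1 x2 x12 x13 x23)) X Y"
  unfolding metric_232_def part_form_eq_wform[OF pp_so7[OF X] pp_so7[OF Y]] wform_linear_weight[symmetric]
  by (rule wform_cong_pp[OF block_weight_232[symmetric] X])

lemma blk_eq_1: "blk k i = 1 \<longleftrightarrow> pos i < k"
  unfolding blk_def by simp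

lemma blk_1_eq_1: "blk 1 i = 1 \<Longrightarrow> blk 1 j = 1 \<Longrightarrow> i = j"
  unfolding blk_eq_1 using pos_eq_iff[of i j] by linarith

lemma block_weight_142:
  assumes "pp_pair i j"
  shows "block_weight 1 (block_table 1 x2 x12 x13 x23) i j =
      x2 * (if i \<in> block [1,4,2] 2 \<and> j \<in> block [1,4,2] 2 \<or> i \<in> block [1,4,2] 2 \<and> j \<in> block [1,4,2] 2 then 5 else 0)
      + x12 * (if i \<in> block [1,4,2] 1 \<and> j \<in> block [1,4,2] 2 \<or> i \<in> block [1,4,2] 2 \<and> j \<in> block [1,4,2] 1 then 5 else 0)
      + x13 * (if i \<in> block [1,4,2] 1 \<and> j \<in> block [1,4,2] 3 \<or> i \<in> block [1,4,2] 3 \<and> j \<in> block [1,4,2] 1 then 5 else 0)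
      + x23 * (if i \<in> block [1,4,2] 2 \<and> j \<in> block [1,4,2] 3 \<or> i \<in> block [1,4,2] 3 \<and> j \<in> block [1,4,2] 2 then 5 else 0)"
proof -
  have B: "l \<in> block [1,4,2] 1 \<longleftrightarrow> blk 1 l = 1" "l \<in> block [1,4,2] 2 \<longleftrightarrow> blk 1 l = 2"
    "l \<in> block [1,4,2] 3 \<longleftrightarrow> blk 1 l = 3" for l
    by (rule blk_iff_block; simp)+
  have ne: "blk 1 i \<noteq> 3 \<or> blk 1 j \<noteq> 3"
    using assms unfolding pp_pair_def by (simp add: blk_eq_3)
  have ne1: "blk 1 i \<noteq> 1 \<or> blk 1 j \<noteq> 1"
    using assms blk_1_eq_1[of i j] unfolding pp_pair_def by blast
  show ?thesis
    unfolding B block_weight_def block_table_def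
    using blk_cases[of 1 i] blk_cases[of 1 j] ne ne1
    by (elim disjE) simp_all
qed

text \<open>
  The first block is a single index, so the weight \<open>1\<close> chosen for it never meets a nonzero
  entry.
\<close>

lemma metric_142_eq_wform:
  assumes X: "X \<in> pp" and Y: "Y \<in> pp"
  shows "metric_142 x2 x12 x13 x23 X Y = wform (block_weight 1 (block_table 1 x2 x12 x13 x23)) X Y"
  unfolding metric_142_def part_form_eq_wform[OF pp_so7[OF X] pp_so7[OF Y]] wform_linear_weight[symmetric]
  by (rule wform_cong_pp[OF block_weight_142[symmetric] X])

section \<open>Common zeros of two functions of two variables\<close>

text \<open>
  A two-dimensional intermediate value theorem: a fixed point of the map that moves \<open>(a, b)\<close>
  by \<open>- (f, g)\<close> and then clamps to the box must be a common zero, because at a clamped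
  coordinate the sign condition on that edge forces the displacement to be zero.
\<close>

lemma poincare_miranda:
  fixes f g :: "real \<times> real \<Rightarrow> real"
  assumes le: "a0 \<le> a1" "b0 \<le> b1"
    and cont: "continuous_on ({a0..a1} \<times> {b0..b1}) f" "continuous_on ({a0..a1} \<times> {b0..b1}) g"
    and f: "\<And>b. b \<in> {b0..b1} \<Longrightarrow> f (a0, b) \<le> 0" "\<And>b. b \<in> {b0..b1} \<Longrightarrow> f (a1, b) \<ge> 0"
    and g: "\<And>a. a \<in> {a0..a1} \<Longrightarrow> g (a, b0) \<le> 0" "\<And>a. a \<in> {a0..a1} \<Longrightarrow> g (a, b1) \<ge> 0"
  obtains a b where "a \<in> {a0..a1}" "b \<in> {b0..b1}" "f (a, b) = 0" "g (a, b) = 0"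
proof -
  let ?S = "{a0..a1} \<times> {b0..b1}"
  define F where "F z = (max a0 (min a1 (fst z - f z)), max b0 (min b1 (snd z - g z)))" for z
  have "compact ?S" by (intro compact_Times) auto
  moreover have "convex ?S" by (intro convex_Times) auto
  moreover have "?S \<noteq> {}" using le by auto
  moreover have "continuous_on ?S F"
    unfolding F_def using cont by (intro continuous_intros)
  moreover have "F \<in> ?S \<rightarrow> ?S"
    using le by (auto simp: F_def)
  ultimately obtain z where z: "z \<in> ?S" "F z = z"
    by (rule brouwer)
  obtain a b where ab: "z = (a, b)" by (cases z)
  have a: "a \<in> {a0..a1}" and b: "b \<in> {b0..b1}" using z ab by auto
  have fix_a: "max a0 (min a1 (a - f (a, b))) = a" and fix_b: "max b0 (min b1 (b - g (a, b))) = b"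
    using z(2) by (simp_all add: F_def ab)
  have "f (a, b) = 0"
  proof (rule ccontr)
    assume "f (a, b) \<noteq> 0"
    then have "a = a0 \<and> f (a, b) > 0 \<or> a = a1 \<and> f (a, b) < 0"
      using fix_a a by (auto simp: max_def min_def split: if_splits)
    then show False using f[OF b] by auto
  qed
  moreover have "g (a, b) = 0"
  proof (rule ccontr)
    assume "g (a, b) \<noteq> 0"
    then have "b = b0 \<and> g (a, b) > 0 \<or> b = b1 \<and> g (a, b) < 0"
      using fix_b b by (auto simp: max_def min_def split: if_splits)
    then show False using g[OF a] by auto
  qed
  ultimately show thesis using a b that by blast
qed

fun horner :: "real list \<Rightarrow> real \<Rightarrow> real" where
  "horner [] s = 0"
| "horner (c # cs) s = c + s * horner cs s"

text \<open>
  A lower bound on the interval from \<open>0\<close> to \<open>h\<close> that is computed like the Horner scheme itself,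
  with the worst case taken at every stage.
\<close>

fun horner_min :: "real list \<Rightarrow> real \<Rightarrow> real" where
  "horner_min [] h = 0"
| "horner_min (c # cs) h = c + min 0 (h * horner_min cs h)"

lemma horner_min_le:
  assumes "0 \<le> s" "s \<le> h"
  shows "horner_min cs h \<le> horner cs s"
proof (induction cs)
  case (Cons c cs)
  have "min 0 (h * horner_min cs h) \<le> s * horner_min cs h"
  proof (cases "horner_min cs h \<ge> 0")
    case False
    then have "h * horner_min cs h \<le> s * horner_min cs h"
      using assms by (intro mult_right_mono_neg) auto
    then show ?thesis by simp
  next
    case True
    then show ?thesis using assms by (simp add: min.coboundedI1)
  qed
  also have "\<dots> \<le> s * horner cs s"
    using Cons assms by (intro mult_left_mono)
  finally show ?case by simp
qed simp

section \<open>The polynomial systems and their roots\<close>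

text \<open>
  For block sizes 1, 4, 2 put \<open>x\<^sub>2\<^sub>3 = 1\<close>, \<open>a = x\<^sub>1\<^sub>2\<close>, \<open>b = x\<^sub>1\<^sub>3\<close>, and let \<open>r\<^sub>2\<close>, \<open>r\<^sub>1\<^sub>2\<close>, \<open>r\<^sub>1\<^sub>3\<close>,
  \<open>r\<^sub>2\<^sub>3\<close> be the multiples of the Ricci eigenvalues from \<open>ricci_coeff\<close>. The equation
  \<open>r\<^sub>1\<^sub>3 = r\<^sub>2\<^sub>3\<close> is linear in \<open>x\<^sub>2\<close> and gives \<open>3 a b x\<^sub>2 = n142 a b\<close>. With this value of \<open>x\<^sub>2\<close>,
  \<open>r\<^sub>1\<^sub>2 = r\<^sub>1\<^sub>3\<close> becomes \<open>p142 a b = 0\<close> and \<open>r\<^sub>2 = r\<^sub>2\<^sub>3\<close> becomes \<open>q142 a b = 0\<close>.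
\<close>

definition p142 :: "real \<Rightarrow> real \<Rightarrow> real" where
  "p142 a b = 6*a^4 - 10*a^3 - a^2 + 10*a - 5 + 10*a*(a - 1)*b + (5 - 6*a^2)*b^2"

definition n142 :: "real \<Rightarrow> real \<Rightarrow> real" where
  "n142 a b = 10*a*b - 10*a + 3*a^2 - 5*b^2 + 5"

definition q142 :: "real \<Rightarrow> real \<Rightarrow> real" where
  "q142 a b = 18*a^4*b^2 + (n142 a b)^2*(1 + 5*a^2) - 30*a^3*b*n142 a b - 3*a^2*(1 - a^2 - b^2)*n142 a b"

text \<open>
  For block sizes 2, 3, 2, again with \<open>x\<^sub>2\<^sub>3 = 1\<close>, \<open>a = x\<^sub>1\<^sub>2\<close> and \<open>b = x\<^sub>1\<^sub>3\<close>, put \<open>S = a\<^sup>2 + b\<^sup>2\<close>.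
  The equation \<open>r\<^sub>1 = r\<^sub>1\<^sub>3\<close> gives \<open>3 S x\<^sub>1 = a b (t232 a b)\<close>, and \<open>r\<^sub>1\<^sub>3 = r\<^sub>2\<^sub>3\<close> gives
  \<open>6 a b S x\<^sub>2 = c232 a b\<close>. The remaining equations \<open>r\<^sub>1\<^sub>2 = r\<^sub>1\<close> and \<open>r\<^sub>2 = r\<^sub>1\<close> become
  \<open>p232 a b = 0\<close> and \<open>q232 a b = 0\<close>.
\<close>

definition t232 :: "real \<Rightarrow> real \<Rightarrow> real" where
  "t232 a b = 10*a + 3*b^2 - 3*a^2 - 3"

definition c232 :: "real \<Rightarrow> real \<Rightarrow> real" where
  "c232 a b = 30*a*b*(a^2 + b^2) + 6*(1 - a^2 - b^2)*(a^2 + b^2) - t232 a b*(3*b^2 + 2*a^2)"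

definition p232 :: "real \<Rightarrow> real \<Rightarrow> real" where
  "p232 a b = 30*a^2*b*(a^2 + b^2) + 6*a^2*(a^2 - b^2 - 1)*(a^2 + b^2) - c232 a b - a^2*t232 a b*(4*b^2 + 2*a^2)"

definition q232 :: "real \<Rightarrow> real \<Rightarrow> real" where
  "q232 a b = 18*a^4*b^2*(a^2 + b^2)^2 + (c232 a b)^2*(1 + a^2) - a^2*c232 a b*(t232 a b*(3*b^2 + 2*a^2))"

lemmas system_defs = p142_def n142_def q142_def t232_def c232_def p232_def q232_def

lemma continuous_systems:
  "continuous_on S (\<lambda>z. p142 (fst z) (snd z))" "continuous_on S (\<lambda>z. q142 (fst z) (snd z))"
  "continuous_on S (\<lambda>z. p232 (fst z) (snd z))" "continuous_on S (\<lambda>z. q232 (fst z) (snd z))"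
  unfolding system_defs by (intro continuous_intros)+

text \<open>
  Near each root \<open>p\<close> depends mainly on \<open>a\<close> and \<open>q\<close> mainly on \<open>b\<close>, so \<open>p\<close> has constant sign on the two
  edges where \<open>a\<close> is constant and \<open>q\<close> on the other two, already for boxes with small rational
  corners. Such a box was located numerically. The list \<open>?cs\<close> in each step consists of the
  Taylor coefficients of the restriction to an edge (or of its negative) at the lower end of
  that edge. The other three root lemmas follow the same pattern.
\<close>

lemma root_142_first:
  obtains a b where "a \<in> {1..8/7}" "b \<in> {1/5..1/3}" "p142 a b = 0" "q142 a b = 0"
proof -
  have pl: "p142 (1) (b) < 0" if "b \<in> {1/5..1/3}" for b
  proof -
    let ?cs = "[1/25, 2/5, 1]"
    have "- p142 (1) (b) = horner ?cs (b - 1/5)"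
      unfolding system_defs horner.simps power_one by algebra
    moreover have "horner_min ?cs (2/15) > 0" by simp
    moreover have "horner_min ?cs (2/15) \<le> horner ?cs (b - 1/5)"
      by (rule horner_min_le) (use that in auto)
    ultimately show ?thesis by linarith
  qed
  have pr: "p142 (8/7) (b) > 0" if "b \<in> {1/5..1/3}" for b
  proof -
    let ?cs = "[38664/60025, 122/245, -139/49]"
    have "p142 (8/7) (b) = horner ?cs (b - 1/5)"
      unfolding system_defs horner.simps power_one by algebra
    moreover have "horner_min ?cs (2/15) > 0" by simp
    moreover have "horner_min ?cs (2/15) \<le> horner ?cs (b - 1/5)"
      by (rule horner_min_le) (use that in auto)
    ultimately show ?thesis by linarith
  qed
  have ql: "q142 (a) (1/5) > 0" if "a \<in> {1..8/7}" for a
  proof -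
    let ?cs = "[267/125, 2774/125, 4472/125, -1696/25, -1813/25, 42, 54]"
    have "q142 (a) (1/5) = horner ?cs (a - 1)"
      unfolding system_defs horner.simps power_one by algebra
    moreover have "horner_min ?cs (1/7) > 0" by simp
    moreover have "horner_min ?cs (1/7) \<le> horner ?cs (a - 1)"
      by (rule horner_min_le) (use that in auto)
    ultimately show ?thesis by linarith
  qed
  have qr: "q142 (a) (1/3) < 0" if "a \<in> {1..8/7}" for a
  proof -
    let ?cs = "[17/9, 314/81, -848/81, 776/27, 13/9, -74, -54]"
    have "- q142 (a) (1/3) = horner ?cs (a - 1)"
      unfolding system_defs horner.simps power_one by algebra
    moreover have "horner_min ?cs (1/7) > 0" by simp
    moreover have "horner_min ?cs (1/7) \<le> horner ?cs (a - 1)"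
      by (rule horner_min_le) (use that in auto)
    ultimately show ?thesis by linarith
  qed
  show thesis
  proof (rule poincare_miranda[of "1" "8/7" "1/5" "1/3" "\<lambda>z. p142 (fst z) (snd z)" "\<lambda>z. - q142 (fst z) (snd z)"])
    fix a b
    assume "a \<in> {1..8/7}" "b \<in> {1/5..1/3}" "(\<lambda>z. p142 (fst z) (snd z)) (a, b) = 0" "(\<lambda>z. - q142 (fst z) (snd z)) (a, b) = 0"
    then show thesis using that by simp
  qed (use pl pr ql qr in \<open>auto intro!: continuous_systems continuous_on_minus less_imp_le\<close>)
qed

lemma root_142_second:
  obtains a b where "a \<in> {5/8..3/4}" "b \<in> {9/8..5/4}" "p142 a b = 0" "q142 a b = 0"
proof -
  have pl: "p142 (5/8) (b) > 0" if "b \<in> {9/8..5/4}" for b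
  proof -
    let ?cs = "[15/256, 465/128, 85/32]"
    have "p142 (5/8) (b) = horner ?cs (b - 9/8)"
      unfolding system_defs horner.simps power_one by algebra
    moreover have "horner_min ?cs (1/8) > 0" by simp
    moreover have "horner_min ?cs (1/8) \<le> horner ?cs (b - 9/8)"
      by (rule horner_min_le) (use that in auto)
    ultimately show ?thesis by linarith
  qed
  have pr: "p142 (3/4) (b) < 0" if "b \<in> {9/8..5/4}" for b
  proof -
    let ?cs = "[223/512, -57/32, -13/8]"
    have "- p142 (3/4) (b) = horner ?cs (b - 9/8)"
      unfolding system_defs horner.simps power_one by algebra
    moreover have "horner_min ?cs (1/8) > 0" by simp
    moreover have "horner_min ?cs (1/8) \<le> horner ?cs (b - 9/8)"
      by (rule horner_min_le) (use that in auto)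
    ultimately show ?thesis by linarith
  qed
  have ql: "q142 (a) (9/8) < 0" if "a \<in> {5/8..3/4}" for a
  proof -
    let ?cs = "[5175/131072, 67475/4096, 57225/1024, 705/16, -679/8, -285/2, -54]"
    have "- q142 (a) (9/8) = horner ?cs (a - 5/8)"
      unfolding system_defs horner.simps power_one by algebra
    moreover have "horner_min ?cs (1/8) > 0" by simp
    moreover have "horner_min ?cs (1/8) \<le> horner ?cs (a - 5/8)"
      by (rule horner_min_le) (use that in auto)
    ultimately show ?thesis by linarith
  qed
  have qr: "q142 (a) (5/4) > 0" if "a \<in> {5/8..3/4}" for a
  proof -
    let ?cs = "[647175/131072, -184975/8192, -181555/2048, -5245/64, 3505/32, 345/2, 54]"
    have "q142 (a) (5/4) = horner ?cs (a - 5/8)"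
      unfolding system_defs horner.simps power_one by algebra
    moreover have "horner_min ?cs (1/8) > 0" by simp
    moreover have "horner_min ?cs (1/8) \<le> horner ?cs (a - 5/8)"
      by (rule horner_min_le) (use that in auto)
    ultimately show ?thesis by linarith
  qed
  show thesis
  proof (rule poincare_miranda[of "5/8" "3/4" "9/8" "5/4" "\<lambda>z. - p142 (fst z) (snd z)" "\<lambda>z. q142 (fst z) (snd z)"])
    fix a b
    assume "a \<in> {5/8..3/4}" "b \<in> {9/8..5/4}" "(\<lambda>z. - p142 (fst z) (snd z)) (a, b) = 0" "(\<lambda>z. q142 (fst z) (snd z)) (a, b) = 0"
    then show thesis using that by simp
  qed (use pl pr ql qr in \<open>auto intro!: continuous_systems continuous_on_minus less_imp_le\<close>)
qed

lemma root_232_first: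
  obtains a b where "a \<in> {1..8/7}" "b \<in> {2/7..3/7}" "p232 a b = 0" "q232 a b = 0"
proof -
  have pl: "p232 (1) (b) < 0" if "b \<in> {2/7..3/7}" for b
  proof -
    let ?cs = "[832/2401, 880/343, 268/49, 24/7, 3]"
    have "- p232 (1) (b) = horner ?cs (b - 2/7)"
      unfolding system_defs horner.simps power_one by algebra
    moreover have "horner_min ?cs (1/7) > 0" by simp
    moreover have "horner_min ?cs (1/7) \<le> horner ?cs (b - 2/7)"
      by (rule horner_min_le) (use that in auto)
    ultimately show ?thesis by linarith
  qed
  have pr: "p232 (8/7) (b) > 0" if "b \<in> {2/7..3/7}" for b
  proof -
    let ?cs = "[49516/16807, 12580/16807, -25367/2401, -1656/343, -417/49]"
    have "p232 (8/7) (b) = horner ?cs (b - 2/7)"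
      unfolding system_defs horner.simps power_one by algebra
    moreover have "horner_min ?cs (1/7) > 0" by simp
    moreover have "horner_min ?cs (1/7) \<le> horner ?cs (b - 2/7)"
      by (rule horner_min_le) (use that in auto)
    ultimately show ?thesis by linarith
  qed
  have ql: "q232 (a) (2/7) > 0" if "a \<in> {1..8/7}" for a
  proof -
    let ?cs = "[60358440/5764801, 1275197248/5764801, 8157221000/5764801, 3364452432/823543, 752798528/117649, 96124576/16807, 6521160/2401, 134704/343, -9256/49, -480/7]"
    have "q232 (a) (2/7) = horner ?cs (a - 1)"
      unfolding system_defs horner.simps power_one by algebra
    moreover have "horner_min ?cs (1/7) > 0" by simp
    moreover have "horner_min ?cs (1/7) \<le> horner ?cs (a - 1)"
      by (rule horner_min_le) (use that in auto)
    ultimately show ?thesis by linarith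
  qed
  have qr: "q232 (a) (3/7) < 0" if "a \<in> {1..8/7}" for a
  proof -
    let ?cs = "[66300765/5764801, 374030792/5764801, -808424000/5764801, -887904042/823543, -261108203/117649, -37641316/16807, -2651310/2401, -38014/343, 6196/49, 300/7]"
    have "- q232 (a) (3/7) = horner ?cs (a - 1)"
      unfolding system_defs horner.simps power_one by algebra
    moreover have "horner_min ?cs (1/7) > 0" by simp
    moreover have "horner_min ?cs (1/7) \<le> horner ?cs (a - 1)"
      by (rule horner_min_le) (use that in auto)
    ultimately show ?thesis by linarith
  qed
  show thesis
  proof (rule poincare_miranda[of "1" "8/7" "2/7" "3/7" "\<lambda>z. p232 (fst z) (snd z)" "\<lambda>z. - q232 (fst z) (snd z)"])
    fix a b
    assume "a \<in> {1..8/7}" "b \<in> {2/7..3/7}" "(\<lambda>z. p232 (fst z) (snd z)) (a, b) = 0" "(\<lambda>z. - q232 (fst z) (snd z)) (a, b) = 0"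
    then show thesis using that by simp
  qed (use pl pr ql qr in \<open>auto intro!: continuous_systems continuous_on_minus less_imp_le\<close>)
qed

lemma root_232_second:
  obtains a b where "a \<in> {4/7..2/3}" "b \<in> {11/10..6/5}" "p232 a b = 0" "q232 a b = 0"
proof -
  have pl: "p232 (4/7) (b) > 0" if "b \<in> {11/10..6/5}" for b
  proof -
    let ?cs = "[251438627/1176490000, 11991143/600250, 5066239/120050, 8034/245, 447/49]"
    have "p232 (4/7) (b) = horner ?cs (b - 11/10)"
      unfolding system_defs horner.simps power_one by algebra
    moreover have "horner_min ?cs (1/10) > 0" by simp
    moreover have "horner_min ?cs (1/10) \<le> horner ?cs (b - 11/10)"
      by (rule horner_min_le) (use that in auto)
    ultimately show ?thesis by linarith
  qed
  have pr: "p232 (2/3) (b) < 0" if "b \<in> {11/10..6/5}" for b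
  proof -
    let ?cs = "[1345853/810000, -83059/6750, -1491/50, -362/15, -7]"
    have "- p232 (2/3) (b) = horner ?cs (b - 11/10)"
      unfolding system_defs horner.simps power_one by algebra
    moreover have "horner_min ?cs (1/10) > 0" by simp
    moreover have "horner_min ?cs (1/10) \<le> horner ?cs (b - 11/10)"
      by (rule horner_min_le) (use that in auto)
    ultimately show ?thesis by linarith
  qed
  have ql: "q232 (a) (11/10) < 0" if "a \<in> {4/7..2/3}" for a
  proof -
    let ?cs = "[756239800034349/807072140000000, 1106865542004989/14412002500000, 133409234113387/514714375000, 1516738071477/3361400000, 81664063759/600250000, -1039254017/1715000, -1256499/1225, -3844243/4900, -59252/175, -78]"
    have "- q232 (a) (11/10) = horner ?cs (a - 4/7)"
      unfolding system_defs horner.simps power_one by algebra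
    moreover have "horner_min ?cs (2/21) > 0" by simp
    moreover have "horner_min ?cs (2/21) \<le> horner ?cs (a - 4/7)"
      by (rule horner_min_le) (use that in auto)
    ultimately show ?thesis by linarith
  qed
  have qr: "q232 (a) (6/5) > 0" if "a \<in> {4/7..2/3}" for a
  proof -
    let ?cs = "[100940940953136/3152625546875, -78974878866112/450375078125, -32911482214784/64339296875, -242788161024/262609375, -8264483656/37515625, 216813568/214375, 392664/245, 277712/245, 78728/175, 96]"
    have "q232 (a) (6/5) = horner ?cs (a - 4/7)"
      unfolding system_defs horner.simps power_one by algebra
    moreover have "horner_min ?cs (2/21) > 0" by simp
    moreover have "horner_min ?cs (2/21) \<le> horner ?cs (a - 4/7)"
      by (rule horner_min_le) (use that in auto)
    ultimately show ?thesis by linarith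
  qed
  show thesis
  proof (rule poincare_miranda[of "4/7" "2/3" "11/10" "6/5" "\<lambda>z. - p232 (fst z) (snd z)" "\<lambda>z. q232 (fst z) (snd z)"])
    fix a b
    assume "a \<in> {4/7..2/3}" "b \<in> {11/10..6/5}" "(\<lambda>z. - p232 (fst z) (snd z)) (a, b) = 0" "(\<lambda>z. q232 (fst z) (snd z)) (a, b) = 0"
    then show thesis using that by simp
  qed (use pl pr ql qr in \<open>auto intro!: continuous_systems continuous_on_minus less_imp_le\<close>)
qed

section \<open>The Einstein condition for block weights\<close>

text \<open>
  The Einstein equations of a block metric. If \<open>k = 1\<close> there is no eigenvalue on the first
  block.
\<close>

definition ricci_constant :: "nat \<Rightarrow> real \<Rightarrow> real \<Rightarrow> real \<Rightarrow> real \<Rightarrow> real \<Rightarrow> bool" where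
  "ricci_constant k x1 x2 x12 x13 x23 \<longleftrightarrow> (\<exists>\<mu>. \<forall>p q.
     (p, q) \<in> {(2,2), (1,2), (1,3), (2,3)} \<or> k \<noteq> 1 \<and> p = 1 \<and> q = 1 \<longrightarrow>
       ricci_coeff (real k) x1 x2 x12 x13 x23 p q = \<mu>)"

lemma block_table_pos:
  "x1 > 0 \<Longrightarrow> x2 > 0 \<Longrightarrow> x12 > 0 \<Longrightarrow> x13 > 0 \<Longrightarrow> x23 > 0 \<Longrightarrow> block_table x1 x2 x12 x13 x23 p q > 0"
  by (simp add: block_table_def)

lemma block_table_sym: "block_table x1 x2 x12 x13 x23 p q = block_table x1 x2 x12 x13 x23 q p"
  by (simp add: block_table_def)

lemma adapted_block_weight:
  assumes "k \<le> 5" "x1 > 0" "x2 > 0" "x12 > 0" "x13 > 0" "x23 > 0"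
  shows "adapted (block_weight k (block_table x1 x2 x12 x13 x23))"
  unfolding adapted_def block_weight_def
proof (intro conjI allI impI)
  show "5 * block_table x1 x2 x12 x13 x23 (blk k i) (blk k j) > 0" for i j
    using block_table_pos[OF assms(2-6)] by simp
  show "5 * block_table x1 x2 x12 x13 x23 (blk k i) (blk k j) = 5 * block_table x1 x2 x12 x13 x23 (blk k j) (blk k i)" for i j
    by (simp only: block_table_sym[of x1 x2 x12 x13 x23 "blk k i"])
  fix i l j assume "5 \<le> pos i" "5 \<le> pos l"
  then have "blk k i = 3" "blk k l = 3" using blk_eq_3[OF assms(1)] by blast+
  then show "5 * block_table x1 x2 x12 x13 x23 (blk k i) (blk k j) = 5 * block_table x1 x2 x12 x13 x23 (blk k l) (blk k j)"
    by simp
qed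

text \<open>
  A pair of distinct indices that does not lie in \<open>hh\<close> has one of the five block types, and
  the Einstein condition on it is the equation for that type.
\<close>

lemma einstein_block_weight:
  assumes k: "k = 1 \<or> k = 2" and x: "x1 > 0" "x2 > 0" "x12 > 0" "x13 > 0" "x23 > 0"
    and ric: "ricci_constant k x1 x2 x12 x13 x23"
    and Q: "\<And>a b. a \<in> pp \<Longrightarrow> b \<in> pp \<Longrightarrow> Q a b = wform (block_weight k (block_table x1 x2 x12 x13 x23)) a b"
  shows "einstein Q"
proof -
  have k5: "k \<le> 5" using k by auto
  let ?x = "block_table x1 x2 x12 x13 x23" and ?r = "ricci_coeff (real k) x1 x2 x12 x13 x23"
  obtain \<mu> where \<mu>: "?r p q = \<mu>"
    if "(p, q) \<in> {(2,2), (1,2), (1,3), (2,3)} \<or> k \<noteq> 1 \<and> p = 1 \<and> q = 1" for p q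
    using ric unfolding ricci_constant_def by blast
  have rsym: "?r p q = ?r q p" for p q
    by (auto simp: ricci_coeff_def)
  show ?thesis
  proof (rule einstein_criterion[OF adapted_block_weight[OF k5 x] Q, where c = "\<mu> / 20"])
    fix i j assume ij: "pp_pair i j"
    define p where "p = blk k i"
    define q where "q = blk k j"
    have n33: "\<not> (p = 3 \<and> q = 3)"
      using ij unfolding pp_pair_def p_def q_def blk_eq_3[OF k5] by blast
    have n11: "\<not> (k = 1 \<and> p = 1 \<and> q = 1)"
      using ij blk_1_eq_1[of i j] unfolding pp_pair_def p_def q_def by blast
    have pq: "((p, q) \<in> {(2,2), (1,2), (1,3), (2,3)} \<or> k \<noteq> 1 \<and> p = 1 \<and> q = 1)
        \<or> ((q, p) \<in> {(2,2), (1,2), (1,3), (2,3)} \<or> k \<noteq> 1 \<and> q = 1 \<and> p = 1)"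
      using blk_cases[of k i] blk_cases[of k j] n33 n11 unfolding p_def[symmetric] q_def[symmetric]
      by (elim disjE) simp_all
    then have r: "?r p q = \<mu>" using \<mu>[of p q] \<mu>[of q p] rsym[of p q] by metis
    have "(p, q) \<in> {(1,1), (2,2), (1,2), (1,3), (2,3)} \<or> (q, p) \<in> {(1,1), (2,2), (1,2), (1,3), (2,3)}"
      using pq by blast
    note sum_eq = triple_term_sum_eq_ricci_coeff[OF x this, of "real k", unfolded r]
    have ij: "i \<noteq> j" "j \<noteq> i" using ij by (auto simp: pp_pair_def)
    have "ricci_weight (block_weight k ?x) i j + ricci_weight (block_weight k ?x) j i = ?x p q / 2 * \<mu>"
      unfolding ricci_weight_block_weight[OF k ij(1)] ricci_weight_block_weight[OF k ij(2)] p_def[symmetric] q_def[symmetric]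
      by (rule sum_eq)
    then show "ricci_weight (block_weight k ?x) i j + ricci_weight (block_weight k ?x) j i
        = 2 * (\<mu> / 20) * block_weight k ?x i j"
      by (simp add: block_weight_def p_def q_def)
  qed
qed

lemma scalar_product_pp_wform:
  assumes W: "\<And>i j. W i j > 0"
    and Q: "\<And>a b. a \<in> pp \<Longrightarrow> b \<in> pp \<Longrightarrow> Q a b = wform W a b"
  shows "scalar_product_pp Q"
proof -
  interpret w: bounded_bilinear "wform W" by (rule bounded_bilinear_wform)
  show ?thesis
    unfolding scalar_product_pp_def
  proof (intro conjI ballI allI impI)
    fix X Y Z assume X: "X \<in> pp" and Y: "Y \<in> pp" and Z: "Z \<in> pp"
    show "Q X Y = Q Y X" using X Y by (simp add: Q wform_sym)
    show "Q (X + Y) Z = Q X Z + Q Y Z"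
      using X Y Z by (simp add: Q subspace_add[OF subspace_pp] w.add_left)
  next
    fix c X Y assume "X \<in> pp" "Y \<in> pp"
    then show "Q (c *\<^sub>R X) Y = c * Q X Y"
      by (simp add: Q subspace_scale[OF subspace_pp] w.scaleR_left)
  next
    fix X assume "X \<in> pp" "X \<noteq> 0"
    then show "Q X X > 0" using wform_pos[OF W] by (simp add: Q)
  qed
qed

section \<open>Comparison up to scaling\<close>

text \<open>
  Evaluating at these matrices recovers the weights from the form.
\<close>

lemma wform_elem_skew:
  assumes sym: "W i j = W j i" and ne: "i \<noteq> j"
  shows "wform W (elem_skew i j) (elem_skew i j) = 2 * W i j"
proof -
  have "W a b * elem_skew i j $ a $ b * elem_skew i j $ a $ b
        = (if b = j then if a = i then W a b else 0 else 0) + (if b = i then if a = j then W a b else 0 else 0)" for a b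
      using ne by (cases "a = i"; cases "b = j"; simp add: elem_skew_def)
    then have "wform W (elem_skew i j) (elem_skew i j) = W i j + W j i"
      by (simp add: wform_def sum.distrib)
    then show ?thesis using sym by simp
qed

lemma elem_skew_so7: "elem_skew i j \<in> so7"
  unfolding so7_iff
proof (intro allI)
  fix a b
  define P :: "7 \<Rightarrow> 7 \<Rightarrow> real" where "P a b = (if a = i \<and> b = j then 1 else 0)" for a b
  have "elem_skew i j $ a $ b = P a b - P b a" for a b
    unfolding elem_skew_def vec_lambda_beta P_def conj_commute[of "a = j"] ..
  then show "elem_skew i j $ a $ b + elem_skew i j $ b $ a = 0" by simp
qed

lemma elem_skew_pp:
  assumes "pp_pair i j"
  shows "elem_skew i j \<in> pp"
proof -
  have "elem_skew i j $ a $ b = 0" if "\<not> pp_pair a b" for a b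
  proof -
    have "\<not> (a = i \<and> b = j)" "\<not> (a = j \<and> b = i)"
      using assms that by (metis, metis pp_pair_sym)
    then show ?thesis unfolding elem_skew_def vec_lambda_beta by (simp only: if_False diff_self)
  qed
  then show ?thesis unfolding pp_iff using elem_skew_so7 by blast
qed

lemma equal_up_to_scaling_weights:
  assumes Q: "\<And>a b. a \<in> pp \<Longrightarrow> b \<in> pp \<Longrightarrow> Q a b = wform W a b"
    and Q': "\<And>a b. a \<in> pp \<Longrightarrow> b \<in> pp \<Longrightarrow> Q' a b = wform W' a b"
    and sym: "\<And>i j. W i j = W j i" "\<And>i j. W' i j = W' j i"
    and eq: "equal_up_to_scaling Q Q'"
  shows "\<exists>c>0. \<forall>i j. pp_pair i j \<longrightarrow> W i j = c * W' i j"
proof -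
  obtain c where c: "c > 0" "\<forall>X\<in>pp. \<forall>Y\<in>pp. Q X Y = c * Q' X Y"
    using eq unfolding equal_up_to_scaling_def equal_on_pp_def by blast
  have "W i j = c * W' i j" if ij: "pp_pair i j" for i j
  proof -
    have "Q (elem_skew i j) (elem_skew i j) = c * Q' (elem_skew i j) (elem_skew i j)"
      using c(2) elem_skew_pp[OF ij] by blast
    moreover have "i \<noteq> j" using ij by (simp add: pp_pair_def)
    ultimately show ?thesis
      unfolding Q[OF elem_skew_pp[OF ij] elem_skew_pp[OF ij]] Q'[OF elem_skew_pp[OF ij] elem_skew_pp[OF ij]]
      by (simp add: wform_elem_skew[OF sym(1)] wform_elem_skew[OF sym(2)])
  qed
  then show ?thesis using c(1) by blast
qed

text \<open>
  Proportional forms have proportional weights, and the weight \<open>x\<^sub>2\<^sub>3 = 1\<close> fixes the factor.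
  The three conclusions compare the weights at the positions \<open>(0, 2)\<close>, \<open>(0, 5)\<close> and \<open>(1, 5)\<close>,
  counted from \<open>0\<close>; position \<open>1\<close> belongs to the first block only if \<open>k = 2\<close>, and therefore the
  last comparison can also separate metrics with different block sizes.
\<close>

lemma scaling_invariants:
  assumes k: "k = 1 \<or> k = 2" and k': "k' = 1 \<or> k' = 2"
    and Q: "\<And>X Y. X \<in> pp \<Longrightarrow> Y \<in> pp \<Longrightarrow> Q X Y = wform (block_weight k (block_table x1 x2 a b 1)) X Y"
    and Q': "\<And>X Y. X \<in> pp \<Longrightarrow> Y \<in> pp \<Longrightarrow> Q' X Y = wform (block_weight k' (block_table x1' x2' a' b' 1)) X Y"
    and eq: "equal_up_to_scaling Q Q'"
  shows "a = a'" "b = b'" "(if k = 2 then b else 1) = (if k' = 2 then b' else 1)"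
proof -
  let ?W = "block_weight k (block_table x1 x2 a b 1)" and ?W' = "block_weight k' (block_table x1' x2' a' b' 1)"
  have sym: "block_weight m (block_table u1 u2 u3 u4 u5) i j = block_weight m (block_table u1 u2 u3 u4 u5) j i"
    for m u1 u2 u3 u4 u5 i j
    unfolding block_weight_def by (rule arg_cong[OF block_table_sym])
  have "\<exists>c>0. \<forall>i j. pp_pair i j \<longrightarrow> ?W i j = c * ?W' i j"
    by (rule equal_up_to_scaling_weights[OF Q Q' sym sym eq])
  then obtain c where c: "\<And>i j. pp_pair i j \<Longrightarrow> ?W i j = c * ?W' i j" by blast
  have ex: "\<exists>i. pos i = n" if "n < 7" for n
    using bij_pos that unfolding bij_betw_def by (metis imageE lessThan_iff)
  obtain i0 where p0: "pos i0 = 0" using ex[of 0] by auto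
  obtain i1 where p1: "pos i1 = 1" using ex[of 1] by auto
  obtain i2 where p2: "pos i2 = 2" using ex[of 2] by auto
  obtain i5 where p5: "pos i5 = 5" using ex[of 5] by auto
  note pos = p0 p1 p2 p5
  have "pp_pair i j" if "pos i < pos j" "pos i < 5" for i j
    using that unfolding pp_pair_def by auto
  from this[of i0 i2] this[of i0 i5] this[of i1 i5] this[of i2 i5]
  have pp: "pp_pair i0 i2" "pp_pair i0 i5" "pp_pair i1 i5" "pp_pair i2 i5"
    by (simp_all add: pos)
  have bl: "blk l i0 = 1" "blk l i1 = (if l = 2 then 1 else 2)" "blk l i2 = 2" "blk l i5 = 3" if "l = 1 \<or> l = 2" for l
    using that by (simp_all add: blk_def pos) auto
  note w = c[OF pp(1), unfolded block_weight_def bl[OF k] bl[OF k']]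
    c[OF pp(2), unfolded block_weight_def bl[OF k] bl[OF k']]
    c[OF pp(3), unfolded block_weight_def bl[OF k] bl[OF k']]
  have "c = 1"
    using c[OF pp(4), unfolded block_weight_def bl[OF k] bl[OF k']] by (simp add: block_table_def)
  note w = w[unfolded this]
  show "a = a'" using w(1) by (simp add: block_table_def split: if_splits)
  show bb: "b = b'" using w(2) by (simp add: block_table_def)
  show "(if k = 2 then b else 1) = (if k' = 2 then b' else 1)"
    using w(3) bb by (cases "k = 2"; cases "k' = 2") (simp_all add: block_table_def)
qed

section \<open>Solutions of the Einstein equations\<close>

text \<open>
  All five coefficients equal \<open>3 / t + 2 * t\<close> or \<open>10 - 4 * t\<close>, and these agree by the quadratic
  equation.
\<close>

lemma ricci_constant_jensen:
  assumes t: "t > 0" "6 * t^2 - 10 * t + 3 = 0"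
  shows "ricci_constant 2 t t t 1 1"
  unfolding ricci_constant_def
proof (intro exI[of _ "10 - 4 * t"] allI impI)
  fix p q :: nat
  have "3 + 2 * t^2 = t * (10 - 4 * t)" using t(2) by algebra
  then have e: "3 / t + 2 * t = 10 - 4 * t" using t(1) by (simp add: field_simps power2_eq_square)
  assume "(p, q) \<in> {(2,2), (1,2), (1,3), (2,3)} \<or> (2::nat) \<noteq> 1 \<and> p = 1 \<and> q = 1"
  then consider "p = 1" "q = 1" | "p = 2" "q = 2" | "p = 1" "q = 2" | "p = 1" "q = 3" | "p = 2" "q = 3"
    by auto
  then show "ricci_coeff (real 2) t t t 1 1 p q = 10 - 4 * t"
    unfolding e[symmetric]
    by cases (use t e in \<open>simp_all add: ricci_coeff_def power2_eq_square divide_simps, (algebra)?\<close>)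
qed

text \<open>
  The equation \<open>q142 a b = 0\<close> exhibits the product of \<open>a * (10*a*b + 1 - a\<^sup>2 - b\<^sup>2)\<close> and \<open>c\<close> as a
  positive sum, so the value \<open>c\<close> for \<open>x\<^sub>2\<close> is positive.
\<close>

lemma ricci_constant_142:
  assumes a: "a > 0" and b: "b > 0" and pos: "10*a*b + 1 - a^2 - b^2 > 0"
    and p: "p142 a b = 0" and q: "q142 a b = 0"
  shows "\<exists>c>0. ricci_constant 1 1 c a b 1"
proof -
  define c where "c = n142 a b / (3*a*b)"
  have n: "n142 a b = 3*a*b*c" using a b by (simp add: c_def)
  have "9*a^2*b * (a^2*b * (2 + 5*c^2 - 10*c) + b*c^2 - a*(1 - a^2 - b^2)*c) = q142 a b"
    unfolding q142_def n by algebra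
  also note q
  finally have "9*a^2*b * (a^2*b * (2 + 5*c^2 - 10*c) + b*c^2 - a*(1 - a^2 - b^2)*c) = 0" .
  then have q': "a^2*b * (2 + 5*c^2 - 10*c) + b*c^2 - a*(1 - a^2 - b^2)*c = 0"
    using a b by simp
  have "a * (10*a*b + 1 - a^2 - b^2) * c = 2*a^2*b + 5*a^2*b*c^2 + b*c^2"
    using q' by algebra
  also have "\<dots> > 0" using a b by (intro add_pos_nonneg) simp_all
  finally have c: "c > 0" by (rule zero_less_mult_pos) (rule mult_pos_pos[OF a pos])
  define \<mu> where "\<mu> = 10 + (1 - a^2 - b^2) / (a*b) - 3*c"
  have n': "3*a*b*c = 10*a*b - 10*a + 3*a^2 - 5*b^2 + 5" using n by (simp add: n142_def)
  have r23: "ricci_coeff 1 1 c a b 1 2 3 = \<mu>"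
    using a b by (simp add: ricci_coeff_def \<mu>_def field_simps power2_eq_square)
  have r13: "ricci_coeff 1 1 c a b 1 1 3 = \<mu>"
  proof -
    have "a*b*ricci_coeff 1 1 c a b 1 1 3 = 10*a + 4*(b^2 - a^2 - 1)"
      using a b by (simp add: ricci_coeff_def field_simps power2_eq_square)
    also have "\<dots> = 10*a*b + (1 - a^2 - b^2) - 3*a*b*c" using n' by algebra
    also have "\<dots> = a*b*\<mu>" using a b by (simp add: \<mu>_def field_simps)
    finally show ?thesis using a b by simp
  qed
  have r12: "ricci_coeff 1 1 c a b 1 1 2 = \<mu>"
  proof -
    have "a^2*b*ricci_coeff 1 1 c a b 1 1 2 = 10*a*b + 2*a*(a^2 - b^2 - 1) - 3*b*c"
      using a b by (simp add: ricci_coeff_def field_simps power2_eq_square)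
    moreover have "a^2*b*\<mu> = a*(10*a*b + (1 - a^2 - b^2) - 3*a*b*c)"
      using a b by (simp add: \<mu>_def field_simps power2_eq_square)
    moreover have "a * (10*a*b + 2*a*(a^2 - b^2 - 1) - 3*b*c - a*(10*a*b + (1 - a^2 - b^2) - 3*a*b*c)) = 0"
      using n' p unfolding p142_def by algebra
    ultimately have "a * (a^2*b*ricci_coeff 1 1 c a b 1 1 2 - a^2*b*\<mu>) = 0" by simp
    then show ?thesis using a b by simp
  qed
  have r22: "ricci_coeff 1 1 c a b 1 2 2 = \<mu>"
  proof -
    have "a^2*b*c*ricci_coeff 1 1 c a b 1 2 2 = 2*a^2*b + b*c^2 + 2*a^2*b*c^2"
      using a b c by (simp add: ricci_coeff_def field_simps power2_eq_square)
    also have "\<dots> = a*c*(10*a*b + (1 - a^2 - b^2) - 3*a*b*c)" using q' by algebra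
    also have "\<dots> = a^2*b*c*\<mu>" using a b by (simp add: \<mu>_def field_simps power2_eq_square)
    finally show ?thesis using a b c by simp
  qed
  have "ricci_constant 1 1 c a b 1"
    unfolding ricci_constant_def
    by (rule exI[of _ \<mu>]) (use r12 r13 r22 r23 in auto)
  then show ?thesis using c by blast
qed

text \<open>
  As before, positivity of \<open>x\<^sub>2\<close> is forced by the last equation, and positivity of \<open>x\<^sub>1\<close> is that
  of \<open>t232\<close>.
\<close>

lemma ricci_constant_232:
  assumes a: "a > 0" and b: "b > 0" and t: "t232 a b > 0"
    and p: "p232 a b = 0" and q: "q232 a b = 0"
  shows "\<exists>d>0. \<exists>c>0. ricci_constant 2 d c a b 1"
proof -
  define S where "S = a^2 + b^2"
  define T where "T = t232 a b"
  define C where "C = c232 a b"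
  have S: "S > 0" using a by (simp add: S_def add_pos_nonneg)
  define d where "d = a*b*T / (3*S)"
  define c where "c = C / (6*a*b*S)"
  define \<mu> where "\<mu> = T*(3*b^2 + 2*a^2) / (3*a*b*S)"
  have d: "d > 0" using a b S t by (simp add: d_def T_def)
  have d_eq: "3*S*d = a*b*T" using S by (simp add: d_def)
  have c_eq: "6*a*b*S*c = C" using a b S by (simp add: c_def)
  have \<mu>_eq: "3*a*b*S*\<mu> = T*(3*b^2 + 2*a^2)" using a b S by (simp add: \<mu>_def)
  have T_eq: "T = 10*a + 3*b^2 - 3*a^2 - 3" by (simp add: T_def t232_def)
  have C_eq: "C = 30*a*b*S + 6*(1 - S)*S - T*(3*b^2 + 2*a^2)"
    by (simp add: C_def c232_def T_def S_def algebra_simps)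
  have q_eq: "18*a^4*b^2*S^2 + C^2*(1 + a^2) - a^2*C*(T*(3*b^2 + 2*a^2)) = 0"
    using q by (simp add: q232_def C_def T_def S_def)
  have p_eq: "30*a^2*b*S + 6*a^2*(a^2 - b^2 - 1)*S - C - a^2*T*(4*b^2 + 2*a^2) = 0"
    using p by (simp add: p232_def C_def T_def S_def)
  have c: "c > 0"
  proof -
    have "C * (a^2*(T*(3*b^2 + 2*a^2))) = 18*a^4*b^2*S^2 + C^2*(1 + a^2)" using q_eq by algebra
    also have "\<dots> > 0" using a b S by (intro add_pos_nonneg) simp_all
    finally have "C * (a^2*(T*(3*b^2 + 2*a^2))) > 0" .
    moreover have "a^2*(T*(3*b^2 + 2*a^2)) > 0"
      using a b t by (simp add: T_def add_pos_pos)
    ultimately have "C > 0" by (rule zero_less_mult_pos2)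
    then show ?thesis using a b S by (simp add: c_def)
  qed
  have r11: "ricci_coeff 2 d c a b 1 1 1 = \<mu>"
  proof -
    have "3*a^2*b^2*S * ricci_coeff 2 d c a b 1 1 1 = (3*S*d)*(3*b^2 + 2*a^2)"
      using a b by (simp add: ricci_coeff_def field_simps power2_eq_square)
    also have "\<dots> = 3*a^2*b^2*S*\<mu>" using \<mu>_eq unfolding d_eq by algebra
    finally show ?thesis using a b S by simp
  qed
  have r13: "ricci_coeff 2 d c a b 1 1 3 = \<mu>"
  proof -
    have "3*a*b^2*S * ricci_coeff 2 d c a b 1 1 3 = 3*b*S*(10*a + 3*b^2 - 3*a^2 - 3) - a*(3*S*d)"
      using a b by (simp add: ricci_coeff_def field_simps power2_eq_square)
    also have "\<dots> = b*(T*(3*b^2 + 2*a^2))" unfolding d_eq unfolding S_def T_eq by algebra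
    also have "\<dots> = 3*a*b^2*S*\<mu>" unfolding \<mu>_eq[symmetric] by algebra
    finally show ?thesis using a b S by simp
  qed
  have r23: "ricci_coeff 2 d c a b 1 2 3 = \<mu>"
  proof -
    have "3*a*b*S * ricci_coeff 2 d c a b 1 2 3 = 30*a*b*S + 6*(1 - S)*S - 6*a*b*S*c"
      using a b by (simp add: ricci_coeff_def S_def field_simps power2_eq_square)
    also have "\<dots> = 3*a*b*S*\<mu>" unfolding c_eq \<mu>_eq C_eq by algebra
    finally show ?thesis using a b S by simp
  qed
  have r12: "ricci_coeff 2 d c a b 1 1 2 = \<mu>"
  proof -
    have "3*a^3*b*S * ricci_coeff 2 d c a b 1 1 2
        = 30*a^2*b*S + 6*a^2*(a^2 - b^2 - 1)*S - a*b*(3*S*d) - 6*a*b*S*c"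
      using a b by (simp add: ricci_coeff_def field_simps power2_eq_square power3_eq_cube)
    also have "\<dots> = a^2*(T*(3*b^2 + 2*a^2))" unfolding c_eq d_eq using p_eq by algebra
    also have "\<dots> = 3*a^3*b*S*\<mu>" unfolding \<mu>_eq[symmetric] by algebra
    finally show ?thesis using a b S by simp
  qed
  have r22: "ricci_coeff 2 d c a b 1 2 2 = \<mu>"
  proof -
    have "18*a^2*b^2*S^2 * (a^2*c * ricci_coeff 2 d c a b 1 2 2)
        = 18*(a^2*a^2)*b^2*S^2 + (6*a*b*S*c)^2*(1 + a^2)"
      using a b c by (simp add: ricci_coeff_def field_simps power2_eq_square)
    also have "\<dots> = a^2*(6*a*b*S*c)*(3*a*b*S*\<mu>)" unfolding c_eq \<mu>_eq using q_eq by algebra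
    also have "\<dots> = 18*a^2*b^2*S^2 * (a^2*c*\<mu>)" by algebra
    finally show ?thesis using a b c S by simp
  qed
  have "ricci_constant 2 d c a b 1"
    unfolding ricci_constant_def
    by (rule exI[of _ \<mu>]) (use r11 r12 r13 r22 r23 in auto)
  then show ?thesis using c d by blast
qed

section \<open>The six metrics\<close>

lemma jensen_parameter:
  assumes "s^2 = 7"
  shows "6 * ((5 + s) / 6)^2 - 10 * ((5 + s) / 6) + 3 = (0::real)"
proof -
  have "6 * ((5 + s) / 6)^2 - 10 * ((5 + s) / 6) + 3 = (s^2 - 7) / 6"
    by (simp add: power2_eq_square field_simps)
  then show ?thesis using assms by simp
qed

lemma invariant_einstein_232:
  assumes "x1 > 0" "x2 > 0" "x12 > 0" "x13 > 0" "x23 > 0" "ricci_constant 2 x1 x2 x12 x13 x23"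
  shows "invariant_metric (metric_232 x1 x2 x12 x13 x23)" "einstein (metric_232 x1 x2 x12 x13 x23)"
    "Ad_invariant (block_group [2,3,2]) (metric_232 x1 x2 x12 x13 x23)"
proof -
  have W: "block_weight 2 (block_table x1 x2 x12 x13 x23) i j > 0" for i j
    using block_table_pos[OF assms(1-5)] by (simp add: block_weight_def)
  show "einstein (metric_232 x1 x2 x12 x13 x23)"
    by (rule einstein_block_weight[where k = 2]) (use assms metric_232_eq_wform in auto)
  show "invariant_metric (metric_232 x1 x2 x12 x13 x23)"
    unfolding invariant_metric_def Ad_invariant_def
    using scalar_product_pp_wform[OF W metric_232_eq_wform] Hgrp_block_diagonal metric_Ad_invariant(1) by blast
  show "Ad_invariant (block_group [2,3,2]) (metric_232 x1 x2 x12 x13 x23)"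
    unfolding Ad_invariant_def using block_group_block_diagonal metric_Ad_invariant(1) by blast
qed

lemma invariant_einstein_142:
  assumes "x2 > 0" "x12 > 0" "x13 > 0" "x23 > 0" "ricci_constant 1 1 x2 x12 x13 x23"
  shows "invariant_metric (metric_142 x2 x12 x13 x23)" "einstein (metric_142 x2 x12 x13 x23)"
    "Ad_invariant (block_group [1,4,2]) (metric_142 x2 x12 x13 x23)"
proof -
  have W: "block_weight 1 (block_table 1 x2 x12 x13 x23) i j > 0" for i j
    using block_table_pos[OF zero_less_one assms(1-4)] by (simp add: block_weight_def)
  show "einstein (metric_142 x2 x12 x13 x23)"
    by (rule einstein_block_weight[OF _ zero_less_one assms(1-4) assms(5) metric_142_eq_wform]) simp
  show "invariant_metric (metric_142 x2 x12 x13 x23)"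
    unfolding invariant_metric_def Ad_invariant_def
    using scalar_product_pp_wform[OF W metric_142_eq_wform] Hgrp_block_diagonal metric_Ad_invariant(2) by blast
  show "Ad_invariant (block_group [1,4,2]) (metric_142 x2 x12 x13 x23)"
    unfolding Ad_invariant_def using block_group_block_diagonal metric_Ad_invariant(2) by blast
qed

lemma jensen_einstein:
  assumes "t > 0" "6 * t^2 - 10 * t + 3 = 0"
  shows "invariant_metric (jensen t)" "einstein (jensen t)"
  unfolding jensen_def using invariant_einstein_232[OF assms(1) assms(1) assms(1) zero_less_one zero_less_one ricci_constant_jensen[OF assms]]
  by blast+

lemma t232_pos:
  assumes "a \<ge> 4/7" "a \<le> 8/7" "b > 0" "a < 1 \<Longrightarrow> b \<ge> 1"
  shows "t232 a b > 0"
proof -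
  have "a * (3 * a) \<le> a * 4" using assms by (intro mult_left_mono) auto
  then have "3 * a^2 \<le> 4 * a" by (simp add: power2_eq_square)
  moreover have "b^2 \<ge> 1" if "a < 1" using assms(4)[OF that] by simp
  moreover have "b^2 \<ge> 0" by simp
  ultimately show ?thesis
    unfolding t232_def using assms by (cases "a < 1") linarith+
qed

lemma between_multiples_pos:
  fixes a b :: real
  assumes "a > 0" "b > 0" "a \<le> 8 * b" "b \<le> 2 * a"
  shows "10 * a * b + 1 - a^2 - b^2 > 0"
proof -
  have "a * a \<le> a * (8 * b)" "b * b \<le> b * (2 * a)"
    using assms by (intro mult_left_mono; simp)+
  then show ?thesis by (simp add: power2_eq_square algebra_simps)
qed

lemma metric_232_of_the_form:
  assumes "x1 > 0" "x2 > 0" "x12 > 0" "x13 > 0" "x23 > 0"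
  shows "\<exists>y1>0. \<exists>y2>0. \<exists>y12>0. \<exists>y13>0. \<exists>y23>0.
    equal_on_pp (metric_232 x1 x2 x12 x13 x23) (metric_232 y1 y2 y12 y13 y23)"
  by (rule exI[of _ x1], rule conjI[OF assms(1)], rule exI[of _ x2], rule conjI[OF assms(2)], rule exI[of _ x12], rule conjI[OF assms(3)], rule exI[of _ x13], rule conjI[OF assms(4)], rule exI[of _ x23], rule conjI[OF assms(5)])
    (simp add: equal_on_pp_def)

lemma metric_142_of_the_form:
  assumes "x2 > 0" "x12 > 0" "x13 > 0" "x23 > 0"
  shows "\<exists>y2>0. \<exists>y12>0. \<exists>y13>0. \<exists>y23>0.
    equal_on_pp (metric_142 x2 x12 x13 x23) (metric_142 y2 y12 y13 y23)"
  by (rule exI[of _ x2], rule conjI[OF assms(1)], rule exI[of _ x12], rule conjI[OF assms(2)], rule exI[of _ x13], rule conjI[OF assms(3)], rule exI[of _ x23], rule conjI[OF assms(4)])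
    (simp add: equal_on_pp_def)

theorem theorem7p1:
  shows "\<exists>g :: nat \<Rightarrow> form7.
    (\<forall>i<6. invariant_metric (g i) \<and> einstein (g i)) \<and>
    (\<forall>i<6. \<forall>j<6. i \<noteq> j \<longrightarrow> \<not> equal_up_to_scaling (g i) (g j)) \<and>
    equal_on_pp (g 0) (jensen ((5 + sqrt 7) / 6)) \<and>
    equal_on_pp (g 1) (jensen ((5 - sqrt 7) / 6)) \<and>
    (\<forall>i\<in>{2,3}. Ad_invariant (block_group [2,3,2]) (g i) \<and>
       (\<exists>x1>0. \<exists>x2>0. \<exists>x12>0. \<exists>x13>0. \<exists>x23>0.
          equal_on_pp (g i) (metric_232 x1 x2 x12 x13 x23))) \<and>
    (\<forall>i\<in>{4,5}. Ad_invariant (block_group [1,4,2]) (g i) \<and>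
       (\<exists>x2>0. \<exists>x12>0. \<exists>x13>0. \<exists>x23>0.
          equal_on_pp (g i) (metric_142 x2 x12 x13 x23)))"
proof -
  define r where "r = sqrt 7"
  define s where "s = (5 + r) / 6"
  define t where "t = (5 - r) / 6"
  have r: "r > 0" "r < 5" "r^2 = 7" "(- r)^2 = 7" by (simp_all add: r_def real_less_lsqrt)
  have st: "s > 0" "t > 0" "s \<noteq> t" using r(1,2) by (simp_all add: s_def t_def)
  have s: "6 * s^2 - 10 * s + 3 = 0" and t: "6 * t^2 - 10 * t + 3 = 0"
    using jensen_parameter[OF r(3)] jensen_parameter[OF r(4)] by (simp_all add: s_def t_def)
  \<comment> \<open>The values of \<open>b\<close> differ from \<open>1\<close> and lie on both sides of it, for each choice of block sizes.\<close>
  obtain a2 b2 where r2: "a2 \<in> {1..8/7}" "b2 \<in> {2/7..3/7}" "p232 a2 b2 = 0" "q232 a2 b2 = 0"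
    by (rule root_232_first)
  obtain a3 b3 where r3: "a3 \<in> {4/7..2/3}" "b3 \<in> {11/10..6/5}" "p232 a3 b3 = 0" "q232 a3 b3 = 0"
    by (rule root_232_second)
  obtain a4 b4 where r4: "a4 \<in> {1..8/7}" "b4 \<in> {1/5..1/3}" "p142 a4 b4 = 0" "q142 a4 b4 = 0"
    by (rule root_142_first)
  obtain a5 b5 where r5: "a5 \<in> {5/8..3/4}" "b5 \<in> {9/8..5/4}" "p142 a5 b5 = 0" "q142 a5 b5 = 0"
    by (rule root_142_second)
  have pos: "a2 > 0" "b2 > 0" "a3 > 0" "b3 > 0" "a4 > 0" "b4 > 0" "a5 > 0" "b5 > 0"
    using r2 r3 r4 r5 by auto
  obtain d2 c2 where m2: "d2 > 0" "c2 > 0" "ricci_constant 2 d2 c2 a2 b2 1"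
    using ricci_constant_232[OF pos(1,2) t232_pos r2(3,4)] r2 by auto
  obtain d3 c3 where m3: "d3 > 0" "c3 > 0" "ricci_constant 2 d3 c3 a3 b3 1"
    using ricci_constant_232[OF pos(3,4) t232_pos r3(3,4)] r3 by auto
  obtain c4 where m4: "c4 > 0" "ricci_constant 1 1 c4 a4 b4 1"
    using ricci_constant_142[OF pos(5,6) between_multiples_pos[OF pos(5,6)] r4(3,4)] r4 by auto
  obtain c5 where m5: "c5 > 0" "ricci_constant 1 1 c5 a5 b5 1"
    using ricci_constant_142[OF pos(7,8) between_multiples_pos[OF pos(7,8)] r5(3,4)] r5 by auto
  define g where "g = (\<lambda>i::nat. [jensen s, jensen t, metric_232 d2 c2 a2 b2 1, metric_232 d3 c3 a3 b3 1,
    metric_142 c4 a4 b4 1, metric_142 c5 a5 b5 1] ! i)"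
  \<comment> \<open>The size of the first block and the parameters \<open>x\<^sub>1\<^sub>2\<close>, \<open>x\<^sub>1\<^sub>3\<close>; Jensen's metrics are listed for sizes 2, 3, 2.\<close>
  define inv :: "(nat \<times> real \<times> real) list"
    where "inv = [(2, s, 1), (2, t, 1), (2, a2, b2), (2, a3, b3), (1, a4, b4), (1, a5, b5)]"
  \<comment> \<open>The invariants of \<open>scaling_invariants\<close>.\<close>
  define sig where "sig = (\<lambda>(k::nat, a::real, b::real). (a, b, if k = 2 then b else 1))"
  have six: "i = 0 \<or> i = 1 \<or> i = 2 \<or> i = 3 \<or> i = 4 \<or> i = 5" if "i < 6" for i :: nat
    using that by arith
  have normal: "\<exists>x1 x2. \<forall>X\<in>pp. \<forall>Y\<in>pp.
      g i X Y = wform (block_weight (fst (inv ! i)) (block_table x1 x2 (fst (snd (inv ! i))) (snd (snd (inv ! i))) 1)) X Y"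
    if "i < 6" for i
    using six[OF that] metric_232_eq_wform metric_142_eq_wform
    by (elim disjE) (fastforce simp: g_def inv_def jensen_def)+
  have k12: "fst (inv ! i) = 1 \<or> fst (inv ! i) = 2" if "i < 6" for i
    using six[OF that] by (elim disjE) (simp_all add: inv_def)
  have scal: "sig (inv ! i) = sig (inv ! j)"
    if i: "i < 6" and j: "j < 6" and eq: "equal_up_to_scaling (g i) (g j)" for i j
  proof -
    obtain x1 x2 where ni: "\<forall>X\<in>pp. \<forall>Y\<in>pp. g i X Y = wform (block_weight (fst (inv ! i))
        (block_table x1 x2 (fst (snd (inv ! i))) (snd (snd (inv ! i))) 1)) X Y"
      using normal[OF i] by blast
    obtain x1' x2' where nj: "\<forall>X\<in>pp. \<forall>Y\<in>pp. g j X Y = wform (block_weight (fst (inv ! j))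
        (block_table x1' x2' (fst (snd (inv ! j))) (snd (snd (inv ! j))) 1)) X Y"
      using normal[OF j] by blast
    from scaling_invariants[OF k12[OF i] k12[OF j] ni[rule_format] nj[rule_format] eq]
    show ?thesis by (simp add: sig_def case_prod_unfold)
  qed
  have len: "length inv = 6" by (simp add: inv_def)
  have "distinct (map sig inv)"
    using st r2 r3 r4 r5 by (auto simp: inv_def sig_def)
  then have dist: "sig (inv ! i) \<noteq> sig (inv ! j)" if "i < 6" "j < 6" "i \<noteq> j" for i j
    using that len by (metis length_map nth_map nth_eq_iff_index_eq)
  have E: "invariant_metric (g i) \<and> einstein (g i)" if "i < 6" for i
    using six[OF that] jensen_einstein[OF st(1) s] jensen_einstein[OF st(2) t]
      invariant_einstein_232(1,2)[OF m2(1,2) pos(1,2) zero_less_one m2(3)]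
      invariant_einstein_232(1,2)[OF m3(1,2) pos(3,4) zero_less_one m3(3)]
      invariant_einstein_142(1,2)[OF m4(1) pos(5,6) zero_less_one m4(2)]
      invariant_einstein_142(1,2)[OF m5(1) pos(7,8) zero_less_one m5(2)]
    by (elim disjE) (simp_all add: g_def)
  have J: "equal_on_pp (g 0) (jensen ((5 + sqrt 7) / 6))" "equal_on_pp (g 1) (jensen ((5 - sqrt 7) / 6))"
    by (simp_all add: g_def equal_on_pp_def s_def t_def r_def)
  have A: "Ad_invariant (block_group [2,3,2]) (g i) \<and>
       (\<exists>x1>0. \<exists>x2>0. \<exists>x12>0. \<exists>x13>0. \<exists>x23>0. equal_on_pp (g i) (metric_232 x1 x2 x12 x13 x23))"
    if i: "i \<in> {2,3}" for i
  proof -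
    consider "g i = metric_232 d2 c2 a2 b2 1" | "g i = metric_232 d3 c3 a3 b3 1"
      using i by (auto simp: g_def)
    then show ?thesis
    proof cases
      case 1
      show ?thesis unfolding 1
        using invariant_einstein_232(3)[OF m2(1,2) pos(1,2) zero_less_one m2(3)]
          metric_232_of_the_form[OF m2(1,2) pos(1,2) zero_less_one] by (rule conjI)
    next
      case 2
      show ?thesis unfolding 2
        using invariant_einstein_232(3)[OF m3(1,2) pos(3,4) zero_less_one m3(3)]
          metric_232_of_the_form[OF m3(1,2) pos(3,4) zero_less_one] by (rule conjI)
    qed
  qed
  have B: "Ad_invariant (block_group [1,4,2]) (g i) \<and>
       (\<exists>x2>0. \<exists>x12>0. \<exists>x13>0. \<exists>x23>0. equal_on_pp (g i) (metric_142 x2 x12 x13 x23))"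
    if i: "i \<in> {4,5}" for i
  proof -
    consider "g i = metric_142 c4 a4 b4 1" | "g i = metric_142 c5 a5 b5 1"
      using i by (auto simp: g_def)
    then show ?thesis
    proof cases
      case 1
      show ?thesis unfolding 1
        using invariant_einstein_142(3)[OF m4(1) pos(5,6) zero_less_one m4(2)]
          metric_142_of_the_form[OF m4(1) pos(5,6) zero_less_one] by (rule conjI)
    next
      case 2
      show ?thesis unfolding 2
        using invariant_einstein_142(3)[OF m5(1) pos(7,8) zero_less_one m5(2)]
          metric_142_of_the_form[OF m5(1) pos(7,8) zero_less_one] by (rule conjI)
    qed
  qed
  show ?thesis
  proof (intro exI[of _ g] conjI allI impI ballI)
    fix i :: nat assume i: "i < 6"
    show "invariant_metric (g i)" "einstein (g i)" using E[OF i] by simp_all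
    fix j :: nat assume j: "j < 6" "i \<noteq> j"
    show "\<not> equal_up_to_scaling (g i) (g j)"
      using scal[OF i j(1)] dist[OF i j] by (rule contrapos_nn[rotated])
  next
    show "equal_on_pp (g 0) (jensen ((5 + sqrt 7) / 6))" "equal_on_pp (g 1) (jensen ((5 - sqrt 7) / 6))"
      by (rule J)+
  next
    fix i :: nat assume "i \<in> {2,3}"
    from A[OF this] show "Ad_invariant (block_group [2,3,2]) (g i)"
      "\<exists>x1>0. \<exists>x2>0. \<exists>x12>0. \<exists>x13>0. \<exists>x23>0. equal_on_pp (g i) (metric_232 x1 x2 x12 x13 x23)"
      by (rule conjunct1, rule conjunct2)
  next
    fix i :: nat assume "i \<in> {4,5}"
    from B[OF this] show "Ad_invariant (block_group [1,4,2]) (g i)"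
      "\<exists>x2>0. \<exists>x12>0. \<exists>x13>0. \<exists>x23>0. equal_on_pp (g i) (metric_142 x2 x12 x13 x23)"
      by (rule conjunct1, rule conjunct2)
  qed
qed

end
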